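(* Among ellipses of given diameter, the disk strictly minimizes each eigenvalue of the Neumann Laplacian. That is, for each integer $j\geq 2$, if $\mathcal{E}$ is a (solid) ellipse in the plane that is not a disk and $B$ is a disk, then \[ \mu_j(\mathcal{E})\, D(\mathcal{E})^2 > \mu_j(B)\, D(B)^2 . \]
   Context: For a bounded Lipschitz domain $\Omega$ in the plane, $D(\Omega)$ denotes its diameter, and $0=\mu_1(\Omega)<\mu_2(\Omega)\leq\mu_3(\Omega)\leq\cdots\to\infty$ denote the eigenvalues, counted with multiplicity, of the Neumann Laplacian on $\Omega$: $-\Delta u=\mu u$ in $\Omega$ with natural boundary condition $\partial u/\partial n=0$ on $\partial \Omega$ (weak formulation, with Rayleigh quotient $\int_\Omega|\nabla u|^2/\int_\Omega u^2$ over $u\in H^1(\Omega)$). An ellipse here means the open region enclosed by an ellipse; disks are ellipses. *)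

theory Defs
  imports "HOL-Analysis.Analysis"
begin

section \<open>The Sobolev space $H^1$\<close>

fun C_k :: "nat \<Rightarrow> ('a::euclidean_space \<Rightarrow> real) \<Rightarrow> bool" where
  "C_k 0 f \<longleftrightarrow> continuous_on UNIV f"
| "C_k (Suc k) f \<longleftrightarrow>
     (\<forall>x. f differentiable at x) \<and> (\<forall>b\<in>Basis. C_k k (\<lambda>x. frechet_derivative f (at x) b))"

definition test_function :: "'a::euclidean_space set \<Rightarrow> ('a \<Rightarrow> real) \<Rightarrow> bool" where
  "test_function \<Omega> \<phi> \<longleftrightarrow>
     (\<forall>k. C_k k \<phi>) \<and> compact (closure {x. \<phi> x \<noteq> 0}) \<and> closure {x. \<phi> x \<noteq> 0} \<subseteq> \<Omega>"

definition L2 :: "'a::euclidean_space set \<Rightarrow> ('a \<Rightarrow> real) set" where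
  "L2 \<Omega> = {u. u \<in> borel_measurable (lebesgue_on \<Omega>) \<and> integrable (lebesgue_on \<Omega>) (\<lambda>x. (u x)\<^sup>2)}"

text \<open>Elements of $L^2$ and $H^1$ are represented by functions rather than by classes modulo null
  sets.  The weak gradient of \<open>u\<close> is unique only almost everywhere, so membership in $H^1$ is a
  relation between \<open>u\<close> and a representative \<open>g\<close> of its weak gradient.\<close>

definition H1_grad :: "'a::euclidean_space set \<Rightarrow> ('a \<Rightarrow> real) \<Rightarrow> ('a \<Rightarrow> 'a) \<Rightarrow> bool" where
  "H1_grad \<Omega> u g \<longleftrightarrow>
     u \<in> L2 \<Omega> \<and>
     (\<forall>b\<in>Basis. (\<lambda>x. g x \<bullet> b) \<in> L2 \<Omega> \<and>
       (\<forall>\<phi>. test_function \<Omega> \<phi> \<longrightarrow>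
         (LINT x|lebesgue_on \<Omega>. u x * frechet_derivative \<phi> (at x) b) =
         - (LINT x|lebesgue_on \<Omega>. (g x \<bullet> b) * \<phi> x)))"

section \<open>Neumann eigenvalues\<close>

definition neumann_eigenspace :: "'a::euclidean_space set \<Rightarrow> real \<Rightarrow> ('a \<Rightarrow> real) set" where
  "neumann_eigenspace \<Omega> \<mu> =
     {u. \<exists>g. H1_grad \<Omega> u g \<and>
        (\<forall>v h. H1_grad \<Omega> v h \<longrightarrow>
          (LINT x|lebesgue_on \<Omega>. g x \<bullet> h x) = \<mu> * (LINT x|lebesgue_on \<Omega>. u x * v x))}"

text \<open>The eigenspace modulo functions vanishing almost everywhere has dimension \<open>n\<close>; in
  particular \<open>\<mu>\<close> is an eigenvalue iff the dimension is not 0.\<close>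

definition neumann_multiplicity :: "'a::euclidean_space set \<Rightarrow> real \<Rightarrow> nat \<Rightarrow> bool" where
  "neumann_multiplicity \<Omega> \<mu> n \<longleftrightarrow>
     (\<exists>u :: nat \<Rightarrow> 'a \<Rightarrow> real.
        (\<forall>i<n. u i \<in> neumann_eigenspace \<Omega> \<mu>) \<and>
        (\<forall>c. (AE x in lebesgue_on \<Omega>. (\<Sum>i<n. c i * u i x) = 0) \<longrightarrow> (\<forall>i<n. c i = 0)) \<and>
        (\<forall>v \<in> neumann_eigenspace \<Omega> \<mu>. \<exists>c. AE x in lebesgue_on \<Omega>. v x = (\<Sum>i<n. c i * u i x)))"

text \<open>Sequences are indexed from 1; the value at index 0 is irrelevant.  Each level set of \<open>m\<close>
  is finite because \<open>m\<close> tends to infinity, so \<open>card\<close> is a genuine count.\<close>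

definition neumann_spectrum :: "'a::euclidean_space set \<Rightarrow> (nat \<Rightarrow> real) \<Rightarrow> bool" where
  "neumann_spectrum \<Omega> m \<longleftrightarrow>
     mono_on {1..} m \<and> filterlim m at_top sequentially \<and>
     (\<forall>\<mu>. neumann_multiplicity \<Omega> \<mu> (card {j\<in>{1..}. m j = \<mu>}))"

definition neumann_eigenvalue :: "'a::euclidean_space set \<Rightarrow> nat \<Rightarrow> real" where
  "neumann_eigenvalue \<Omega> j = (THE \<mu>. \<exists>m. neumann_spectrum \<Omega> m \<and> m j = \<mu>)"

section \<open>Ellipses and disks\<close>

text \<open>Solid open ellipse with centre \<open>c\<close>, orthonormal axis directions \<open>e\<close>, \<open>f\<close> and
  semi-axes \<open>a\<close>, \<open>b\<close>.\<close>

definition is_ellipse :: "(real^2) set \<Rightarrow> bool" where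
  "is_ellipse E \<longleftrightarrow>
     (\<exists>c e f a b. norm e = 1 \<and> norm f = 1 \<and> e \<bullet> f = 0 \<and> a > 0 \<and> b > 0 \<and>
        E = {x. (((x - c) \<bullet> e) / a)\<^sup>2 + (((x - c) \<bullet> f) / b)\<^sup>2 < 1})"

definition is_disk :: "(real^2) set \<Rightarrow> bool" where
  "is_disk B \<longleftrightarrow> (\<exists>c r. r > 0 \<and> B = ball c r)"

end

theory Submission
  imports Defs "HOL-Library.Diagonal_Subsequence" "HOL-Library.Nat_Bijection"
begin

text \<open>Pull the Dirichlet form of an ellipse with semi-axes \<open>a \<ge> b\<close> back to the unit disc by an affine map:
  up to the factor \<open>a\<^sup>-\<^sup>2\<close> it becomes $\int g_1 h_1 + \kappa\, g_2 h_2$ with \<open>\<kappa> = (a / b)\<^sup>2 \<ge> 1\<close>, while the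
  disk corresponds to \<open>\<kappa> = 1\<close>.  The min-max principle makes every eigenvalue nondecreasing in \<open>\<kappa>\<close>, and
  equality would produce an eigenfunction whose second derivative vanishes; testing its equation with
  $\partial_2 ((1 - |x|^2) W)$ forces it to be constant.

  Compactness of $H^1 \subset L^2$ needs no mollification: the degenerate energy with matrix
  $I - x x^T$ is bounded by the Dirichlet integral, and its operator is triangular on polynomials
  with diagonal \<open>n(n+2)\<close>, so orthonormal polynomials diagonalise it.\<close>

section \<open>Spectral theory of a form with compact embedding\<close>

text \<open>The diameter enters only at the end: it is exactly 2r for the disk and at least 2a for
  the ellipse, so what remains is a strict inequality between eigenvalues of two forms on one space.
  Classically, an eigenfunction u depending on x1 only satisfies the natural boundary condition n1
  u' = 0 on the circle, and since the circle projects onto the whole interval, u' = 0 throughout.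
  Here u is merely in H^1, so this condition is read off by testing: a second partial derivative of
  something vanishing on the circle is orthogonal to u, and moving derivatives back leaves x1 u'
  against arbitrary polynomials. A constant eigenfunction has eigenvalue 0, which j >= 2 excludes
  because the constants form a line. The matrix I - x x^T comes from the Zernike polynomials, the
  orthogonal polynomials of the disc, which are eigenfunctions of -div((I - x x^T) grad). It
  annihilates the normal on the circle, so integration by parts leaves no boundary term, and it lies
  between 0 and I.\<close>

lemma linear_coefficient_zero:
  fixes B C :: real
  assumes "\<And>t. 0 \<le> 2 * t * B + t\<^sup>2 * C"
  shows "B = 0"
proof (rule ccontr)
  assume "B \<noteq> 0"
  define D where "D = \<bar>C\<bar> + 1"
  have D: "D > 0" "C < D" by (auto simp: D_def)
  have "0 \<le> 2 * (- B / D) * B + (- B / D)\<^sup>2 * C" by (rule assms)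
  also have "\<dots> = (B\<^sup>2 / D) * (C / D - 2)"
    using D by (simp add: field_simps power2_eq_square)
  finally have "0 \<le> (B\<^sup>2 / D) * (C / D - 2)" .
  moreover have "C / D - 2 < 0" using D by (simp add: field_simps)
  moreover have "B\<^sup>2 / D > 0" using \<open>B \<noteq> 0\<close> D by simp
  ultimately show False by (meson mult_pos_neg not_less)
qed

text \<open>\<open>H\<close> plays the graph of the weak gradient, and \<open>\<alpha>\<close> sees
  the gradient component only, so that two forms can share one \<open>H\<close> when they are
  compared. Coercivity concerns the gradient alone, so constants may have zero energy;
  \<open>infinite_dim\<close> ensures that successive minimisation never runs out of
  vectors.\<close>

locale energy_form =
  fixes H :: "('u::{real_inner,complete_space} \<times> 'g::{real_inner,complete_space}) set"
    and \<alpha> :: "'g \<Rightarrow> 'g \<Rightarrow> real"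
  assumes subspace: "subspace H"
    and closed: "closed H"
    and bilinear: "bounded_bilinear \<alpha>"
    and sym: "\<alpha> g h = \<alpha> h g"
    and coercive: "\<exists>c>0. \<forall>g. c * (norm g)\<^sup>2 \<le> \<alpha> g g"
    and compact: "range x \<subseteq> H \<Longrightarrow> bounded (range x) \<Longrightarrow>
      \<exists>r. strict_mono (r :: nat \<Rightarrow> nat) \<and> convergent (\<lambda>n. fst (x (r n)))"
    and infinite_dim: "\<exists>v\<in>H. fst v \<noteq> 0 \<and> (\<forall>i<n::nat. fst v \<bullet> b i = 0)"
begin

sublocale form: bounded_bilinear \<alpha> by (rule bilinear)

lemma form_nonneg: "0 \<le> \<alpha> g g"
  using coercive by (meson mult_nonneg_nonneg less_imp_le order_trans zero_le_power2)

text \<open>Direct method: compactness makes the first components of a minimising sequence converge,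
  and the parallelogram identity gives norm convergence of the second ones, so no weak limits occur.
  The subspace \<open>K\<close> is there for the orthogonality constraints of the later
  steps.\<close>

lemma minimizer_exists:
  assumes K: "K \<subseteq> H" "subspace K" "closed K" and v0: "v0 \<in> K" "fst v0 \<noteq> 0"
  shows "\<exists>x\<in>K. norm (fst x) = 1 \<and>
    (\<forall>v\<in>K. \<alpha> (snd x) (snd x) * (norm (fst v))\<^sup>2 \<le> \<alpha> (snd v) (snd v))"
proof -
  define q where "q g = \<alpha> g g" for g
  define R where "R = (\<lambda>v. q (snd v)) ` {v\<in>K. norm (fst v) = 1}"
  define \<mu> where "\<mu> = Inf R"
  have q_scale: "q (r *\<^sub>R g) = r\<^sup>2 * q g" for r g
    by (simp add: q_def form.scaleR_left form.scaleR_right power2_eq_square)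
  have normalized: "v /\<^sub>R norm (fst v) \<in> {v\<in>K. norm (fst v) = 1}" if "v \<in> K" "fst v \<noteq> 0" for v
    using that K(2) by (simp add: subspace_scale)
  have Rne: "R \<noteq> {}" using normalized[OF v0] unfolding R_def by blast
  have Rbdd: "bdd_below R" using form_nonneg by (auto simp: R_def q_def intro!: bdd_belowI[of _ 0])
  have \<mu>: "\<mu> * (norm (fst v))\<^sup>2 \<le> q (snd v)" if "v \<in> K" for v
  proof (cases "fst v = 0")
    case True then show ?thesis using form_nonneg by (simp add: q_def)
  next
    case False
    have "\<mu> \<le> q (snd (v /\<^sub>R norm (fst v)))"
      unfolding \<mu>_def using Rbdd imageI[OF normalized[OF that False], of "\<lambda>v. q (snd v)"]
      by (intro cInf_lower) (simp_all add: R_def)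
    also have "\<dots> = q (snd v) / (norm (fst v))\<^sup>2"
      by (simp add: q_scale power_inverse divide_inverse mult.commute)
    finally show ?thesis using False by (simp add: field_simps)
  qed
  have "\<exists>x\<in>K. norm (fst x) = 1 \<and> q (snd x) < \<mu> + 1 / real (Suc n)" for n
  proof -
    have "\<mu> < \<mu> + 1 / real (Suc n)" by simp
    then obtain y where "y \<in> R" "y < \<mu> + 1 / real (Suc n)"
      unfolding \<mu>_def using cInf_less_iff[OF Rne Rbdd] by blast
    then show ?thesis by (auto simp: R_def)
  qed
  then obtain x where x: "\<And>n. x n \<in> K" "\<And>n. norm (fst (x n)) = 1"
    "\<And>n. q (snd (x n)) < \<mu> + 1 / real (Suc n)" by metis
  obtain c where c: "c > 0" "\<And>g. c * (norm g)\<^sup>2 \<le> q g" using coercive by (auto simp: q_def)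
  have "norm (x n) \<le> 1 + sqrt ((\<mu> + 1) / c)" for n
  proof -
    have "c * (norm (snd (x n)))\<^sup>2 \<le> \<mu> + 1 / real (Suc n)" using c(2)[of "snd (x n)"] x(3)[of n] by linarith
    also have "\<dots> \<le> \<mu> + 1" by simp
    finally have "(norm (snd (x n)))\<^sup>2 \<le> (\<mu> + 1) / c" using c(1) by (simp add: field_simps)
    then have "norm (snd (x n)) \<le> sqrt ((\<mu> + 1) / c)" by (simp add: real_le_rsqrt)
    then show ?thesis using norm_Pair_le[of "fst (x n)" "snd (x n)"] x(2)[of n] by simp
  qed
  then have "bounded (range x)" by (auto simp: bounded_iff)
  moreover have "range x \<subseteq> H" using x(1) K(1) by auto
  ultimately obtain r where r: "strict_mono (r :: nat \<Rightarrow> nat)" "convergent (\<lambda>n. fst (x (r n)))"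
    using compact by blast
  define y where "y n = x (r n)" for n
  have yK: "y n \<in> K" and y1: "norm (fst (y n)) = 1" for n by (auto simp: y_def x)
  have yq: "q (snd (y n)) < \<mu> + 1 / real (Suc n)" for n
  proof -
    have "1 / real (Suc (r n)) \<le> 1 / real (Suc n)"
      using seq_suble[OF r(1), of n] by (simp add: frac_le)
    then show ?thesis using x(3)[of "r n"] by (simp add: y_def)
  qed
  have Cf: "Cauchy (\<lambda>n. fst (y n))" using r(2) by (simp add: y_def convergent_Cauchy)
  \<comment> \<open>The parallelogram identity for \<open>\<alpha>\<close> turns almost-minimality into the Cauchy property.\<close>
  have par: "c * (norm (snd (y m) - snd (y n)))\<^sup>2
      \<le> 2 / real (Suc m) + 2 / real (Suc n) + \<mu> * (norm (fst (y m) - fst (y n)))\<^sup>2" for m n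
  proof -
    let ?g = "snd (y m)" and ?h = "snd (y n)" and ?u = "fst (y m)" and ?w = "fst (y n)"
    have "\<mu> * (norm (?u + ?w))\<^sup>2 \<le> q (?g + ?h)"
      using \<mu>[OF subspace_add[OF K(2) yK[of m] yK[of n]]] by simp
    moreover have "q (?g - ?h) = 2 * q ?g + 2 * q ?h - q (?g + ?h)"
      by (simp add: q_def form.add_left form.add_right form.diff_left form.diff_right)
    moreover have "(norm (?u + ?w))\<^sup>2 = 4 - (norm (?u - ?w))\<^sup>2"
      using y1[of m] y1[of n] unfolding power2_norm_eq_inner norm_eq_1
      by (simp add: inner_add_left inner_add_right inner_diff_left inner_diff_right)
    ultimately have "q (?g - ?h) \<le> 2 * (q ?g - \<mu>) + 2 * (q ?h - \<mu>) + \<mu> * (norm (?u - ?w))\<^sup>2"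
      by (simp add: algebra_simps)
    moreover have "2 / real (Suc k) = 2 * (1 / real (Suc k))" for k by simp
    ultimately show ?thesis using c(2)[of "?g - ?h"] yq[of m] yq[of n] by (smt (verit, best))
  qed
  have "Cauchy (\<lambda>n. snd (y n))"
  proof (rule metric_CauchyI)
    fix e :: real assume e: "e > 0"
    define d where "d = c * e\<^sup>2"
    have d: "d > 0" using c(1) e by (simp add: d_def)
    \<comment> \<open>The thresholds split \<open>d\<close>: less than d/2 for the \<mu>-term, and
      less than d/4 for each of the two terms 2/(k+1).\<close>
    obtain N1 where N1: "\<And>m n. m \<ge> N1 \<Longrightarrow> n \<ge> N1 \<Longrightarrow> dist (fst (y m)) (fst (y n)) < sqrt (d / (2 * (\<bar>\<mu>\<bar> + 1)))"
      using metric_CauchyD[OF Cf, of "sqrt (d / (2 * (\<bar>\<mu>\<bar> + 1)))"] d by auto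
    obtain N2 where N2: "real N2 > 8 / d" using reals_Archimedean2 by blast
    show "\<exists>M. \<forall>m\<ge>M. \<forall>n\<ge>M. dist (snd (y m)) (snd (y n)) < e"
    proof (intro exI allI impI)
      fix m n assume mn: "m \<ge> max N1 N2" "n \<ge> max N1 N2"
      have s: "2 / real (Suc k) < d / 4" if "k \<ge> max N1 N2" for k
      proof -
        have "8 / d < real (Suc k)" using that N2 by simp
        then show ?thesis using d by (simp add: field_simps)
      qed
      have "(norm (fst (y m) - fst (y n)))\<^sup>2 \<le> d / (2 * (\<bar>\<mu>\<bar> + 1))"
      proof -
        have "norm (fst (y m) - fst (y n)) \<le> sqrt (d / (2 * (\<bar>\<mu>\<bar> + 1)))"
          using N1[of m n] mn by (simp add: dist_norm less_imp_le)
        then have "(norm (fst (y m) - fst (y n)))\<^sup>2 \<le> (sqrt (d / (2 * (\<bar>\<mu>\<bar> + 1))))\<^sup>2"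
          by (intro power_mono) auto
        then show ?thesis using d by simp
      qed
      then have "\<bar>\<mu>\<bar> * (norm (fst (y m) - fst (y n)))\<^sup>2 \<le> \<bar>\<mu>\<bar> * (d / (2 * (\<bar>\<mu>\<bar> + 1)))"
        by (intro mult_left_mono) auto
      also have "\<dots> < d / 2" using d by (simp add: field_simps)
      finally have "\<mu> * (norm (fst (y m) - fst (y n)))\<^sup>2 < d / 2"
        by (smt (verit, best) mult_right_mono zero_le_power2)
      then have "c * (norm (snd (y m) - snd (y n)))\<^sup>2 < d"
        using par[of m n] s[OF mn(1)] s[OF mn(2)] by linarith
      then have "(norm (snd (y m) - snd (y n)))\<^sup>2 < e\<^sup>2" using c(1) by (simp add: d_def)
      then show "dist (snd (y m)) (snd (y n)) < e" using e by (simp add: dist_norm power_less_imp_less_base)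
    qed
  qed
  then obtain g u where lim: "(\<lambda>n. snd (y n)) \<longlonglongrightarrow> g" "(\<lambda>n. fst (y n)) \<longlonglongrightarrow> u"
    using Cf by (meson Cauchy_convergent convergentD)
  then have "(\<lambda>n. (fst (y n), snd (y n))) \<longlonglongrightarrow> (u, g)" by (intro tendsto_Pair)
  then have yl: "y \<longlonglongrightarrow> (u, g)" by simp
  have "(u, g) \<in> K" using closed_sequentially[OF K(3) yK yl] .
  moreover have "norm u = 1"
  proof -
    have "(\<lambda>n. norm (fst (y n))) \<longlonglongrightarrow> norm u" by (intro tendsto_norm lim)
    then show ?thesis by (simp add: y1 LIMSEQ_const_iff)
  qed
  moreover have "q g \<le> \<mu>"
  proof (rule LIMSEQ_le)
    show "(\<lambda>n. q (snd (y n))) \<longlonglongrightarrow> q g" unfolding q_def by (intro form.tendsto lim)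
    have "(\<lambda>n. \<mu> + inverse (real (Suc n))) \<longlonglongrightarrow> \<mu> + 0"
      by (intro tendsto_intros LIMSEQ_inverse_real_of_nat)
    then show "(\<lambda>n. \<mu> + 1 / real (Suc n)) \<longlonglongrightarrow> \<mu>" by (simp add: inverse_eq_divide)
    show "\<exists>N. \<forall>n\<ge>N. q (snd (y n)) \<le> \<mu> + 1 / real (Suc n)" using yq less_imp_le by blast
  qed
  moreover have "q g * (norm (fst v))\<^sup>2 \<le> q (snd v)" if "v \<in> K" for v
    using \<mu>[OF that] mult_right_mono[OF \<open>q g \<le> \<mu>\<close>, of "(norm (fst v))\<^sup>2"] by simp
  ultimately show ?thesis by (intro bexI[of _ "(u, g)"]) (auto simp: q_def)
qed

definition eigenpair :: "real \<Rightarrow> 'u \<times> 'g \<Rightarrow> bool" where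
  "eigenpair \<mu> x \<longleftrightarrow> x \<in> H \<and> (\<forall>v\<in>H. \<alpha> (snd x) (snd v) = \<mu> * (fst x \<bullet> fst v))"

text \<open>The last clause is the variational characterisation and stands in for completeness of
  the \<open>fst (e i)\<close>. Indices start at 0, so \<open>m j\<close> is the (j+1)-st
  eigenvalue.\<close>

definition spectral_basis :: "(nat \<Rightarrow> 'u \<times> 'g) \<Rightarrow> (nat \<Rightarrow> real) \<Rightarrow> bool" where
  "spectral_basis e m \<longleftrightarrow>
     (\<forall>i. eigenpair (m i) (e i)) \<and>
     (\<forall>i j. fst (e i) \<bullet> fst (e j) = (if i = j then 1 else 0)) \<and>
     mono m \<and> filterlim m at_top sequentially \<and>
     (\<forall>j. \<forall>v\<in>H. (\<forall>i<j. fst v \<bullet> fst (e i) = 0) \<longrightarrow> m j * (norm (fst v))\<^sup>2 \<le> \<alpha> (snd v) (snd v))"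

text \<open>Each \<open>e n\<close> minimises the energy among unit vectors orthogonal to its
  predecessors. The first variation gives the eigenvalue equation against vectors orthogonal to the
  predecessors; symmetry and the equations of the predecessors supply the rest. If \<open>m\<close>
  stayed bounded, compactness would give an orthonormal sequence a Cauchy subsequence.\<close>

theorem spectral_basis_exists: "\<exists>e m. spectral_basis e m"
proof -
  define P where "P e n x \<longleftrightarrow> x \<in> H \<and> norm (fst x) = 1 \<and> (\<forall>i<n. fst x \<bullet> fst (e i) = 0) \<and>
    (\<forall>v\<in>H. (\<forall>i<n. fst v \<bullet> fst (e i) = 0) \<longrightarrow>
      \<alpha> (snd x) (snd x) * (norm (fst v))\<^sup>2 \<le> \<alpha> (snd v) (snd v))"
    for e :: "nat \<Rightarrow> 'u \<times> 'g" and n and x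
  have "\<exists>e. \<forall>n. P e n (e n)"
  proof (rule dependent_wellorder_choice)
    show "P e n x = P e' n x" if "\<And>i. i < n \<Longrightarrow> e i = e' i" for x e e' n
      using that by (auto simp: P_def)
    show "\<exists>x. P e n x" for n e
    proof -
      define K where "K = {v\<in>H. \<forall>i<n. fst v \<bullet> fst (e i) = 0}"
      have "K = H \<inter> (\<Inter>i\<in>{..<n}. {v. fst v \<bullet> fst (e i) = 0})" by (auto simp: K_def)
      moreover have "closed {v :: 'u \<times> 'g. fst v \<bullet> fst (e i) = 0}" for i
        by (intro closed_Collect_eq continuous_intros)
      ultimately have "closed K" by (auto intro!: closed_Int closed closed_INT)
      moreover have "subspace K" using subspace
        by (auto simp: K_def subspace_def inner_add_left)
      moreover obtain v0 where "v0 \<in> K" "fst v0 \<noteq> 0"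
        using infinite_dim[of n "\<lambda>i. fst (e i)"] by (auto simp: K_def)
      moreover have "K \<subseteq> H" by (auto simp: K_def)
      ultimately obtain x where "x \<in> K" "norm (fst x) = 1"
        "\<forall>v\<in>K. \<alpha> (snd x) (snd x) * (norm (fst v))\<^sup>2 \<le> \<alpha> (snd v) (snd v)"
        using minimizer_exists[of K v0] by blast
      then have "P e n x" by (simp add: P_def K_def)
      then show ?thesis by blast
    qed
  qed
  then obtain e where "\<And>n. P e n (e n)" by blast
  then have eH: "e n \<in> H" and e1: "norm (fst (e n)) = 1"
    and eorth: "i < n \<Longrightarrow> fst (e n) \<bullet> fst (e i) = 0"
    and emin: "v \<in> H \<Longrightarrow> (\<And>i. i < n \<Longrightarrow> fst v \<bullet> fst (e i) = 0) \<Longrightarrow>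
      \<alpha> (snd (e n)) (snd (e n)) * (norm (fst v))\<^sup>2 \<le> \<alpha> (snd v) (snd v)" for n i v
    by (auto simp: P_def)
  define m where "m n = \<alpha> (snd (e n)) (snd (e n))" for n
  have ortho: "fst (e i) \<bullet> fst (e j) = (if i = j then 1 else 0)" for i j
    using eorth[of i j] eorth[of j i] e1[of i]
    by (cases i j rule: linorder_cases) (auto simp: inner_commute dot_square_norm)
  have eig: "eigenpair (m n) (e n)" for n
  proof (induction n rule: less_induct)
    case (less n)
    have K: "\<alpha> (snd (e n)) (snd w) = m n * (fst (e n) \<bullet> fst w)"
      if w: "w \<in> H" "\<And>i. i < n \<Longrightarrow> fst w \<bullet> fst (e i) = 0" for w
    proof -
      \<comment> \<open>Minimality of \<open>e n\<close> along the line e n + t w, written as a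
        polynomial in t whose linear coefficient must vanish.\<close>
      have "0 \<le> 2 * t * (\<alpha> (snd (e n)) (snd w) - m n * (fst (e n) \<bullet> fst w))
          + t\<^sup>2 * (\<alpha> (snd w) (snd w) - m n * (norm (fst w))\<^sup>2)" for t
      proof -
        let ?v = "e n + t *\<^sub>R w"
        have "m n * (norm (fst ?v))\<^sup>2 \<le> \<alpha> (snd ?v) (snd ?v)"
          unfolding m_def using subspace eH w eorth
          by (intro emin) (auto simp: subspace_def inner_add_left)
        moreover have "(norm (fst ?v))\<^sup>2 = 1 + 2 * t * (fst (e n) \<bullet> fst w) + t\<^sup>2 * (norm (fst w))\<^sup>2"
          using ortho[of n n] unfolding power2_norm_eq_inner
          by (simp add: inner_add_left inner_add_right inner_commute power2_eq_square algebra_simps)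
        moreover have "\<alpha> (snd ?v) (snd ?v) = m n + 2 * t * \<alpha> (snd (e n)) (snd w) + t\<^sup>2 * \<alpha> (snd w) (snd w)"
          using sym[of "snd w" "snd (e n)"]
          by (simp add: m_def form.add_left form.add_right form.scaleR_left form.scaleR_right power2_eq_square
              algebra_simps)
        ultimately show ?thesis by (simp add: algebra_simps)
      qed
      from linear_coefficient_zero[OF this] show ?thesis by simp
    qed
    have "\<alpha> (snd (e n)) (snd v) = m n * (fst (e n) \<bullet> fst v)" if v: "v \<in> H" for v
    proof -
      define s where "s = (\<Sum>i<n. (fst v \<bullet> fst (e i)) *\<^sub>R e i)"
      have sH: "s \<in> H" unfolding s_def by (intro subspace_sum subspace_scale subspace eH)
      have fs: "fst s = (\<Sum>i<n. (fst v \<bullet> fst (e i)) *\<^sub>R fst (e i))"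
        and ss: "snd s = (\<Sum>i<n. (fst v \<bullet> fst (e i)) *\<^sub>R snd (e i))"
        by (simp_all add: s_def fst_sum snd_sum)
      have "\<alpha> (snd (e n)) (snd (v - s)) = m n * (fst (e n) \<bullet> fst (v - s))"
      proof (rule K)
        show "v - s \<in> H" using subspace v sH by (rule subspace_diff)
        fix k assume "k < n"
        then show "fst (v - s) \<bullet> fst (e k) = 0"
          by (simp add: fs inner_diff_left inner_sum_left ortho if_distrib[of "(*) _"] sum.delta cong: if_cong)
      qed
      moreover have "\<alpha> (snd (e n)) (snd (e i)) = 0" if "i < n" for i
        using less[OF that] sym eH[of n] ortho[of i n] that by (auto simp: eigenpair_def)
      then have "\<alpha> (snd (e n)) (snd s) = 0"
        by (simp add: ss form.sum_right form.scaleR_right)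
      moreover have "fst (e n) \<bullet> fst s = 0"
        by (simp add: fs inner_sum_right ortho)
      ultimately show ?thesis by (simp add: form.diff_right inner_diff_right)
    qed
    then show ?case using eH by (simp add: eigenpair_def)
  qed
  have mono: "mono m"
  proof (rule monoI)
    fix i j :: nat assume "i \<le> j"
    have "m i * (norm (fst (e j)))\<^sup>2 \<le> \<alpha> (snd (e j)) (snd (e j))"
      unfolding m_def using \<open>i \<le> j\<close> by (intro emin eH) (simp add: ortho)
    then show "m i \<le> m j" by (simp add: e1 m_def)
  qed
  have "filterlim m at_top sequentially"
  proof (rule ccontr)
    assume "\<not> filterlim m at_top sequentially"
    then obtain Z where "\<not> (\<forall>\<^sub>F n in sequentially. Z \<le> m n)" by (auto simp: filterlim_at_top)
    then have "\<exists>n\<ge>N. m n < Z" for N by (force simp: eventually_sequentially not_le)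
    then have mb: "m n \<le> Z" for n using mono by (meson less_imp_le monoD order_trans)
    obtain c where c: "c > 0" "\<And>g. c * (norm g)\<^sup>2 \<le> \<alpha> g g" using coercive by auto
    have "norm (e n) \<le> 1 + sqrt (Z / c)" for n
    proof -
      have "c * (norm (snd (e n)))\<^sup>2 \<le> Z" using c(2)[of "snd (e n)"] mb[of n] by (simp add: m_def)
      then have "(norm (snd (e n)))\<^sup>2 \<le> Z / c" using c(1) by (simp add: field_simps)
      then have "norm (snd (e n)) \<le> sqrt (Z / c)" by (simp add: real_le_rsqrt)
      then show ?thesis using norm_Pair_le[of "fst (e n)" "snd (e n)"] e1[of n] by simp
    qed
    then have "bounded (range e)" by (auto simp: bounded_iff)
    then obtain r where r: "strict_mono (r :: nat \<Rightarrow> nat)" "convergent (\<lambda>n. fst (e (r n)))"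
      using compact[of e] eH by blast
    obtain N where N: "\<forall>i\<ge>N. \<forall>j\<ge>N. dist (fst (e (r i))) (fst (e (r j))) < 1"
      using metric_CauchyD[OF convergent_Cauchy[OF r(2)], of 1] by auto
    have "r N \<noteq> r (Suc N)" using r(1) by (metis lessI less_irrefl strict_mono_less)
    then have "(norm (fst (e (r N)) - fst (e (r (Suc N)))))\<^sup>2 = 2"
      unfolding power2_norm_eq_inner by (simp add: inner_diff_left inner_diff_right ortho)
    moreover have "norm (fst (e (r N)) - fst (e (r (Suc N)))) < 1" using N by (simp add: dist_norm)
    ultimately show False by (smt (verit) norm_ge_zero power_le_one)
  qed
  then show ?thesis using eig ortho mono emin
    unfolding spectral_basis_def m_def[symmetric] by blast
qed

end

section \<open>Underdetermined linear systems and the min-max comparison of two forms\<close>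

text \<open>Gaussian elimination, by induction on the equations: an unknown \<open>p\<close> with
  nonzero coefficient in equation \<open>j\<close> is expressed through the others. This supplies
  the nontrivial combination in the dimension counts below.\<close>

lemma homogeneous_system_solvable:
  fixes M :: "'i \<Rightarrow> 'j \<Rightarrow> real"
  assumes "finite J" "finite I" "card J < card I"
  shows "\<exists>c. (\<exists>i\<in>I. c i \<noteq> 0) \<and> (\<forall>j\<in>J. (\<Sum>i\<in>I. c i * M i j) = 0)"
  using assms
proof (induction J arbitrary: I M rule: finite_induct)
  case empty
  then have "I \<noteq> {}" by auto
  then show ?case by (intro exI[of _ "\<lambda>_. 1"]) auto
next
  case (insert j J)
  show ?case
  proof (cases "\<forall>i\<in>I. M i j = 0")
    case True
    then show ?thesis using insert.IH[of I M] insert.prems insert.hyps by auto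
  next
    case False
    then obtain p where p: "p \<in> I" "M p j \<noteq> 0" by auto
    define M' where "M' i l = M i l - M i j / M p j * M p l" for i l
    have "card J < card (I - {p})" using insert.prems insert.hyps p by simp
    then obtain c where c: "\<exists>i\<in>I - {p}. c i \<noteq> 0" "\<forall>l\<in>J. (\<Sum>i\<in>I - {p}. c i * M' i l) = 0"
      using insert.IH[of "I - {p}" M'] insert.prems by auto
    define s where "s = (\<Sum>i\<in>I - {p}. c i * M i j) / M p j"
    define d where "d = c(p := - s)"
    have sum_d: "(\<Sum>i\<in>I. d i * M i l) = (\<Sum>i\<in>I - {p}. c i * M i l) - s * M p l" for l
      using insert.prems p(1) by (simp add: sum.remove[of I p] d_def)
    have "(\<Sum>i\<in>I. d i * M i l) = 0" if "l \<in> insert j J" for l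
    proof (cases "l = j")
      case True
      then show ?thesis unfolding sum_d using p(2) by (simp add: s_def)
    next
      case False
      have "0 = (\<Sum>i\<in>I - {p}. c i * M' i l)" using c(2) that False by simp
      also have "\<dots> = (\<Sum>i\<in>I - {p}. c i * M i l) - s * M p l"
        by (simp add: M'_def s_def right_diff_distrib sum_subtractf sum_divide_distrib sum_distrib_right sum_distrib_left mult_ac)
      finally show ?thesis unfolding sum_d by simp
    qed
    moreover have "\<exists>i\<in>I. d i \<noteq> 0" using c(1) by (auto simp: d_def)
    ultimately show ?thesis by blast
  qed
qed

context energy_form
begin

lemma spectral_basisD:
  assumes "spectral_basis e m"
  shows "eigenpair (m i) (e i)" "fst (e i) \<bullet> fst (e j) = (if i = j then 1 else 0)" "e i \<in> H"
    "mono m" "filterlim m at_top sequentially"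
    "v \<in> H \<Longrightarrow> (\<And>i. i < k \<Longrightarrow> fst v \<bullet> fst (e i) = 0) \<Longrightarrow>
      m k * (norm (fst v))\<^sup>2 \<le> \<alpha> (snd v) (snd v)"
    "v \<in> H \<Longrightarrow> \<alpha> (snd (e i)) (snd v) = m i * (fst (e i) \<bullet> fst v)"
  using assms unfolding spectral_basis_def eigenpair_def by blast+

lemma eigenpair_combination:
  assumes "\<And>i. i \<in> I \<Longrightarrow> eigenpair \<mu> (e i)"
  shows "eigenpair \<mu> (\<Sum>i\<in>I. c i *\<^sub>R e i)"
  unfolding eigenpair_def
proof (intro conjI ballI)
  show "(\<Sum>i\<in>I. c i *\<^sub>R e i) \<in> H"
    using assms by (intro subspace_sum subspace_scale subspace) (auto simp: eigenpair_def)
  fix v assume "v \<in> H"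
  then have "\<alpha> (snd (e i)) (snd v) = \<mu> * (fst (e i) \<bullet> fst v)" if "i \<in> I" for i
    using assms[OF that] by (simp add: eigenpair_def)
  then show "\<alpha> (snd (\<Sum>i\<in>I. c i *\<^sub>R e i)) (snd v) = \<mu> * (fst (\<Sum>i\<in>I. c i *\<^sub>R e i) \<bullet> fst v)"
    by (simp add: fst_sum snd_sum form.sum_left form.scaleR_left inner_sum_left sum_distrib_left mult_ac)
qed

lemma finite_level_set:
  assumes "filterlim m at_top sequentially"
  shows "finite {i::nat. m i = (\<mu>::real)}"
proof -
  obtain N where "\<And>n. n \<ge> N \<Longrightarrow> m n \<ge> \<mu> + 1"
    using assms unfolding filterlim_at_top eventually_sequentially by blast
  then have "{i. m i = \<mu>} \<subseteq> {..<N}" by (force simp: not_less[symmetric])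
  then show ?thesis using finite_subset by blast
qed

text \<open>What is left of \<open>x\<close> after projection is again an eigenpair for \<mu>, but
  orthogonal to every \<open>fst (e i)\<close>. Unless its first component is 0, the variational
  clause gives \<open>m k \<le> \<mu>\<close> for all k, while \<open>m\<close> is
  unbounded.\<close>

lemma eigenpair_expansion:
  assumes e: "spectral_basis e m" and x: "eigenpair \<mu> x"
  shows "fst x = (\<Sum>i | m i = \<mu>. (fst x \<bullet> fst (e i)) *\<^sub>R fst (e i))"
proof -
  define A where "A = {i. m i = \<mu>}"
  note E = spectral_basisD[OF e]
  have fin: "finite A" using finite_level_set[OF E(5)] by (simp add: A_def)
  define y where "y = x - (\<Sum>i\<in>A. (fst x \<bullet> fst (e i)) *\<^sub>R e i)"
  have xe: "fst x \<bullet> fst (e i) = 0" if "m i \<noteq> \<mu>" for i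
  proof -
    have "\<mu> * (fst x \<bullet> fst (e i)) = \<alpha> (snd x) (snd (e i))"
      using x E(3) by (simp add: eigenpair_def)
    also have "\<dots> = m i * (fst x \<bullet> fst (e i))"
      using x E(7)[of x i] by (simp add: eigenpair_def sym inner_commute)
    finally show ?thesis using that by simp
  qed
  have "eigenpair \<mu> y"
  proof -
    have "eigenpair \<mu> (\<Sum>i\<in>A. (fst x \<bullet> fst (e i)) *\<^sub>R e i)"
      using E(1) by (intro eigenpair_combination) (auto simp: A_def)
    then show ?thesis using x subspace_diff[OF subspace]
      by (auto simp: eigenpair_def y_def form.diff_left inner_diff_left right_diff_distrib)
  qed
  then have yH: "y \<in> H" and yy: "\<alpha> (snd y) (snd y) = \<mu> * (norm (fst y))\<^sup>2"
    by (auto simp: eigenpair_def power2_norm_eq_inner)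
  have "fst y \<bullet> fst (e i) = 0" for i
    using fin xe[of i]
    by (simp add: y_def fst_sum inner_diff_left inner_sum_left E(2) if_distrib[of "(*) _"] sum.delta A_def
        cong: if_cong)
  then have "m k * (norm (fst y))\<^sup>2 \<le> \<mu> * (norm (fst y))\<^sup>2" for k
    using E(6)[OF yH] yy by simp
  moreover obtain k where "m k > \<mu>"
    using E(5) unfolding filterlim_at_top_dense eventually_sequentially by blast
  ultimately have "fst y = 0" by (smt (verit) mult_strict_right_mono norm_eq_zero zero_less_power2)
  then show ?thesis by (simp add: y_def fst_sum A_def)
qed

end

text \<open>Courant-Fischer by counting dimensions: some unit combination of the first j+1
  eigenvectors of \<beta> is orthogonal to the first j of \<alpha>, so both its energies lie between
  \<open>m j\<close> and \<open>n j\<close>. If these agree, all its weight sits on eigenvectors of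
  \<beta> with value \<open>n j\<close>.\<close>

lemma eigenvalue_comparison:
  assumes "energy_form H \<alpha>" "energy_form H \<beta>"
    and le: "\<And>g. \<alpha> g g \<le> \<beta> g g"
    and e: "energy_form.spectral_basis H \<alpha> e m" and f: "energy_form.spectral_basis H \<beta> f n"
  shows "m j \<le> n j"
    and "m j = n j \<Longrightarrow> \<exists>x. energy_form.eigenpair H \<beta> (n j) x \<and> norm (fst x) = 1 \<and> \<alpha> (snd x) (snd x) = \<beta> (snd x) (snd x)"
proof -
  interpret a: energy_form H \<alpha> by fact
  interpret b: energy_form H \<beta> by fact
  note E = a.spectral_basisD[OF e] and F = b.spectral_basisD[OF f]
  obtain c0 where c0: "\<exists>i\<le>j. c0 i \<noteq> 0" "\<And>k. k < j \<Longrightarrow> (\<Sum>i\<le>j. c0 i * (fst (f i) \<bullet> fst (e k))) = 0"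
    using homogeneous_system_solvable[of "{..<j}" "{..j}" "\<lambda>i k. fst (f i) \<bullet> fst (e k)"]
    by auto
  define s where "s = sqrt (\<Sum>i\<le>j. (c0 i)\<^sup>2)"
  have "(\<Sum>i\<le>j. (c0 i)\<^sup>2) > 0" using c0(1) by (auto intro!: sum_pos2)
  then have s: "s > 0" "(\<Sum>i\<le>j. (c0 i)\<^sup>2) = s\<^sup>2" by (auto simp: s_def)
  define c where "c i = c0 i / s" for i
  have c1: "(\<Sum>i\<le>j. (c i)\<^sup>2) = 1"
    using s by (simp add: c_def power_divide flip: sum_divide_distrib)
  define x where "x = (\<Sum>i\<le>j. c i *\<^sub>R f i)"
  have xH: "x \<in> H" unfolding x_def by (intro subspace_sum subspace_scale a.subspace F(3))
  have fx: "fst x = (\<Sum>i\<le>j. c i *\<^sub>R fst (f i))" and sx: "snd x = (\<Sum>i\<le>j. c i *\<^sub>R snd (f i))"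
    by (simp_all add: x_def fst_sum snd_sum)
  have fxf: "fst (f i) \<bullet> fst x = c i" if "i \<le> j" for i
    using that by (simp add: fx inner_sum_right F(2) if_distrib[of "(*) _"] sum.delta cong: if_cong)
  have nx: "norm (fst x) = 1"
  proof -
    have "fst x \<bullet> fst x = (\<Sum>i\<le>j. c i * (fst (f i) \<bullet> fst x))" by (subst (1) fx) (simp add: inner_sum_left)
    also have "\<dots> = 1" using fxf c1 by (simp add: power2_eq_square)
    finally show ?thesis by (simp add: norm_eq_1)
  qed
  have "fst x \<bullet> fst (e k) = 0" if "k < j" for k
    using c0(2)[OF that]
    by (simp add: fx inner_sum_left c_def flip: sum_divide_distrib)
  then have lower: "m j \<le> \<alpha> (snd x) (snd x)" using E(6)[OF xH] nx by fastforce
  have bx: "\<beta> (snd x) (snd x) = (\<Sum>i\<le>j. n i * (c i)\<^sup>2)"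
  proof -
    have "\<beta> (snd x) (snd x) = (\<Sum>i\<le>j. c i * \<beta> (snd (f i)) (snd x))"
      by (subst (1) sx) (simp add: b.form.sum_left b.form.scaleR_left)
    also have "\<dots> = (\<Sum>i\<le>j. c i * (n i * c i))" using F(7)[OF xH] fxf by simp
    finally show ?thesis by (simp add: power2_eq_square mult_ac)
  qed
  \<comment> \<open>\<open>n j\<close> minus an average of the \<open>n i\<close> with weights c i^2
    of total 1: a sum of nonnegative terms, all of which vanish in the case of equality.\<close>
  have diff: "n j - \<beta> (snd x) (snd x) = (\<Sum>i\<le>j. (n j - n i) * (c i)\<^sup>2)"
    using c1 by (simp add: bx left_diff_distrib sum_subtractf flip: sum_distrib_left)
  have nonneg: "0 \<le> (n j - n i) * (c i)\<^sup>2" if "i \<le> j" for i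
    using monoD[OF F(4) that] by simp
  have upper: "\<beta> (snd x) (snd x) \<le> n j"
    using sum_nonneg[of "{..j}" "\<lambda>i. (n j - n i) * (c i)\<^sup>2"] nonneg diff by simp
  show "m j \<le> n j" using lower le[of "snd x"] upper by linarith
  assume eq: "m j = n j"
  then have "(\<Sum>i\<le>j. (n j - n i) * (c i)\<^sup>2) = 0"
    using lower le[of "snd x"] upper diff by linarith
  then have "c i = 0 \<or> n i = n j" if "i \<le> j" for i
    using nonneg that by (subst (asm) sum_nonneg_eq_0_iff) force+
  then have "x = (\<Sum>i | i \<le> j \<and> n i = n j. c i *\<^sub>R f i)"
    unfolding x_def by (intro sum.mono_neutral_right) auto
  then have "b.eigenpair (n j) x"
    using b.eigenpair_combination[of "{i. i \<le> j \<and> n i = n j}" "n j" f c] F(1) by (metis (mono_tags, lifting) mem_Collect_eq)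
  then show "\<exists>x. b.eigenpair (n j) x \<and> norm (fst x) = 1 \<and> \<alpha> (snd x) (snd x) = \<beta> (snd x) (snd x)"
    using nx lower le[of "snd x"] upper eq by (intro exI[of _ x]) simp
qed

section \<open>Compactness from a triangular energy\<close>

lemma norm_sum_orthogonal:
  fixes p :: "'i \<Rightarrow> 'u::real_inner"
  assumes "finite A" "\<And>i j. i \<in> A \<Longrightarrow> j \<in> A \<Longrightarrow> i \<noteq> j \<Longrightarrow> p i \<bullet> p j = 0"
  shows "(norm (\<Sum>i\<in>A. a i *\<^sub>R p i))\<^sup>2 = (\<Sum>i\<in>A. (a i)\<^sup>2 * (norm (p i))\<^sup>2)"
proof -
  have "(\<Sum>i\<in>A. a i *\<^sub>R p i) \<bullet> (\<Sum>i\<in>A. a i *\<^sub>R p i) = (\<Sum>i\<in>A. a i * (\<Sum>j\<in>A. a j * (p j \<bullet> p i)))"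
    by (simp add: inner_sum_left inner_sum_right)
  also have "\<dots> = (\<Sum>i\<in>A. a i * (a i * (p i \<bullet> p i)))"
  proof (rule sum.cong[OF refl])
    fix i assume i: "i \<in> A"
    have "(\<Sum>j\<in>A. a j * (p j \<bullet> p i)) = (\<Sum>j\<in>A. if j = i then a i * (p i \<bullet> p i) else 0)"
      using assms(2) i by (intro sum.cong) auto
    then show "a i * (\<Sum>j\<in>A. a j * (p j \<bullet> p i)) = a i * (a i * (p i \<bullet> p i))" using assms(1) i by simp
  qed
  finally show ?thesis unfolding power2_norm_eq_inner by (simp add: power2_eq_square mult.assoc)
qed

text \<open>Vectors of norm 0 are allowed, so that Gram--Schmidt needs no linear independence.\<close>

locale total_orthogonal =
  fixes p :: "nat \<Rightarrow> 'u::{real_inner,complete_space}"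
  assumes orthogonal: "i \<noteq> j \<Longrightarrow> p i \<bullet> p j = 0"
    and normalized: "p i = 0 \<or> norm (p i) = 1"
    and total: "(\<And>i. x \<bullet> p i = 0) \<Longrightarrow> x = 0"
begin

lemma inner_self: "(x \<bullet> p i) * (p i \<bullet> p i) = x \<bullet> p i"
  using normalized[of i] by (auto simp: norm_eq_1)

lemma inner_sum_coefficients:
  assumes "finite A"
  shows "(\<Sum>i\<in>A. (x \<bullet> p i) *\<^sub>R p i) \<bullet> p j = (if j \<in> A then x \<bullet> p j else 0)"
proof -
  have "(\<Sum>i\<in>A. (x \<bullet> p i) *\<^sub>R p i) \<bullet> p j = (\<Sum>i\<in>A. if i = j then x \<bullet> p j else 0)"
    unfolding inner_sum_left by (intro sum.cong) (use orthogonal inner_self in auto)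
  then show ?thesis using assms by simp
qed

lemma norm_sum_coefficients:
  assumes "finite A"
  shows "(norm (\<Sum>i\<in>A. (x \<bullet> p i) *\<^sub>R p i))\<^sup>2 = (\<Sum>i\<in>A. (x \<bullet> p i)\<^sup>2)"
proof -
  have "(x \<bullet> p i)\<^sup>2 * (norm (p i))\<^sup>2 = (x \<bullet> p i)\<^sup>2" for i using normalized[of i] by auto
  then show ?thesis by (subst norm_sum_orthogonal[OF assms]) (simp_all only: orthogonal not_False_eq_True)
qed

lemma bessel:
  assumes "finite A"
  shows "(\<Sum>i\<in>A. (x \<bullet> p i)\<^sup>2) \<le> (norm x)\<^sup>2"
proof -
  define s where "s = (\<Sum>i\<in>A. (x \<bullet> p i) *\<^sub>R p i)"
  have "x \<bullet> s = (\<Sum>i\<in>A. (x \<bullet> p i)\<^sup>2)" by (simp add: s_def inner_sum_right power2_eq_square)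
  moreover have "s \<bullet> s = (\<Sum>i\<in>A. (x \<bullet> p i)\<^sup>2)"
    using norm_sum_coefficients[OF assms] by (simp add: s_def power2_norm_eq_inner)
  moreover have "0 \<le> (norm (x - s))\<^sup>2" by simp
  ultimately show ?thesis
    unfolding power2_norm_eq_inner by (simp add: inner_diff_left inner_diff_right inner_commute)
qed

text \<open>Bessel's inequality makes the partial sums Cauchy; totality identifies the limit with
  \<open>x\<close>.\<close>

lemma expansion: "(\<lambda>N. \<Sum>i<N. (x \<bullet> p i) *\<^sub>R p i) \<longlonglongrightarrow> x"
proof -
  define S where "S N = (\<Sum>i<N. (x \<bullet> p i) *\<^sub>R p i)" for N
  have "summable (\<lambda>i. (x \<bullet> p i)\<^sup>2)"
    using bessel by (intro summableI_nonneg_bounded[of _ "(norm x)\<^sup>2"]) auto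
  have "Cauchy S"
  proof (rule CauchyI)
    fix e :: real assume e: "e > 0"
    obtain N where N: "\<And>m n. m \<ge> N \<Longrightarrow> norm (\<Sum>i\<in>{m..<n}. (x \<bullet> p i)\<^sup>2) < e\<^sup>2"
      using \<open>summable _\<close> e unfolding summable_Cauchy by (meson zero_less_power)
    have *: "norm (S n - S m) < e" if "N \<le> m" "m \<le> n" for m n
    proof -
      have "S n - S m = (\<Sum>i\<in>{m..<n}. (x \<bullet> p i) *\<^sub>R p i)"
        using that(2) by (simp add: S_def sum_diff_nat_ivl lessThan_atLeast0)
      then have "(norm (S n - S m))\<^sup>2 = (\<Sum>i\<in>{m..<n}. (x \<bullet> p i)\<^sup>2)"
        by (simp only: norm_sum_coefficients finite_atLeastLessThan)
      also have "\<dots> < e\<^sup>2" using N[OF that(1), of n] by (simp only: real_norm_def abs_less_iff)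
      finally have "(norm (S n - S m))\<^sup>2 < e\<^sup>2" .
      then show ?thesis using power_less_imp_less_base[of _ 2 e] e by auto
    qed
    then show "\<exists>M. \<forall>m\<ge>M. \<forall>n\<ge>M. norm (S m - S n) < e"
      by (metis nle_le norm_minus_commute)
  qed
  then obtain y where y: "S \<longlonglongrightarrow> y" using Cauchy_convergent convergentD by blast
  have "(x - y) \<bullet> p j = 0" for j
  proof -
    have "(\<lambda>N. S N \<bullet> p j) \<longlonglongrightarrow> y \<bullet> p j" by (intro tendsto_intros y)
    moreover have "(\<lambda>N. S N \<bullet> p j) \<longlonglongrightarrow> x \<bullet> p j"
      by (intro tendsto_eventually eventually_sequentiallyI[of "Suc j"]) (simp add: S_def inner_sum_coefficients)
    ultimately have "y \<bullet> p j = x \<bullet> p j" by (rule LIMSEQ_unique)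
    then show ?thesis by (simp add: inner_diff_left)
  qed
  then have "x = y" using total by fastforce
  then show ?thesis using y unfolding S_def by simp
qed

end

text \<open>\<open>Q\<close> is an energy on the second components for which the \<open>W k\<close> are triangular
  with diagonal \<open>ev k\<close>; Gram--Schmidt then diagonalises it, because an operator which is
  triangular and symmetric is diagonal.\<close>

locale triangular_energy =
  fixes H :: "('u::{real_inner,complete_space} \<times> 'g::real_inner) set"
    and Q :: "'g \<Rightarrow> 'g \<Rightarrow> real" and W :: "nat \<Rightarrow> 'u \<times> 'g" and ev :: "nat \<Rightarrow> real" and z :: "nat \<Rightarrow> 'u"
  assumes subspace: "subspace H"
    and Q_bilinear: "bounded_bilinear Q"
    and Q_sym: "Q g h = Q h g"
    and Q_nonneg: "0 \<le> Q g g"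
    and Q_le: "Q g g \<le> (norm g)\<^sup>2"
    and W_in: "W k \<in> H"
    and Q_W: "U \<in> H \<Longrightarrow> Q (snd U) (snd (W k)) = fst U \<bullet> (ev k *\<^sub>R fst (W k) + z k)"
    and z_in: "z k \<in> span ((\<lambda>m. fst (W m)) ` {..<k})"
    and ev_tendsto: "filterlim ev at_top sequentially"
    and W_total: "(\<And>k. x \<bullet> fst (W k) = 0) \<Longrightarrow> x = 0"
begin

sublocale Q: bounded_bilinear Q by (rule Q_bilinear)

text \<open>Whole pairs are orthonormalised by their first components, so each \<open>P k\<close>
  stays in \<open>H\<close> and \<open>Q\<close> can be evaluated on it. The clause on
  \<open>P 0\<close> later identifies the functions of zero gradient as constants.\<close>

lemma diagonal_basis_exists:
  "\<exists>P. (\<forall>k. P k \<in> H) \<and> total_orthogonal (\<lambda>k. fst (P k)) \<and> fst (P 0) \<in> span {fst (W 0)} \<and>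
     (\<forall>k. \<forall>U\<in>H. Q (snd U) (snd (P k)) = ev k * (fst U \<bullet> fst (P k)))"
proof -
  define R where "R P k = W k - (\<Sum>i<k. (fst (W k) \<bullet> fst (P i)) *\<^sub>R P i)" for P k
  \<comment> \<open>If the first component of \<open>R P k\<close> is 0, then
    \<open>inverse 0 = 0\<close> turns \<open>P k\<close> into the zero pair, for which every claim
    is trivial.\<close>
  have "\<exists>P. \<forall>k. P k = R P k /\<^sub>R norm (fst (R P k))"
  proof (rule dependent_wellorder_choice)
    show "(r = R f x /\<^sub>R norm (fst (R f x))) = (r = R g x /\<^sub>R norm (fst (R g x)))"
      if "\<And>y. y < x \<Longrightarrow> f y = g y" for r f g and x :: nat
      using that by (simp add: R_def)
  qed blast
  then obtain P where P: "\<And>k. P k = R P k /\<^sub>R norm (fst (R P k))" by blast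
  define p where "p k = fst (P k)" for k
  define w where "w k = fst (W k)" for k
  define r where "r k = w k - (\<Sum>i<k. (w k \<bullet> p i) *\<^sub>R p i)" for k
  have fR: "fst (R P k) = r k" for k by (simp add: R_def r_def w_def p_def fst_sum)
  have p: "p k = r k /\<^sub>R norm (r k)" for k by (subst p_def, subst P) (simp add: fR)
  have PH: "P k \<in> H" for k
  proof (induction k rule: less_induct)
    case (less k)
    then have "R P k \<in> H" unfolding R_def
      by (intro subspace_diff subspace_sum subspace_scale subspace W_in) auto
    then show ?case by (subst P) (simp add: subspace subspace_scale)
  qed
  have norm_p: "p k = 0 \<or> norm (p k) = 1" for k by (cases "r k = 0") (auto simp: p)
  then have self: "(x \<bullet> p i) * (p i \<bullet> p i) = x \<bullet> p i" for x i using norm_p[of i] by (cases "p i = 0") (auto simp: norm_eq_1)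
  have orth: "p i \<bullet> p k = 0" if "i < k" for i k
    using that
  proof (induction k arbitrary: i rule: less_induct)
    case (less k)
    have o: "p l \<bullet> p i = 0" if "l < k" "l \<noteq> i" for l
      using that less less.IH[of l i] less.IH[of i l] by (cases l i rule: linorder_cases) (auto simp: inner_commute)
    have "(\<Sum>l<k. (w k \<bullet> p l) *\<^sub>R p l) \<bullet> p i = (\<Sum>l<k. if l = i then w k \<bullet> p i else 0)"
      unfolding inner_sum_left by (intro sum.cong) (use o self in auto)
    then have "r k \<bullet> p i = 0" using less.prems by (simp add: r_def inner_diff_left)
    then show ?case by (simp add: p inner_commute)
  qed
  have w_eq: "w k = norm (r k) *\<^sub>R p k + (\<Sum>i<k. (w k \<bullet> p i) *\<^sub>R p i)" for k
  proof -
    have "norm (r k) *\<^sub>R p k = r k" by (cases "r k = 0") (simp_all add: p)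
    then show ?thesis by (simp add: r_def)
  qed
  have w_span: "w k \<in> span (p ` {..k})" for k
    by (subst w_eq) (intro span_add span_sum span_scale span_base; auto)
  have z_span: "z k \<in> span (p ` {..<k})" for k
  proof -
    have "w m \<in> span (p ` {..<k})" if "m < k" for m
      using w_span[of m] span_mono[of "p ` {..m}" "p ` {..<k}"] that by fastforce
    then have "span (w ` {..<k}) \<subseteq> span (p ` {..<k})" by (intro span_minimal) auto
    then show ?thesis using z_in[of k] by (auto simp: w_def)
  qed
  have eig: "\<forall>U\<in>H. Q (snd U) (snd (P k)) = ev k * (fst U \<bullet> p k)" for k
  proof (induction k rule: less_induct)
    case (less k)
    show ?case
    proof (cases "r k = 0")
      case True
      then have "P k = 0" by (subst P) (simp add: fR)
      then show ?thesis by (simp add: p_def Q.zero_right)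
    next
      case False
      \<comment> \<open>\<open>y\<close> is the off-diagonal part of the operator on
        \<open>r k\<close>. It lies in the span of the earlier \<open>p i\<close> by triangularity
        and is orthogonal to them by symmetry of \<open>Q\<close>, hence is 0.\<close>
      define y where "y = z k + (\<Sum>i<k. (w k \<bullet> p i) *\<^sub>R ((ev k - ev i) *\<^sub>R p i))"
      have y: "norm (r k) * Q (snd U) (snd (P k)) = fst U \<bullet> (ev k *\<^sub>R r k + y)" if U: "U \<in> H" for U
      proof -
        have "norm (r k) * Q (snd U) (snd (P k)) = Q (snd U) (snd (R P k))"
          by (subst P) (use False in \<open>simp add: Q.scaleR_right fR\<close>)
        also have "\<dots> = fst U \<bullet> (ev k *\<^sub>R w k + z k) - (\<Sum>i<k. (w k \<bullet> p i) * (ev i * (fst U \<bullet> p i)))"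
          using U less by (simp add: R_def snd_sum Q.diff_right Q.sum_right Q.scaleR_right Q_W w_def p_def)
        also have "\<dots> = fst U \<bullet> (ev k *\<^sub>R r k + y)"
          by (simp add: y_def r_def inner_add_right inner_diff_right inner_sum_right algebra_simps
              sum_subtractf sum_distrib_left)
        finally show ?thesis .
      qed
      have yspan: "y \<in> span (p ` {..<k})"
        unfolding y_def by (intro span_add span_sum span_scale z_span) (auto intro: span_base)
      have yp: "p j \<bullet> y = 0" if j: "j < k" for j
      proof -
        have "Q (snd (P j)) (snd (P k)) = 0"
          using less[OF j] PH[of k] orth[OF j] Q_sym[of "snd (P j)"] by (simp add: p_def inner_commute)
        then have "p j \<bullet> (ev k *\<^sub>R r k + y) = 0" using y[OF PH[of j]] by (simp add: p_def)
        moreover have "p j \<bullet> r k = 0"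
          using orth[OF j] False by (simp add: p)
        ultimately show ?thesis by (simp add: inner_add_right)
      qed
      have "span (p ` {..<k}) \<subseteq> {v. v \<bullet> y = 0}"
        using yp by (intro span_minimal) (auto simp: subspace_def inner_add_left)
      then have "y = 0" using yspan by auto
      then show ?thesis
        using y False by (auto simp: p field_simps)
    qed
  qed
  have tot: "x = 0" if "\<And>i. x \<bullet> p i = 0" for x
  proof (rule W_total)
    fix k
    show "x \<bullet> fst (W k) = 0"
      unfolding w_def[symmetric] by (subst w_eq) (simp add: inner_add_right inner_sum_right that)
  qed
  have "total_orthogonal p"
  proof
    show "p i \<bullet> p j = 0" if "i \<noteq> j" for i j
      using that orth[of i j] orth[of j i] by (cases i j rule: linorder_cases) (auto simp: inner_commute)
  qed (use norm_p tot in auto)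
  moreover have "p 0 \<in> span {w 0}" unfolding p[of 0] by (intro span_scale) (simp add: r_def span_base)
  moreover have "p = (\<lambda>k. fst (P k))" by (rule ext) (rule p_def)
  ultimately have "total_orthogonal (\<lambda>k. fst (P k))" "fst (P 0) \<in> span {fst (W 0)}"
    by (simp_all only: w_def p_def)
  then show ?thesis using PH eig[unfolded p_def] by (intro exI[of _ P] conjI allI)
qed

text \<open>This plays the role of Rellich's theorem. As \<open>ev\<close> tends to infinity, the
  energy controls the tails of the expansions uniformly, and the remaining finitely many
  coefficients converge along a diagonal subsequence.\<close>

lemma compact_embedding:
  assumes x: "range x \<subseteq> H" and bd: "bounded (range x)"
  shows "\<exists>r. strict_mono (r :: nat \<Rightarrow> nat) \<and> convergent (\<lambda>n. fst (x (r n)))"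
proof -
  obtain P where PH: "\<And>k. P k \<in> H" and tot: "total_orthogonal (\<lambda>k. fst (P k))"
    and eig: "\<And>k U. U \<in> H \<Longrightarrow> Q (snd U) (snd (P k)) = ev k * (fst U \<bullet> fst (P k))"
    using diagonal_basis_exists by blast
  define p where "p k = fst (P k)" for k
  interpret p: total_orthogonal p using tot by (simp add: p_def[abs_def])
  obtain C where C: "C > 0" "\<And>n. norm (x n) \<le> C" using bd unfolding bounded_pos by auto
  have xH: "x n \<in> H" for n using x by auto
  \<comment> \<open>Expanding \<open>Q (U - V) (U - V) \<ge> 0\<close> for the partial sum \<open>V\<close> of the expansion of \<open>U\<close> over \<open>A\<close>.\<close>
  have energy: "(\<Sum>i\<in>A. ev i * (fst U \<bullet> p i)\<^sup>2) \<le> (norm (snd U))\<^sup>2" if U: "U \<in> H" and A: "finite A" for U A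
  proof -
    define V where "V = (\<Sum>i\<in>A. (fst U \<bullet> p i) *\<^sub>R P i)"
    have VH: "V \<in> H" unfolding V_def by (intro subspace_sum subspace_scale subspace PH)
    have sV: "snd V = (\<Sum>i\<in>A. (fst U \<bullet> p i) *\<^sub>R snd (P i))" and fV: "fst V = (\<Sum>i\<in>A. (fst U \<bullet> p i) *\<^sub>R p i)"
      by (simp_all add: V_def snd_sum fst_sum p_def)
    have UV: "Q (snd U) (snd V) = (\<Sum>i\<in>A. ev i * (fst U \<bullet> p i)\<^sup>2)"
      by (simp add: sV Q.sum_right Q.scaleR_right eig[OF U] p_def power2_eq_square mult_ac)
    have VV: "Q (snd V) (snd V) = (\<Sum>i\<in>A. ev i * (fst U \<bullet> p i)\<^sup>2)"
    proof -
      have "Q (snd V) (snd V) = (\<Sum>i\<in>A. (fst U \<bullet> p i) * (ev i * (fst V \<bullet> p i)))"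
        by (subst (2) sV) (simp add: Q.sum_right Q.scaleR_right eig[OF VH] p_def)
      also have "\<dots> = (\<Sum>i\<in>A. ev i * (fst U \<bullet> p i)\<^sup>2)"
        unfolding fV using A by (intro sum.cong) (auto simp: p.inner_sum_coefficients power2_eq_square)
      finally show ?thesis .
    qed
    have "0 \<le> Q (snd U - snd V) (snd U - snd V)" by (rule Q_nonneg)
    also have "\<dots> = Q (snd U) (snd U) - (\<Sum>i\<in>A. ev i * (fst U \<bullet> p i)\<^sup>2)"
      using UV VV Q_sym[of "snd V" "snd U"] by (simp add: Q.diff_left Q.diff_right)
    finally show ?thesis using Q_le[of "snd U"] by linarith
  qed
  have tail: "\<Lambda> * (norm (fst U - (\<Sum>i<N. (fst U \<bullet> p i) *\<^sub>R p i)))\<^sup>2 \<le> (norm (snd U))\<^sup>2"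
    if U: "U \<in> H" and L: "\<And>i. i \<ge> N \<Longrightarrow> \<Lambda> \<le> ev i" "\<Lambda> > 0" for U N \<Lambda>
  proof -
    define S where "S n = (\<Sum>i<n. (fst U \<bullet> p i) *\<^sub>R p i)" for n
    have lim: "(\<lambda>n. \<Lambda> * (norm (S n - S N))\<^sup>2) \<longlonglongrightarrow> \<Lambda> * (norm (fst U - S N))\<^sup>2"
      by (intro tendsto_intros) (auto simp: S_def p.expansion)
    have "\<Lambda> * (norm (S n - S N))\<^sup>2 \<le> (norm (snd U))\<^sup>2" if "n \<ge> N" for n
    proof -
      have "S n - S N = (\<Sum>i\<in>{N..<n}. (fst U \<bullet> p i) *\<^sub>R p i)"
        using that by (simp add: S_def sum_diff_nat_ivl lessThan_atLeast0)
      then have "\<Lambda> * (norm (S n - S N))\<^sup>2 = (\<Sum>i\<in>{N..<n}. \<Lambda> * (fst U \<bullet> p i)\<^sup>2)"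
        by (simp add: p.norm_sum_coefficients sum_distrib_left)
      also have "\<dots> \<le> (\<Sum>i\<in>{N..<n}. ev i * (fst U \<bullet> p i)\<^sup>2)"
        using L by (intro sum_mono mult_right_mono) auto
      also have "\<dots> \<le> (norm (snd U))\<^sup>2" by (rule energy[OF U]) simp
      finally show ?thesis .
    qed
    then show ?thesis using LIMSEQ_le_const2[OF lim] unfolding S_def by blast
  qed
  interpret D: subseqs "\<lambda>i s. convergent (\<lambda>n. fst (x (s n)) \<bullet> p i)"
  proof
    fix i and s :: "nat \<Rightarrow> nat"
    have "\<bar>fst (x (s n)) \<bullet> p i\<bar> \<le> C" for n
    proof -
      have "\<bar>fst (x (s n)) \<bullet> p i\<bar> \<le> norm (fst (x (s n))) * norm (p i)" by (rule Cauchy_Schwarz_ineq2)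
      also have "\<dots> \<le> norm (fst (x (s n))) * 1" using p.normalized[of i] by (intro mult_left_mono) auto
      also have "\<dots> \<le> C" using norm_fst_le[of "fst (x (s n))" "snd (x (s n))"] C(2)[of "s n"] by simp
      finally show ?thesis .
    qed
    then have "bounded (range (\<lambda>n. fst (x (s n)) \<bullet> p i))" by (auto simp: bounded_iff)
    then show "\<exists>r'. strict_mono r' \<and> convergent (\<lambda>n. fst (x ((s \<circ> r') n)) \<bullet> p i)"
      using bounded_imp_convergent_subsequence by (fastforce simp: convergent_def o_def)
  qed
  have conv: "convergent (\<lambda>n. fst (x (D.diagseq n)) \<bullet> p i)" for i
  proof -
    have "convergent (\<lambda>n. fst (x ((D.diagseq \<circ> (+) (Suc i)) n)) \<bullet> p i)"
    proof (rule D.diagseq_holds)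
      show "convergent (\<lambda>n. fst (x ((s \<circ> r) n)) \<bullet> p k)"
        if "strict_mono r" "convergent (\<lambda>n. fst (x (s n)) \<bullet> p k)" for r s :: "nat \<Rightarrow> nat" and k
        using convergent_subseq_convergent[OF that(2,1)] by (simp add: o_def)
    qed
    then have "convergent (\<lambda>n. fst (x (D.diagseq (n + Suc i))) \<bullet> p i)" by (simp add: o_def add.commute)
    then show ?thesis
      using convergent_ignore_initial_segment[of "\<lambda>n. fst (x (D.diagseq n)) \<bullet> p i" "Suc i"] by simp
  qed
  define y where "y n = x (D.diagseq n)" for n
  have yH: "y n \<in> H" and yC: "norm (y n) \<le> C" for n by (auto simp: y_def xH C)
  have "Cauchy (\<lambda>n. fst (y n))"
  proof (rule CauchyI)
    fix e :: real assume e: "e > 0"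
    \<comment> \<open>Chosen so that \<Lambda> (e/2)^2 is at least (2C)^2, where 2C bounds the
      difference of two members of the sequence; the summand 1 makes positivity immediate.\<close>
    define \<Lambda> where "\<Lambda> = (4 * C / e)\<^sup>2 + 1"
    have \<Lambda>: "\<Lambda> > 0" by (simp add: \<Lambda>_def add_nonneg_pos)
    obtain N where N: "\<And>i. i \<ge> N \<Longrightarrow> \<Lambda> \<le> ev i"
      using ev_tendsto unfolding filterlim_at_top eventually_sequentially by blast
    define T where "T n = (\<Sum>i<N. (fst (y n) \<bullet> p i) *\<^sub>R p i)" for n
    have "(\<lambda>n. fst (y n) \<bullet> p i) \<longlonglongrightarrow> lim (\<lambda>n. fst (y n) \<bullet> p i)" for i
      using conv[of i] unfolding y_def convergent_LIMSEQ_iff .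
    then have "T \<longlonglongrightarrow> (\<Sum>i<N. lim (\<lambda>n. fst (y n) \<bullet> p i) *\<^sub>R p i)"
      unfolding T_def by (intro tendsto_intros)
    then have "convergent T" by (rule convergentI)
    then obtain M where M: "\<And>m n. m \<ge> M \<Longrightarrow> n \<ge> M \<Longrightarrow> norm (T m - T n) < e / 2"
      using CauchyD[OF convergent_Cauchy, of T "e / 2"] e by auto
    have "norm (fst (y m) - fst (y n)) < e" if "m \<ge> M" "n \<ge> M" for m n
    proof -
      define U where "U = y m - y n"
      have UH: "U \<in> H" unfolding U_def by (intro subspace_diff subspace yH)
      have "norm (snd U) \<le> norm U" using norm_snd_le[of "snd U" "fst U"] by simp
      also have "\<dots> \<le> 2 * C"
        using norm_triangle_ineq4[of "y m" "y n"] yC[of m] yC[of n] by (simp add: U_def)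
      finally have "norm (snd U) \<le> 2 * C" .
      then have "\<Lambda> * (norm (fst U - (\<Sum>i<N. (fst U \<bullet> p i) *\<^sub>R p i)))\<^sup>2 \<le> (2 * C)\<^sup>2"
        using tail[of U N \<Lambda>, OF UH N \<Lambda>] power_mono[of "norm (snd U)" "2 * C" 2] by fastforce
      also have "\<dots> = (4 * C / e)\<^sup>2 * (e / 2)\<^sup>2" using e by (simp add: power_divide power_mult_distrib)
      also have "\<dots> \<le> \<Lambda> * (e / 2)\<^sup>2" by (intro mult_right_mono) (auto simp: \<Lambda>_def)
      finally have "(norm (fst U - (\<Sum>i<N. (fst U \<bullet> p i) *\<^sub>R p i)))\<^sup>2 \<le> (e / 2)\<^sup>2"
        using \<Lambda> by (simp only: mult_le_cancel_left_pos)
      then have "norm (fst U - (\<Sum>i<N. (fst U \<bullet> p i) *\<^sub>R p i)) \<le> e / 2"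
        by (rule power2_le_imp_le) (use e in linarith)
      moreover have "(\<Sum>i<N. (fst U \<bullet> p i) *\<^sub>R p i) = T m - T n"
        by (simp add: U_def T_def inner_diff_left scaleR_left_diff_distrib sum_subtractf)
      ultimately have "norm (fst U) \<le> e / 2 + norm (T m - T n)"
        using norm_triangle_ineq[of "fst U - (T m - T n)" "T m - T n"] by simp
      then show ?thesis using M[OF that] by (simp add: U_def)
    qed
    then show "\<exists>M. \<forall>m\<ge>M. \<forall>n\<ge>M. norm (fst (y m) - fst (y n)) < e" by blast
  qed
  then show ?thesis using D.subseq_diagseq Cauchy_convergent unfolding y_def by blast
qed

text \<open>A zero gradient makes \<open>Q\<close> vanish, so the diagonal equation kills every
  coefficient with nonzero \<open>ev k\<close> and leaves a multiple of
  \<open>fst (P 0)\<close>.\<close>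

lemma zero_energy:
  assumes U: "U \<in> H" "snd U = 0" and ev: "\<And>k. k > 0 \<Longrightarrow> ev k \<noteq> 0"
  shows "fst U \<in> span {fst (W 0)}"
proof -
  obtain P where "\<And>k. P k \<in> H" and tot: "total_orthogonal (\<lambda>k. fst (P k))" and P0: "fst (P 0) \<in> span {fst (W 0)}"
    and eig: "\<And>k U. U \<in> H \<Longrightarrow> Q (snd U) (snd (P k)) = ev k * (fst U \<bullet> fst (P k))"
    using diagonal_basis_exists by blast
  interpret p: total_orthogonal "\<lambda>k. fst (P k)" by (fact tot)
  have "fst U \<bullet> fst (P k) = 0" if "k > 0" for k
    using eig[OF U(1), of k] U(2) ev[OF that] by (simp add: Q.zero_left)
  then have "(\<Sum>i<N. (fst U \<bullet> fst (P i)) *\<^sub>R fst (P i)) = (fst U \<bullet> fst (P 0)) *\<^sub>R fst (P 0)" if "N \<ge> 1" for N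
    using that by (subst sum.remove[of _ 0]) (auto intro!: sum.neutral)
  then have "(\<lambda>N. \<Sum>i<N. (fst U \<bullet> fst (P i)) *\<^sub>R fst (P i)) \<longlonglongrightarrow> (fst U \<bullet> fst (P 0)) *\<^sub>R fst (P 0)"
    by (intro tendsto_eventually eventually_sequentiallyI[of 1])
  then have "fst U = (fst U \<bullet> fst (P 0)) *\<^sub>R fst (P 0)" by (rule LIMSEQ_unique[OF p.expansion])
  then show ?thesis using P0 by (metis span_scale)
qed

end

section \<open>Smooth functions given by expressions\<close>

text \<open>The powers in the denominator make the family closed under differentiation up to linear
  combinations; the symbolic derivative of \<open>Flat\<close> relies on this.\<close>

definition flat :: "nat \<Rightarrow> real \<Rightarrow> real" where
  "flat k t = (if t > 0 then exp (- 1 / t) / t ^ k else 0)"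

lemma flat_tendsto_0: "((\<lambda>t. exp (- 1 / t) / t ^ k) \<longlongrightarrow> 0) (at_right (0::real))"
proof -
  have "((\<lambda>s::real. s ^ k / exp s) \<longlongrightarrow> 0) at_top" by (rule tendsto_power_div_exp_0)
  then have "((\<lambda>t::real. inverse t ^ k / exp (inverse t)) \<longlongrightarrow> 0) (at_right 0)"
    by (rule filterlim_compose) (rule filterlim_inverse_at_top_right)
  then show ?thesis by (simp add: exp_minus field_simps)
qed

lemma flat_has_derivative:
  "(flat k has_real_derivative flat (k + 2) t - of_nat k * flat (k + 1) t) (at t)"
proof -
  consider "t > 0" | "t < 0" | "t = 0" by linarith
  then show ?thesis
  proof cases
    case 1
    have "((\<lambda>t. exp (- 1 / t) / t ^ k) has_real_derivative flat (k + 2) t - of_nat k * flat (k + 1) t) (at t)"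
      by (rule derivative_eq_intros refl | use 1 in \<open>force\<close>)+
        (use 1 in \<open>cases k; simp add: flat_def field_simps power2_eq_square\<close>)
    moreover have "\<forall>\<^sub>F s in nhds t. flat k s = exp (- 1 / s) / s ^ k"
      using eventually_nhds_in_open[of "{0<..}" t] 1 by (auto simp: flat_def elim: eventually_mono)
    ultimately show ?thesis by (subst DERIV_cong_ev) auto
  next
    case 2
    have "\<forall>\<^sub>F s in nhds t. flat k s = 0"
      using eventually_nhds_in_open[of "{..<0}" t] 2 by (auto simp: flat_def elim: eventually_mono)
    then show ?thesis using 2 by (subst DERIV_cong_ev[where g = "\<lambda>_. 0"]) (auto simp: flat_def)
  next
    case 3
    \<comment> \<open>At 0 the difference quotient of \<open>flat k\<close> is
      \<open>flat (k + 1)\<close> on the right and 0 on the left.\<close>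
    have "((\<lambda>h. flat k h / h) \<longlongrightarrow> 0) (at 0)"
    proof (rule filterlim_split_at_real)
      have "\<forall>\<^sub>F h in at_left 0. flat k h / h = 0"
        by (auto simp: flat_def eventually_at_filter)
      then show "((\<lambda>h. flat k h / h) \<longlongrightarrow> 0) (at_left 0)" by (rule tendsto_eventually)
      have "\<forall>\<^sub>F h in at_right 0. exp (- 1 / h) / h ^ Suc k = flat k h / h"
        by (auto simp: flat_def eventually_at_filter)
      from tendsto_cong[OF this] show "((\<lambda>h. flat k h / h) \<longlongrightarrow> 0) (at_right 0)"
        using flat_tendsto_0[of "Suc k"] by simp
    qed
    then show ?thesis using 3 by (simp add: has_field_derivative_iff flat_def)
  qed
qed

lemma flat_nonneg: "flat k t \<ge> 0"
  by (simp add: flat_def)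

text \<open>Formal expressions for smooth functions: derivatives are computed symbolically, so that
  differentiability of all orders and the symmetry of second derivatives are inductions on syntax.\<close>

datatype 'a smooth =
  Const real | Coord 'a | Add "'a smooth" "'a smooth" | Mul "'a smooth" "'a smooth" | Flat nat "'a smooth"

primrec ev :: "'a::real_inner smooth \<Rightarrow> 'a \<Rightarrow> real" where
  "ev (Const c) x = c"
| "ev (Coord v) x = x \<bullet> v"
| "ev (Add p q) x = ev p x + ev q x"
| "ev (Mul p q) x = ev p x * ev q x"
| "ev (Flat k p) x = flat k (ev p x)"

primrec D :: "'a::real_inner \<Rightarrow> 'a smooth \<Rightarrow> 'a smooth" where
  "D h (Const c) = Const 0"
| "D h (Coord v) = Const (h \<bullet> v)"
| "D h (Add p q) = Add (D h p) (D h q)"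
| "D h (Mul p q) = Add (Mul (D h p) q) (Mul p (D h q))"
| "D h (Flat k p) = Mul (Add (Flat (k + 2) p) (Mul (Const (- of_nat k)) (Flat (k + 1) p))) (D h p)"

lemma ev_has_derivative: "(ev p has_derivative (\<lambda>h. ev (D h p) x)) (at x)"
proof (induction p)
  case (Const c)
  then show ?case by simp
next
  case (Coord v)
  then show ?case by (simp add: has_derivative_inner_left)
next
  case (Add p q)
  then show ?case using has_derivative_add by simp
next
  case (Mul p q)
  then show ?case using has_derivative_mult[OF Mul] by (simp add: add.commute)
next
  case (Flat k p)
  have "((flat k \<circ> ev p) has_derivative
      ((*) (flat (k + 2) (ev p x) - of_nat k * flat (k + 1) (ev p x)) \<circ> (\<lambda>h. ev (D h p) x))) (at x)"
    using flat_has_derivative[of k "ev p x"] unfolding has_field_derivative_def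
    by (intro diff_chain_at Flat)
  then show ?case by (simp add: o_def)
qed

lemma frechet_derivative_ev: "frechet_derivative (ev p) (at x) h = ev (D h p) x"
  by (simp flip: frechet_derivative_at[OF ev_has_derivative[of p x]])

lemma continuous_on_ev: "continuous_on A (ev p)"
  by (meson ev_has_derivative continuous_at_imp_continuous_on has_derivative_continuous)

lemma ev_measurable: "ev p \<in> borel_measurable borel"
  by (intro borel_measurable_continuous_onI continuous_on_ev)

lemma C_k_ev: "C_k k (ev p)"
proof (induction k arbitrary: p)
  case 0
  then show ?case by (simp add: continuous_on_ev)
next
  case (Suc k)
  have "ev p differentiable at x" for x using ev_has_derivative differentiableI by blast
  then show ?case using Suc by (simp add: frechet_derivative_ev)
qed

lemma D_commute: "ev (D h (D k p)) x = ev (D k (D h p)) x"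
  by (induction p arbitrary: h k) (auto simp: algebra_simps)

lemma test_function_ev:
  fixes p :: "'a::euclidean_space smooth"
  assumes "compact K" "K \<subseteq> \<Omega>" "\<And>x. ev p x \<noteq> 0 \<Longrightarrow> x \<in> K"
  shows "test_function \<Omega> (ev p)"
proof -
  have "closure {x. ev p x \<noteq> 0} \<subseteq> K"
    using assms by (intro closure_minimal compact_imp_closed) auto
  moreover have "compact (closure {x. ev p x \<noteq> 0})"
    using calculation assms(1) by (metis Int_absorb1 closed_closure compact_Int_closed)
  ultimately show ?thesis using assms(2) C_k_ev[of _ p] unfolding test_function_def by blast
qed

lemma derivative_zero_off_support:
  assumes "(f has_derivative f') (at x)" "closed K" "\<And>y. y \<notin> K \<Longrightarrow> f y = 0" "x \<notin> K"
  shows "f' h = (0 :: real)"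
proof -
  have z: "0 = f y" if "y \<in> - K" for y using assms(3) that by simp
  have "open (- K)" "x \<in> - K" using assms(2,4) by auto
  then have "(f has_derivative (\<lambda>_. 0)) (at x)"
    by (rule has_derivative_transform_within_open[OF has_derivative_const]) (rule z)
  then have "f' = (\<lambda>_. 0)" by (rule has_derivative_unique[OF assms(1)])
  then show ?thesis by simp
qed

lemma test_function_D:
  fixes p :: "'a::euclidean_space smooth"
  assumes "test_function \<Omega> (ev p)"
  shows "test_function \<Omega> (ev (D h p))"
proof -
  have "ev (D h p) x = 0" if "x \<notin> closure {x. ev p x \<noteq> 0}" for x
    using closure_subset[of "{x. ev p x \<noteq> 0}"] that
    by (intro derivative_zero_off_support[OF ev_has_derivative closed_closure]) auto
  then show ?thesis using assms
    by (intro test_function_ev[of "closure {x. ev p x \<noteq> 0}"]) (auto simp: test_function_def)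
qed

section \<open>Integration by parts\<close>

text \<open>Translation invariance makes every difference quotient integrate to 0; the mean value
  theorem bounds these quotients, and dominated convergence passes to the derivative. This treats
  any direction \<open>b\<close> without iterated integrals.\<close>

lemma integral_directional_derivative_zero:
  fixes f :: "'a::euclidean_space \<Rightarrow> real"
  assumes f': "\<And>x. (f has_derivative f' x) (at x)" and cont: "continuous_on UNIV (\<lambda>x. f' x b)"
    and K: "compact K" "\<And>x. x \<notin> K \<Longrightarrow> f x = 0"
  shows "(LINT x|lebesgue. f' x b) = 0"
proof -
  have f'0: "f' x b = 0" if "x \<notin> K" for x
    using K(2) that by (rule derivative_zero_off_support[OF f' compact_imp_closed[OF K(1)]])
  have contf: "continuous_on UNIV f"
    using f' by (meson continuous_at_imp_continuous_on has_derivative_continuous)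
  obtain M where M: "\<And>x. \<bar>f' x b\<bar> \<le> M"
  proof -
    have "compact ((\<lambda>x. f' x b) ` K)" by (intro compact_continuous_image continuous_on_subset[OF cont] K) auto
    then obtain M where "M > 0" "\<And>y. y \<in> (\<lambda>x. f' x b) ` K \<Longrightarrow> norm y \<le> M"
      by (meson bounded_pos compact_imp_bounded)
    then show thesis by (intro that[of M]) (metis f'0 abs_zero imageI less_imp_le real_norm_def)
  qed
  obtain C where C: "\<And>x. x \<in> K \<Longrightarrow> norm x \<le> C" using K(1) compact_imp_bounded bounded_iff by metis
  \<comment> \<open>The steps \<open>t n\<close> are at most 1, so this ball contains every x for
    which x or x + t n b lies in \<open>K\<close>.\<close>
  define B where "B = cball (0::'a) (C + norm b)"
  define t where "t n = inverse (real (Suc n))" for n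
  have t: "0 < t n" "t n \<le> 1" for n by (auto simp: t_def inverse_le_1_iff)
  define q where "q n x = (f (x + t n *\<^sub>R b) - f x) / t n" for n x
  have q_bound: "norm (q n x) \<le> M * indicator B x" for n x
  proof (cases "x \<in> B")
    case True
    have "((\<lambda>s. f (x + s *\<^sub>R b)) has_real_derivative f' (x + s *\<^sub>R b) b) (at s)" for s
    proof -
      have "(f \<circ> (\<lambda>s. x + s *\<^sub>R b) has_derivative f' (x + s *\<^sub>R b) \<circ> (\<lambda>h. h *\<^sub>R b)) (at s)"
        by (rule diff_chain_at) (auto intro!: derivative_eq_intros f')
      moreover have "f' (x + s *\<^sub>R b) (h *\<^sub>R b) = f' (x + s *\<^sub>R b) b * h" for h
        using linear_cmul[OF has_derivative_linear[OF f']] by (simp add: mult.commute)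
      ultimately show ?thesis by (simp add: o_def has_field_derivative_def)
    qed
    then obtain z where "f (x + t n *\<^sub>R b) - f (x + 0 *\<^sub>R b) = (t n - 0) * f' (x + z *\<^sub>R b) b"
      using MVT2[of 0 "t n" "\<lambda>s. f (x + s *\<^sub>R b)" "\<lambda>s. f' (x + s *\<^sub>R b) b"] t by auto
    then have "q n x = f' (x + z *\<^sub>R b) b" using t(1)[of n] by (simp add: q_def field_simps)
    then show ?thesis using M True by simp
  next
    case False
    have "x \<notin> K" using C[of x] False by (auto simp: B_def intro: order_trans[of _ C])
    moreover have "x + t n *\<^sub>R b \<notin> K"
    proof
      assume "x + t n *\<^sub>R b \<in> K"
      then have "norm x \<le> C + norm (t n *\<^sub>R b)"
        using C norm_triangle_ineq4[of "x + t n *\<^sub>R b" "t n *\<^sub>R b"] by fastforce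
      also have "norm (t n *\<^sub>R b) \<le> norm b" using t[of n] by (simp add: mult_left_le_one_le)
      finally show False using False by (simp add: B_def)
    qed
    ultimately show ?thesis using False K(2) by (simp add: q_def)
  qed
  have q_lim: "(\<lambda>n. q n x) \<longlonglongrightarrow> f' x b" for x
  proof -
    have "((\<lambda>s. (f (x + s *\<^sub>R b) - f x) / s) \<longlongrightarrow> f' x b) (at 0)"
    proof -
      have "(f \<circ> (\<lambda>s. x + s *\<^sub>R b) has_derivative f' (x + 0 *\<^sub>R b) \<circ> (\<lambda>h. h *\<^sub>R b)) (at 0)"
        by (rule diff_chain_at) (auto intro!: derivative_eq_intros f')
      moreover have "f' x (h *\<^sub>R b) = f' x b * h" for h
        using linear_cmul[OF has_derivative_linear[OF f']] by (simp add: mult.commute)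
      ultimately have "((\<lambda>s. f (x + s *\<^sub>R b)) has_real_derivative f' x b) (at 0)"
        by (simp add: o_def has_field_derivative_def)
      then show ?thesis by (simp add: has_field_derivative_iff)
    qed
    moreover have "filterlim t (at 0) sequentially"
      unfolding t_def using LIMSEQ_inverse_real_of_nat by (auto simp: filterlim_at)
    ultimately show ?thesis unfolding q_def by (rule filterlim_compose)
  qed
  have int_f: "integrable lborel (\<lambda>x. f (x + c))" for c
  proof -
    have "integrable lborel (\<lambda>x. indicator ((\<lambda>x. x - c) ` K) x *\<^sub>R f (x + c))"
      by (intro borel_integrable_compact compact_continuous_image K continuous_intros
          continuous_on_compose2[OF contf]) auto
    moreover have "indicator ((\<lambda>x. x - c) ` K) x *\<^sub>R f (x + c) = f (x + c)" for x
      using K(2)[of "x + c"] by (auto simp: indicator_def image_iff) (metis add_diff_cancel)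
    ultimately show ?thesis by (simp only:)
  qed
  have shift: "(LINT x|lborel. f (x + c)) = (LINT x|lborel. f x)" for c
    using integral_distr[of "(+) c" lborel borel f] contf
    by (simp add: lborel_distr_plus borel_measurable_continuous_onI add.commute)
  have meas: "(\<lambda>x. f' x b) \<in> borel_measurable lborel" using borel_measurable_continuous_onI[OF cont] by simp
  have "(\<lambda>n. LINT x|lborel. q n x) \<longlonglongrightarrow> (LINT x|lborel. f' x b)"
  proof (rule integral_dominated_convergence)
    show "(\<lambda>x. f' x b) \<in> borel_measurable lborel" by (rule meas)
    show "q n \<in> borel_measurable lborel" for n
      unfolding q_def using int_f[of "t n *\<^sub>R b"] int_f[of 0]
      by (intro borel_measurable_divide borel_measurable_diff) (auto dest: borel_measurable_integrable)
    show "integrable lborel (\<lambda>x. M * indicator B x :: real)"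
      unfolding B_def using emeasure_bounded_finite[OF bounded_cball]
      by (intro integrable_mult_right integrable_real_indicator) (simp_all add: less_top)
  qed (use q_lim q_bound in auto)
  moreover have "(LINT x|lborel. q n x) = 0" for n
    using int_f[of "t n *\<^sub>R b"] int_f[of 0] shift[of "t n *\<^sub>R b"] by (simp add: q_def)
  ultimately have "(LINT x|lborel. f' x b) = 0" by (simp add: LIMSEQ_const_iff)
  then show ?thesis using integral_completion[OF meas] by simp
qed

lemma L2_scale: "u \<in> L2 \<Omega> \<Longrightarrow> (\<lambda>x. c * u x) \<in> L2 \<Omega>"
  by (auto simp: L2_def power_mult_distrib)

lemma L2_mult_integrable:
  assumes "u \<in> L2 \<Omega>" "v \<in> L2 \<Omega>"
  shows "integrable (lebesgue_on \<Omega>) (\<lambda>x. u x * v x)"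
proof (rule Bochner_Integration.integrable_bound)
  show "integrable (lebesgue_on \<Omega>) (\<lambda>x. (u x)\<^sup>2 + (v x)\<^sup>2)" using assms by (simp add: L2_def)
  show "(\<lambda>x. u x * v x) \<in> borel_measurable (lebesgue_on \<Omega>)" using assms by (auto simp: L2_def)
  have "\<bar>a * b\<bar> \<le> a\<^sup>2 + b\<^sup>2" for a b :: real
  proof -
    have "2 * \<bar>a * b\<bar> \<le> a\<^sup>2 + b\<^sup>2" using sum_squares_bound[of "\<bar>a\<bar>" "\<bar>b\<bar>"] by (simp add: abs_mult)
    then show ?thesis using sum_power2_ge_zero[of a b] by linarith
  qed
  then show "AE x in lebesgue_on \<Omega>. norm (u x * v x) \<le> norm ((u x)\<^sup>2 + (v x)\<^sup>2)" by simp
qed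

lemma L2_add:
  assumes "u \<in> L2 \<Omega>" "v \<in> L2 \<Omega>"
  shows "(\<lambda>x. u x + v x) \<in> L2 \<Omega>"
proof -
  have "integrable (lebesgue_on \<Omega>) (\<lambda>x. (u x)\<^sup>2 + (v x)\<^sup>2 + 2 * (u x * v x))"
    using assms L2_mult_integrable[OF assms] by (auto simp: L2_def)
  moreover have "(\<lambda>x. u x + v x) \<in> borel_measurable (lebesgue_on \<Omega>)"
    using assms by (intro borel_measurable_add) (auto simp: L2_def)
  ultimately show ?thesis by (simp add: L2_def power2_sum mult.assoc)
qed

lemma L2_bounded:
  assumes "\<Omega> \<in> lmeasurable" "u \<in> borel_measurable (lebesgue_on \<Omega>)" "\<And>x. x \<in> \<Omega> \<Longrightarrow> \<bar>u x\<bar> \<le> C"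
  shows "u \<in> L2 \<Omega>"
proof -
  have "integrable (lebesgue_on \<Omega>) (\<lambda>x. (u x)\<^sup>2)"
  proof (rule finite_measure.integrable_const_bound[OF finite_measure_lebesgue_on[OF assms(1)]])
    show "AE x in lebesgue_on \<Omega>. norm ((u x)\<^sup>2) \<le> C\<^sup>2"
      using assms(3) by (intro AE_I2) (auto intro!: abs_le_square_iff[THEN iffD1] intro: order_trans[OF _ abs_ge_self])
  qed (use assms(2) in auto)
  then show ?thesis using assms(2) by (simp add: L2_def)
qed

lemma L2_integrable:
  assumes "\<Omega> \<in> lmeasurable" "u \<in> L2 \<Omega>"
  shows "integrable (lebesgue_on \<Omega>) u"
  using L2_mult_integrable[OF assms(2) L2_bounded[OF assms(1), of "\<lambda>_. 1" 1]] by simp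

lemma continuous_L2:
  fixes \<Omega> :: "'a::euclidean_space set"
  assumes "open \<Omega>" "bounded \<Omega>" "continuous_on UNIV (f :: 'a \<Rightarrow> real)"
  shows "f \<in> L2 \<Omega>"
proof -
  have "compact (f ` closure \<Omega>)"
    using assms by (intro compact_continuous_image) (auto intro: continuous_on_subset simp: compact_closure)
  then obtain C where C: "\<And>y. y \<in> f ` closure \<Omega> \<Longrightarrow> norm y \<le> C" by (meson bounded_iff compact_imp_bounded)
  show ?thesis
  proof (rule L2_bounded)
    show "\<Omega> \<in> lmeasurable" using assms by (simp add: lmeasurable_open)
    have "f \<in> borel_measurable lebesgue"
      using borel_measurable_continuous_onI[OF assms(3)] by (simp add: measurable_completion)
    then show "f \<in> borel_measurable (lebesgue_on \<Omega>)" by (rule measurable_restrict_space1)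
    show "\<bar>f x\<bar> \<le> C" if "x \<in> \<Omega>" for x using C that closure_subset by fastforce
  qed
qed

lemma integral_lebesgue_on_vanishing:
  assumes "\<Omega> \<in> sets lebesgue" "\<And>x. x \<notin> \<Omega> \<Longrightarrow> f x = 0"
  shows "(LINT x|lebesgue_on \<Omega>. f x) = (LINT x|lebesgue. (f x :: real))"
proof -
  have "(LINT x|lebesgue_on \<Omega>. f x) = (LINT x|lebesgue. indicator \<Omega> x *\<^sub>R f x)"
    using assms by (intro integral_restrict_space) auto
  also have "\<dots> = (LINT x|lebesgue. f x)"
    using assms(2) by (intro Bochner_Integration.integral_cong) (auto simp: indicator_def)
  finally show ?thesis .
qed

lemma test_function_derivative:
  assumes "test_function \<Omega> \<phi>"
  shows "(\<phi> has_derivative frechet_derivative \<phi> (at x)) (at x)"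
    and "b \<in> Basis \<Longrightarrow> continuous_on UNIV (\<lambda>x. frechet_derivative \<phi> (at x) b)"
    and "continuous_on UNIV \<phi>"
proof -
  have "C_k (Suc 0) \<phi>" "C_k 0 \<phi>" using assms unfolding test_function_def by blast+
  then show "(\<phi> has_derivative frechet_derivative \<phi> (at x)) (at x)"
    "b \<in> Basis \<Longrightarrow> continuous_on UNIV (\<lambda>x. frechet_derivative \<phi> (at x) b)" "continuous_on UNIV \<phi>"
    by (auto simp: frechet_derivative_works)
qed

lemma test_function_L2:
  assumes "open \<Omega>" "bounded \<Omega>" "test_function \<Omega> \<phi>"
  shows "\<phi> \<in> L2 \<Omega>" "b \<in> Basis \<Longrightarrow> (\<lambda>x. frechet_derivative \<phi> (at x) b) \<in> L2 \<Omega>"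
  by (rule continuous_L2[OF assms(1,2)], rule test_function_derivative[OF assms(3)])
    (rule continuous_L2[OF assms(1,2)], rule test_function_derivative[OF assms(3)])

text \<open>The product of \<open>ev p\<close> with a test function has compact support, so its
  directional derivative integrates to 0; the product rule splits that integral.\<close>

lemma H1_grad_ev:
  fixes \<Omega> :: "'a::euclidean_space set"
  assumes \<Omega>: "open \<Omega>" "bounded \<Omega>"
  shows "H1_grad \<Omega> (ev p) (\<lambda>x. \<Sum>b\<in>Basis. ev (D b p) x *\<^sub>R b)"
  unfolding H1_grad_def
proof (intro conjI ballI allI impI)
  show "ev p \<in> L2 \<Omega>" by (intro continuous_L2 \<Omega> continuous_on_ev)
  fix b :: 'a assume b: "b \<in> Basis"
  have gb: "(\<Sum>c\<in>Basis. ev (D c p) x *\<^sub>R c) \<bullet> b = ev (D b p) x" for x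
    using b by (simp add: inner_sum_left inner_Basis if_distrib[of "(*) _"] cong: if_cong)
  show "(\<lambda>x. (\<Sum>c\<in>Basis. ev (D c p) x *\<^sub>R c) \<bullet> b) \<in> L2 \<Omega>"
    unfolding gb by (intro continuous_L2 \<Omega> continuous_on_ev)
  fix \<phi> :: "'a \<Rightarrow> real" assume t: "test_function \<Omega> \<phi>"
  note d = test_function_derivative[OF t] and l = test_function_L2[OF \<Omega> t]
  define K where "K = closure {x. \<phi> x \<noteq> 0}"
  have K: "compact K" "K \<subseteq> \<Omega>" "\<And>x. x \<notin> K \<Longrightarrow> \<phi> x = 0"
    using t closure_subset[of "{x. \<phi> x \<noteq> 0}"] by (auto simp: K_def test_function_def)
  define f' where "f' x h = ev p x * frechet_derivative \<phi> (at x) h + ev (D h p) x * \<phi> x" for x h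
  have "((\<lambda>x. ev p x * \<phi> x) has_derivative f' x) (at x)" for x
    using has_derivative_mult[OF ev_has_derivative d(1)] by (simp add: f'_def[abs_def])
  moreover have "continuous_on UNIV (\<lambda>x. f' x b)"
    unfolding f'_def using d b by (intro continuous_intros continuous_on_ev) auto
  ultimately have "(LINT x|lebesgue. f' x b) = 0"
    by (rule integral_directional_derivative_zero[OF _ _ K(1)]) (simp add: K(3))
  moreover have "frechet_derivative \<phi> (at x) b = 0" if "x \<notin> K" for x
    using K(3) that by (rule derivative_zero_off_support[OF d(1) compact_imp_closed[OF K(1)]])
  ultimately have "(LINT x|lebesgue_on \<Omega>. f' x b) = 0"
    using K(3) contra_subsetD[OF K(2)] \<Omega>(1)
    by (subst integral_lebesgue_on_vanishing) (auto simp: f'_def)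
  moreover have "(LINT x|lebesgue_on \<Omega>. f' x b) =
      (LINT x|lebesgue_on \<Omega>. ev p x * frechet_derivative \<phi> (at x) b) + (LINT x|lebesgue_on \<Omega>. ev (D b p) x * \<phi> x)"
    unfolding f'_def using b l
    by (intro Bochner_Integration.integral_add L2_mult_integrable continuous_L2 \<Omega> continuous_on_ev d) auto
  ultimately show "(LINT x|lebesgue_on \<Omega>. ev p x * frechet_derivative \<phi> (at x) b) =
      - (LINT x|lebesgue_on \<Omega>. ((\<Sum>c\<in>Basis. ev (D c p) x *\<^sub>R c) \<bullet> b) * \<phi> x)"
    unfolding gb by simp
qed

section \<open>Green's formula on the unit disc\<close>

abbreviation e1 :: "real^2" where "e1 \<equiv> axis 1 1"
abbreviation e2 :: "real^2" where "e2 \<equiv> axis 2 1"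
abbreviation disc :: "(real^2) set" where "disc \<equiv> ball 0 1"

lemma norm_vec2: "(norm (x :: real^2))\<^sup>2 = (x $ 1)\<^sup>2 + (x $ 2)\<^sup>2"
  unfolding power2_norm_eq_inner by (simp add: inner_vec_def sum_2 power2_eq_square)

lemma disc_iff: "x \<in> disc \<longleftrightarrow> (x $ 1)\<^sup>2 + (x $ 2)\<^sup>2 < 1"
  by (simp add: abs_square_less_1 flip: norm_vec2)

lemma Basis_vec2: "Basis = {e1, e2}"
  by (auto simp: Basis_vec_def) (metis exhaust_2)

lemma e1_neq_e2: "e1 \<noteq> e2"
  by (simp add: axis_eq_axis)

lemma axis_components [simp]: "e1 $ 1 = 1" "e1 $ 2 = 0" "e2 $ 1 = 0" "e2 $ 2 = 1"
  by (simp_all add: axis_def)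

abbreviation X :: "(real^2) smooth" where "X \<equiv> Coord e1"
abbreviation Y :: "(real^2) smooth" where "Y \<equiv> Coord e2"

definition defect :: "(real^2) smooth" where
  "defect = Add (Const 1) (Mul (Const (-1)) (Add (Mul X X) (Mul Y Y)))"

lemma ev_defect: "ev defect x = 1 - (x $ 1)\<^sup>2 - (x $ 2)\<^sup>2"
  by (simp add: defect_def inner_axis power2_eq_square)

lemma ev_D_defect: "ev (D e1 defect) x = - 2 * x $ 1" "ev (D e2 defect) x = - 2 * x $ 2"
  by (simp_all add: defect_def inner_axis)

text \<open>Positive exactly where n times the defect exceeds 1, which keeps the support of
  \<open>cutoff n\<close> compact in the disc. The relation level + 1 = n * defect later balances
  the factor n in the gradient of the cutoff.\<close>

definition level :: "nat \<Rightarrow> (real^2) smooth" where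
  "level n = Add (Const (-1)) (Mul (Const (real n)) defect)"

definition cutoff :: "nat \<Rightarrow> (real^2) smooth" where
  "cutoff n = Flat 0 (level n)"

lemma ev_D_cutoff: "ev (D h (cutoff n)) x = flat 2 (ev (level n) x) * (real n * ev (D h defect) x)"
  by (simp add: cutoff_def level_def numeral_2_eq_2)

lemma cutoff_test_function: "test_function disc (ev (Mul (cutoff n) p))"
proof (rule test_function_ev)
  show sub: "{x :: real^2. 1 \<le> real n * (1 - (norm x)\<^sup>2)} \<subseteq> disc"
  proof
    fix x :: "real^2" assume "x \<in> {x. 1 \<le> real n * (1 - (norm x)\<^sup>2)}"
    then have "0 < real n * (1 - (norm x)\<^sup>2)" by simp
    then have "0 < 1 - (norm x)\<^sup>2" by (simp add: zero_less_mult_iff)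
    then show "x \<in> disc" by (simp add: abs_square_less_1)
  qed
  have "closed {x :: real^2. 1 \<le> real n * (1 - (norm x)\<^sup>2)}"
    by (intro closed_Collect_le continuous_intros)
  moreover have "bounded {x :: real^2. 1 \<le> real n * (1 - (norm x)\<^sup>2)}"
    by (rule bounded_subset[OF bounded_ball sub])
  ultimately show "compact {x :: real^2. 1 \<le> real n * (1 - (norm x)\<^sup>2)}"
    by (simp add: compact_eq_bounded_closed)
  show "x \<in> {x. 1 \<le> real n * (1 - (norm x)\<^sup>2)}" if "ev (Mul (cutoff n) p) x \<noteq> 0" for x
    using that by (auto simp: cutoff_def level_def flat_def norm_vec2 ev_defect algebra_simps split: if_splits)
qed

text \<open>For t = \<open>level n\<close> this is the size of the cutoff's derivative against a
  tangential field, since t + 1 is then n times the defect. With y = 1/t it equals (y + y^2) exp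
  (-y), so the bound is uniform in n.\<close>

lemma flat_error_bound: "0 \<le> (t + 1) * flat 2 t" "(t + 1) * flat 2 t \<le> 2"
proof -
  show "0 \<le> (t + 1) * flat 2 t" by (simp add: flat_def)
  show "(t + 1) * flat 2 t \<le> 2"
  proof (cases "t > 0")
    case True
    define y where "y = 1 / t"
    have y: "y > 0" using True by (simp add: y_def)
    have "y + y\<^sup>2 \<le> 2 * (1 + y + y\<^sup>2 / 2)" using y by simp
    also have "\<dots> \<le> 2 * exp y" using exp_lower_Taylor_quadratic[of y] y by simp
    finally have "(y + y\<^sup>2) / exp y \<le> 2" by (simp add: divide_le_eq)
    moreover have "(t + 1) * flat 2 t = (y + y\<^sup>2) / exp y"
      using True by (simp add: flat_def y_def exp_minus field_simps power2_eq_square)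
    ultimately show ?thesis by simp
  qed (simp add: flat_def)
qed

lemma flat_0_le_1: "flat 0 t \<le> 1"
  by (simp add: flat_def)

lemma level_filterlim:
  assumes "x \<in> disc"
  shows "filterlim (\<lambda>n. ev (level n) x) at_top sequentially"
proof -
  have "ev defect x > 0" using assms unfolding disc_iff by (simp add: ev_defect)
  then have "filterlim (\<lambda>n. real n * ev defect x) at_top sequentially"
    by (intro filterlim_at_top_mult_tendsto_pos[OF tendsto_const _ filterlim_real_sequentially, unfolded mult.commute[of "ev defect x"]])
      auto
  from filterlim_tendsto_add_at_top[OF tendsto_const[of "-1"] this] show ?thesis
    unfolding level_def by simp
qed

lemma flat_limits:
  assumes "x \<in> disc"
  shows "(\<lambda>n. flat 0 (ev (level n) x)) \<longlonglongrightarrow> 1"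
    and "(\<lambda>n. (ev (level n) x + 1) * flat 2 (ev (level n) x)) \<longlonglongrightarrow> 0"
proof -
  have i: "((\<lambda>t::real. inverse t) \<longlongrightarrow> 0) at_top" by (rule tendsto_inverse_0_at_top[OF filterlim_ident])
  have "((\<lambda>t. exp (- inverse t)) \<longlongrightarrow> exp (- (0::real))) at_top"
    by (intro tendsto_intros i)
  moreover have "\<forall>\<^sub>F t in at_top. exp (- inverse t) = flat 0 t"
    using eventually_gt_at_top[of 0] by eventually_elim (simp add: flat_def divide_inverse)
  ultimately have "(flat 0 \<longlongrightarrow> 1) at_top" by (simp add: tendsto_cong)
  then show "(\<lambda>n. flat 0 (ev (level n) x)) \<longlonglongrightarrow> 1"
    by (rule filterlim_compose) (rule level_filterlim[OF assms])
  have "((\<lambda>t. exp (- inverse t) * (inverse t + (inverse t)\<^sup>2)) \<longlongrightarrow> exp (- (0::real)) * (0 + 0\<^sup>2)) at_top"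
    by (intro tendsto_intros i)
  moreover have "\<forall>\<^sub>F t in at_top. exp (- inverse t) * (inverse t + (inverse t)\<^sup>2) = (t + 1) * flat 2 t"
    using eventually_gt_at_top[of 0]
    by eventually_elim (simp add: flat_def field_simps power2_eq_square)
  ultimately have "((\<lambda>t. (t + 1) * flat 2 t) \<longlongrightarrow> 0) at_top" by (simp add: tendsto_cong)
  then show "(\<lambda>n. (ev (level n) x + 1) * flat 2 (ev (level n) x)) \<longlonglongrightarrow> 0"
    by (rule filterlim_compose) (rule level_filterlim[OF assms])
qed

lemma ev_bounded_on_disc:
  obtains C where "\<And>x. x \<in> disc \<Longrightarrow> \<bar>ev p x\<bar> \<le> C" "C \<ge> 0"
proof -
  have "compact (ev p ` cball 0 1)" by (intro compact_continuous_image continuous_on_ev compact_cball)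
  then obtain C where "C > 0" "\<And>y. y \<in> ev p ` cball 0 1 \<Longrightarrow> norm y \<le> C" by (meson bounded_pos compact_imp_bounded)
  then show thesis by (intro that[of C]) auto
qed

lemma ev_measurable_lebesgue_on: "ev p \<in> borel_measurable (lebesgue_on (A :: 'a::euclidean_space set))"
  using ev_measurable by (intro measurable_restrict_space1 measurable_completion) simp

text \<open>The gradient of the defect is -2x, so the derivative of the cutoff meets the field only
  through x . F. Tangency turns that into a multiple of the defect, and n * defect = level + 1
  absorbs the growing factor n.\<close>

lemma D_cutoff_field:
  assumes tangential: "x $ 1 * ev F1 x + x $ 2 * ev F2 x = ev defect x * ev W x"
  shows "ev (D e1 (Mul (cutoff n) F1)) x + ev (D e2 (Mul (cutoff n) F2)) x =
    ev (cutoff n) x * (ev (D e1 F1) x + ev (D e2 F2) x)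
      - 2 * ((ev (level n) x + 1) * flat 2 (ev (level n) x)) * ev W x"
proof -
  have "ev (D e1 (Mul (cutoff n) F1)) x + ev (D e2 (Mul (cutoff n) F2)) x =
    ev (cutoff n) x * (ev (D e1 F1) x + ev (D e2 F2) x)
    - 2 * flat 2 (ev (level n) x) * real n * (x $ 1 * ev F1 x + x $ 2 * ev F2 x)"
    by (simp add: ev_D_cutoff ev_D_defect algebra_simps)
  also have "2 * flat 2 (ev (level n) x) * real n * (x $ 1 * ev F1 x + x $ 2 * ev F2 x) =
    2 * ((ev (level n) x + 1) * flat 2 (ev (level n) x)) * ev W x"
    unfolding tangential by (simp add: level_def)
  finally show ?thesis .
qed

text \<open>The tangency condition on the field \<open>(F1, F2)\<close> makes the derivative of the cutoff
  contribute only a bounded term that vanishes in the limit, so no boundary term appears.\<close>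

lemma tangential_divergence:
  assumes u: "integrable (lebesgue_on disc) u" and R: "integrable (lebesgue_on disc) R"
    and tangential: "\<And>x. x \<in> disc \<Longrightarrow> x $ 1 * ev F1 x + x $ 2 * ev F2 x = ev defect x * ev W x"
    and cut: "\<And>n. (LINT x|lebesgue_on disc. u x * (ev (D e1 (Mul (cutoff n) F1)) x + ev (D e2 (Mul (cutoff n) F2)) x))
      = (LINT x|lebesgue_on disc. R x * ev (cutoff n) x)"
  shows "(LINT x|lebesgue_on disc. u x * (ev (D e1 F1) x + ev (D e2 F2) x)) = (LINT x|lebesgue_on disc. R x)"
proof -
  define dv where "dv = Add (D e1 F1) (D e2 F2)"
  obtain C where C: "\<And>x. x \<in> disc \<Longrightarrow> \<bar>ev dv x\<bar> \<le> C" "C \<ge> 0"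
    using ev_bounded_on_disc[of dv] by blast
  obtain C' where C': "\<And>x. x \<in> disc \<Longrightarrow> \<bar>ev W x\<bar> \<le> C'" "C' \<ge> 0"
    using ev_bounded_on_disc[of W] by blast
  define b where "b n x = ev (D e1 (Mul (cutoff n) F1)) x + ev (D e2 (Mul (cutoff n) F2)) x" for n x
  have b: "b n x = ev (cutoff n) x * ev dv x - 2 * ((ev (level n) x + 1) * flat 2 (ev (level n) x)) * ev W x"
    if "x \<in> disc" for n x
    using D_cutoff_field[OF tangential[OF that]] by (simp add: b_def dv_def)
  have um: "u \<in> borel_measurable (lebesgue_on disc)" and Rm: "R \<in> borel_measurable (lebesgue_on disc)"
    using u R by auto
  have "(\<lambda>n. LINT x|lebesgue_on disc. u x * b n x) \<longlonglongrightarrow> (LINT x|lebesgue_on disc. u x * ev dv x)"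
  proof (rule integral_dominated_convergence)
    show "(\<lambda>x. u x * ev dv x) \<in> borel_measurable (lebesgue_on disc)"
      by (intro borel_measurable_times um ev_measurable_lebesgue_on)
    show "(\<lambda>x. u x * b n x) \<in> borel_measurable (lebesgue_on disc)" for n
      unfolding b_def by (intro borel_measurable_times borel_measurable_add um ev_measurable_lebesgue_on)
    \<comment> \<open>The 4 is the factor 2 from the gradient of the defect times the bound 2 of
      \<open>flat_error_bound\<close>; the cutoff itself is at most 1.\<close>
    show "integrable (lebesgue_on disc) (\<lambda>x. \<bar>u x\<bar> * (C + 4 * C'))" using u by auto
    show "AE x in lebesgue_on disc. (\<lambda>n. u x * b n x) \<longlonglongrightarrow> u x * ev dv x"
    proof (intro AE_I2)
      fix x assume "x \<in> space (lebesgue_on disc)"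
      then have x: "x \<in> disc" by simp
      have "(\<lambda>n. u x * (flat 0 (ev (level n) x) * ev dv x - 2 * ((ev (level n) x + 1) * flat 2 (ev (level n) x)) * ev W x))
        \<longlonglongrightarrow> u x * (1 * ev dv x - 2 * 0 * ev W x)"
        by (intro tendsto_intros flat_limits x)
      then show "(\<lambda>n. u x * b n x) \<longlonglongrightarrow> u x * ev dv x" by (simp add: b[OF x] cutoff_def)
    qed
    fix n
    show "AE x in lebesgue_on disc. norm (u x * b n x) \<le> \<bar>u x\<bar> * (C + 4 * C')"
    proof (intro AE_I2)
      fix x assume "x \<in> space (lebesgue_on disc)"
      then have x: "x \<in> disc" by simp
      have "\<bar>ev (cutoff n) x * ev dv x\<bar> \<le> 1 * C"
        unfolding abs_mult using C(1)[OF x] flat_nonneg flat_0_le_1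
        by (intro mult_mono) (auto simp: cutoff_def)
      moreover have "\<bar>2 * ((ev (level n) x + 1) * flat 2 (ev (level n) x)) * ev W x\<bar> \<le> 4 * C'"
        unfolding abs_mult[of _ "ev W x"] using C'(1)[OF x] flat_error_bound[of "ev (level n) x"]
        by (intro mult_mono) (auto simp: abs_if)
      ultimately have "\<bar>b n x\<bar> \<le> C + 4 * C'" unfolding b[OF x] by linarith
      then show "norm (u x * b n x) \<le> \<bar>u x\<bar> * (C + 4 * C')" by (simp add: abs_mult mult_left_mono)
    qed
  qed
  moreover have "(\<lambda>n. LINT x|lebesgue_on disc. R x * ev (cutoff n) x) \<longlonglongrightarrow> (LINT x|lebesgue_on disc. R x)"
  proof (rule integral_dominated_convergence)
    show "R \<in> borel_measurable (lebesgue_on disc)" by (rule Rm)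
    show "(\<lambda>x. R x * ev (cutoff n) x) \<in> borel_measurable (lebesgue_on disc)" for n
      by (intro borel_measurable_times Rm ev_measurable_lebesgue_on)
    show "integrable (lebesgue_on disc) (\<lambda>x. \<bar>R x\<bar>)" using R by auto
    show "AE x in lebesgue_on disc. (\<lambda>n. R x * ev (cutoff n) x) \<longlonglongrightarrow> R x"
    proof (intro AE_I2)
      fix x assume "x \<in> space (lebesgue_on disc)"
      then have x: "x \<in> disc" by simp
      have "(\<lambda>n. R x * flat 0 (ev (level n) x)) \<longlonglongrightarrow> R x * 1" by (intro tendsto_intros flat_limits x)
      then show "(\<lambda>n. R x * ev (cutoff n) x) \<longlonglongrightarrow> R x" by (simp add: cutoff_def)
    qed
    show "AE x in lebesgue_on disc. norm (R x * ev (cutoff n) x) \<le> \<bar>R x\<bar>" for n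
      using flat_nonneg[of 0] flat_0_le_1 by (intro AE_I2) (auto simp: cutoff_def abs_mult mult_left_le)
  qed
  ultimately show ?thesis using cut LIMSEQ_unique unfolding b_def dv_def by fastforce
qed

lemma H1_gradD:
  assumes "H1_grad disc u g"
  shows "u \<in> L2 disc" "(\<lambda>x. g x $ 1) \<in> L2 disc" "(\<lambda>x. g x $ 2) \<in> L2 disc"
    and "test_function disc \<phi> \<Longrightarrow> (LINT x|lebesgue_on disc. u x * frechet_derivative \<phi> (at x) (axis i 1))
      = - (LINT x|lebesgue_on disc. g x $ i * \<phi> x)"
proof -
  have i: "axis i 1 \<in> (Basis :: (real^2) set)" for i by (auto simp: Basis_vec_def)
  show "u \<in> L2 disc" "(\<lambda>x. g x $ 1) \<in> L2 disc" "(\<lambda>x. g x $ 2) \<in> L2 disc"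
    using assms i[of 1] i[of 2] unfolding H1_grad_def by (auto simp: cart_eq_inner_axis)
  show "test_function disc \<phi> \<Longrightarrow> (LINT x|lebesgue_on disc. u x * frechet_derivative \<phi> (at x) (axis i 1))
      = - (LINT x|lebesgue_on disc. g x $ i * \<phi> x)"
    using assms i[of i] unfolding H1_grad_def by (auto simp: cart_eq_inner_axis)
qed

lemma disc_lmeasurable: "disc \<in> lmeasurable"
  by (simp add: lmeasurable_open)

lemma ev_L2_disc: "ev p \<in> L2 disc"
  by (intro continuous_L2 continuous_on_ev) auto

lemma H1_grad_tangential:
  assumes u: "H1_grad disc u g"
    and tangential: "\<And>x. x \<in> disc \<Longrightarrow> x $ 1 * ev F1 x + x $ 2 * ev F2 x = ev defect x * ev W x"
  shows "(LINT x|lebesgue_on disc. u x * (ev (D e1 F1) x + ev (D e2 F2) x)) =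
    - (LINT x|lebesgue_on disc. g x $ 1 * ev F1 x + g x $ 2 * ev F2 x)"
proof -
  note h = H1_gradD[OF u]
  define R where "R x = - (g x $ 1 * ev F1 x + g x $ 2 * ev F2 x)" for x
  have intR: "integrable (lebesgue_on disc) R"
    unfolding R_def using h by (intro Bochner_Integration.integrable_minus Bochner_Integration.integrable_add L2_mult_integrable ev_L2_disc) auto
  have "(LINT x|lebesgue_on disc. u x * (ev (D e1 F1) x + ev (D e2 F2) x)) = (LINT x|lebesgue_on disc. R x)"
  proof (rule tangential_divergence[OF L2_integrable[OF disc_lmeasurable h(1)] intR tangential])
    fix n
    have "(LINT x|lebesgue_on disc. u x * (ev (D e1 (Mul (cutoff n) F1)) x + ev (D e2 (Mul (cutoff n) F2)) x))
      = (LINT x|lebesgue_on disc. u x * ev (D e1 (Mul (cutoff n) F1)) x) + (LINT x|lebesgue_on disc. u x * ev (D e2 (Mul (cutoff n) F2)) x)"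
      unfolding distrib_left by (intro Bochner_Integration.integral_add L2_mult_integrable ev_L2_disc h)
    also have "\<dots> = - (LINT x|lebesgue_on disc. g x $ 1 * ev (Mul (cutoff n) F1) x) - (LINT x|lebesgue_on disc. g x $ 2 * ev (Mul (cutoff n) F2) x)"
      using h(4)[OF cutoff_test_function, of n F1 1] h(4)[OF cutoff_test_function, of n F2 2]
      by (simp only: frechet_derivative_ev)
    also have "\<dots> = - (LINT x|lebesgue_on disc. g x $ 1 * ev (Mul (cutoff n) F1) x + g x $ 2 * ev (Mul (cutoff n) F2) x)"
      by (subst Bochner_Integration.integral_add) (auto intro!: L2_mult_integrable[OF _ ev_L2_disc] h simp del: ev.simps)
    also have "\<dots> = (LINT x|lebesgue_on disc. R x * ev (cutoff n) x)"
      unfolding Bochner_Integration.integral_minus[symmetric]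
      by (intro Bochner_Integration.integral_cong) (auto simp: R_def algebra_simps)
    finally show "(LINT x|lebesgue_on disc. u x * (ev (D e1 (Mul (cutoff n) F1)) x + ev (D e2 (Mul (cutoff n) F2)) x))
      = (LINT x|lebesgue_on disc. R x * ev (cutoff n) x)" .
  qed auto
  then show ?thesis unfolding R_def by (simp only: Bochner_Integration.integral_minus)
qed

section \<open>The Hilbert space $L^2$ of the disc\<close>

text \<open>A partial equivalence: only square-integrable functions are related to themselves, so
  the quotient is exactly \<open>L2\<close> modulo null sets.\<close>

definition l2_rel :: "(real^2 \<Rightarrow> real) \<Rightarrow> (real^2 \<Rightarrow> real) \<Rightarrow> bool" where
  "l2_rel u v \<longleftrightarrow> u \<in> L2 disc \<and> v \<in> L2 disc \<and> (AE x in lebesgue_on disc. u x = v x)"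

lemma L2_zero: "(\<lambda>x. 0) \<in> L2 \<Omega>"
  by (simp add: L2_def)

lemma L2_diff: "u \<in> L2 \<Omega> \<Longrightarrow> v \<in> L2 \<Omega> \<Longrightarrow> (\<lambda>x. u x - v x) \<in> L2 \<Omega>"
  using L2_add[OF _ L2_scale[of v \<Omega> "-1"]] by simp

quotient_type l2 = "real^2 \<Rightarrow> real" / partial: l2_rel
  morphisms rep_l2 abs_l2
proof (rule part_equivpI)
  show "\<exists>x. l2_rel x x" by (rule exI[of _ "\<lambda>x. 0"]) (simp add: l2_rel_def L2_zero)
  show "symp l2_rel" by (auto simp: symp_def l2_rel_def elim: eventually_mono)
  show "transp l2_rel"
    by (auto simp: transp_def l2_rel_def elim: eventually_elim2)
qed

instantiation l2 :: real_inner
begin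

lift_definition zero_l2 :: l2 is "\<lambda>x. 0" by (simp add: l2_rel_def L2_zero)

lift_definition plus_l2 :: "l2 \<Rightarrow> l2 \<Rightarrow> l2" is "\<lambda>u v x. u x + v x"
  by (auto simp: l2_rel_def L2_add elim: eventually_elim2)

lift_definition minus_l2 :: "l2 \<Rightarrow> l2 \<Rightarrow> l2" is "\<lambda>u v x. u x - v x"
  by (auto simp: l2_rel_def L2_diff elim: eventually_elim2)

lift_definition uminus_l2 :: "l2 \<Rightarrow> l2" is "\<lambda>u x. - u x"
  using L2_scale[of _ disc "-1"] by (auto simp: l2_rel_def)

lift_definition scaleR_l2 :: "real \<Rightarrow> l2 \<Rightarrow> l2" is "\<lambda>c u x. c * u x"
  by (auto simp: l2_rel_def L2_scale)

lift_definition inner_l2 :: "l2 \<Rightarrow> l2 \<Rightarrow> real" is "\<lambda>u v. LINT x|lebesgue_on disc. u x * v x"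
  by (auto simp: l2_rel_def L2_def intro!: integral_cong_AE)

definition norm_l2 :: "l2 \<Rightarrow> real" where "norm_l2 x = sqrt (inner x x)"
definition dist_l2 :: "l2 \<Rightarrow> l2 \<Rightarrow> real" where "dist_l2 x y = norm (x - y)"
definition sgn_l2 :: "l2 \<Rightarrow> l2" where "sgn_l2 x = inverse (norm x) *\<^sub>R x"
definition uniformity_l2 :: "(l2 \<times> l2) filter" where
  "uniformity_l2 = (INF e\<in>{0 <..}. principal {(x, y). dist x y < e})"
definition open_l2 :: "l2 set \<Rightarrow> bool" where
  "open_l2 U \<longleftrightarrow> (\<forall>x\<in>U. \<forall>\<^sub>F (x', y) in uniformity. x' = x \<longrightarrow> y \<in> U)"

instance
proof
  fix a b c :: l2 and r s :: real
  show "a + b + c = a + (b + c)"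
    by transfer (auto simp: l2_rel_def L2_add add.assoc)
  show "a + b = b + a" by transfer (auto simp: l2_rel_def L2_add add.commute)
  show "0 + a = a" by transfer (auto simp: l2_rel_def)
  show "- a + a = 0" by transfer (auto simp: l2_rel_def L2_zero)
  show "a - b = a + - b" by transfer (auto simp: l2_rel_def L2_diff)
  show "r *\<^sub>R (a + b) = r *\<^sub>R a + r *\<^sub>R b"
    by transfer (auto simp: l2_rel_def L2_add L2_scale distrib_left)
  show "(r + s) *\<^sub>R a = r *\<^sub>R a + s *\<^sub>R a"
    by transfer (auto simp: l2_rel_def L2_add L2_scale distrib_right)
  show "r *\<^sub>R s *\<^sub>R a = (r * s) *\<^sub>R a"
    by transfer (auto simp: l2_rel_def L2_scale mult.assoc)
  show "1 *\<^sub>R a = a" by transfer (auto simp: l2_rel_def)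
  show "dist a b = norm (a - b)" by (rule dist_l2_def)
  show "sgn a = inverse (norm a) *\<^sub>R a" by (rule sgn_l2_def)
  show "(uniformity :: (l2 \<times> l2) filter) = (INF e\<in>{0 <..}. principal {(x, y). dist x y < e})"
    by (rule uniformity_l2_def)
  show "open U \<longleftrightarrow> (\<forall>x\<in>U. \<forall>\<^sub>F (x', y) in uniformity. x' = x \<longrightarrow> y \<in> U)" for U :: "l2 set"
    by (rule open_l2_def)
  show "a \<bullet> b = b \<bullet> a" by transfer (simp add: mult.commute)
  show "(a + b) \<bullet> c = a \<bullet> c + b \<bullet> c"
    by transfer (auto simp: l2_rel_def distrib_right L2_mult_integrable)
  show "(r *\<^sub>R a) \<bullet> b = r * (a \<bullet> b)" by transfer (simp add: mult.assoc)
  show "0 \<le> a \<bullet> a" by transfer simp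
  show "a \<bullet> a = 0 \<longleftrightarrow> a = 0"
  proof transfer
    fix u assume "l2_rel u u"
    then have u: "u \<in> L2 disc" by (simp add: l2_rel_def)
    have "(LINT x|lebesgue_on disc. u x * u x) = 0 \<longleftrightarrow> (AE x in lebesgue_on disc. u x * u x = 0)"
      using L2_mult_integrable[OF u u] by (intro integral_nonneg_eq_0_iff_AE) auto
    then show "((LINT x|lebesgue_on disc. u x * u x) = 0) = l2_rel u (\<lambda>x. 0)"
      using u by (simp add: l2_rel_def L2_zero)
  qed
  show "norm a = sqrt (a \<bullet> a)" by (rule norm_l2_def)
qed

end

lemma rep_l2_L2: "rep_l2 a \<in> L2 disc"
  using Quotient_rep_reflp[OF Quotient_l2, of a] by (simp add: l2_rel_def)

lemma abs_rep_l2: "abs_l2 (rep_l2 a) = a"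
  by (rule Quotient_abs_rep[OF Quotient_l2])

lemma abs_l2_eq_iff:
  "u \<in> L2 disc \<Longrightarrow> v \<in> L2 disc \<Longrightarrow> abs_l2 u = abs_l2 v \<longleftrightarrow> (AE x in lebesgue_on disc. u x = v x)"
  using Quotient_rel[OF Quotient_l2, of u v] by (auto simp: l2_rel_def)

lemma abs_l2_simps:
  assumes "u \<in> L2 disc" "v \<in> L2 disc"
  shows "abs_l2 u + abs_l2 v = abs_l2 (\<lambda>x. u x + v x)"
    "abs_l2 u - abs_l2 v = abs_l2 (\<lambda>x. u x - v x)"
    "abs_l2 u \<bullet> abs_l2 v = (LINT x|lebesgue_on disc. u x * v x)"
  using assms by (auto simp: l2_rel_def plus_l2.abs_eq minus_l2.abs_eq inner_l2.abs_eq)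

lemma abs_l2_scaleR: "u \<in> L2 disc \<Longrightarrow> c *\<^sub>R abs_l2 u = abs_l2 (\<lambda>x. c * u x)"
  by (simp add: l2_rel_def scaleR_l2.abs_eq)

lemma abs_l2_zero: "abs_l2 (\<lambda>x. 0) = 0"
  by (simp add: zero_l2_def)

lemma norm_abs_l2:
  assumes "u \<in> L2 disc"
  shows "(norm (abs_l2 u))\<^sup>2 = (LINT x|lebesgue_on disc. (u x)\<^sup>2)"
  unfolding power2_norm_eq_inner using assms by (simp add: abs_l2_simps power2_eq_square)

lemma abs_l2_eq_0_iff: "u \<in> L2 disc \<Longrightarrow> abs_l2 u = 0 \<longleftrightarrow> (AE x in lebesgue_on disc. u x = 0)"
  using abs_l2_eq_iff[of u "\<lambda>x. 0"] by (simp add: abs_l2_zero L2_zero)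

lemma L2_sum: "(\<And>i. i \<in> I \<Longrightarrow> u i \<in> L2 \<Omega>) \<Longrightarrow> (\<lambda>x. \<Sum>i\<in>I. u i x) \<in> L2 \<Omega>"
  by (induction I rule: infinite_finite_induct) (auto simp: L2_zero L2_add)

lemma abs_l2_sum:
  assumes "\<And>i. i \<in> I \<Longrightarrow> u i \<in> L2 disc"
  shows "(\<Sum>i\<in>I. c i *\<^sub>R abs_l2 (u i)) = abs_l2 (\<lambda>x. \<Sum>i\<in>I. c i * u i x)"
  using assms
proof (induction I rule: infinite_finite_induct)
  case (insert i I)
  then have "(\<Sum>j\<in>insert i I. c j *\<^sub>R abs_l2 (u j)) = abs_l2 (\<lambda>x. c i * u i x) + abs_l2 (\<lambda>x. \<Sum>j\<in>I. c j * u j x)"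
    by (simp add: abs_l2_scaleR)
  also have "\<dots> = abs_l2 (\<lambda>x. c i * u i x + (\<Sum>j\<in>I. c j * u j x))"
    using insert by (intro abs_l2_simps L2_scale L2_sum) auto
  finally show ?case using insert by simp
qed (simp_all add: abs_l2_zero)

text \<open>An $L^2$-Cauchy sequence is $L^1$-Cauchy on the disc, hence has an almost everywhere
  convergent subsequence; Fatou's lemma upgrades this to $L^2$-convergence.\<close>

instance l2 :: complete_space
proof
  fix A :: "nat \<Rightarrow> l2" assume A: "Cauchy A"
  define s where "s n = rep_l2 (A n)" for n
  have s: "s n \<in> L2 disc" for n by (simp add: s_def rep_l2_L2)
  have As: "A n = abs_l2 (s n)" for n by (simp add: s_def abs_rep_l2)
  have sm: "s n \<in> borel_measurable (lebesgue_on disc)" for n using s[of n] by (simp add: L2_def)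
  \<comment> \<open>Pairing with the constant 1, which is square integrable on the disc, turns the
    L2 Cauchy condition into an L1 one by Cauchy-Schwarz.\<close>
  define one :: l2 where "one = abs_l2 (\<lambda>x. 1)"
  have one: "(\<lambda>x. 1) \<in> L2 disc" by (intro L2_bounded[OF disc_lmeasurable, of _ 1]) auto
  have L1: "(LINT x|lebesgue_on disc. norm (s i x - s j x)) \<le> norm (A i - A j) * norm one" for i j
  proof -
    have d: "(\<lambda>x. s i x - s j x) \<in> L2 disc" by (intro L2_diff s)
    then have d': "(\<lambda>x. \<bar>s i x - s j x\<bar>) \<in> L2 disc" by (auto simp: L2_def)
    have "(LINT x|lebesgue_on disc. norm (s i x - s j x)) = abs_l2 (\<lambda>x. \<bar>s i x - s j x\<bar>) \<bullet> one"
      unfolding one_def using d' one by (simp add: abs_l2_simps)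
    also have "\<dots> \<le> norm (abs_l2 (\<lambda>x. \<bar>s i x - s j x\<bar>)) * norm one" by (rule norm_cauchy_schwarz)
    also have "norm (abs_l2 (\<lambda>x. \<bar>s i x - s j x\<bar>)) = norm (abs_l2 (\<lambda>x. s i x - s j x))"
      using norm_abs_l2[OF d] norm_abs_l2[OF d'] by (auto intro: power2_eq_imp_eq[OF _ norm_ge_zero norm_ge_zero])
    also have "abs_l2 (\<lambda>x. s i x - s j x) = A i - A j" by (simp add: As abs_l2_simps s)
    finally show ?thesis .
  qed
  have "\<exists>N. \<forall>i\<ge>N. \<forall>j\<ge>N. LINT x|lebesgue_on disc. norm (s i x - s j x) < e" if e: "e > 0" for e
  proof -
    obtain N where N: "\<And>i j. i \<ge> N \<Longrightarrow> j \<ge> N \<Longrightarrow> norm (A i - A j) < e / (norm one + 1)"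
      using CauchyD[OF A, of "e / (norm one + 1)"] e by (auto simp: add_nonneg_pos)
    have "(LINT x|lebesgue_on disc. norm (s i x - s j x)) < e" if "i \<ge> N" "j \<ge> N" for i j
    proof -
      have "norm (A i - A j) * norm one \<le> e / (norm one + 1) * norm one"
        using N[OF that] by (intro mult_right_mono) auto
      also have "\<dots> < e" using e
        by (subst times_divide_eq_left, subst pos_divide_less_eq) (auto simp: add_pos_nonneg add_nonneg_pos algebra_simps)
      finally show ?thesis using L1[of i j] by simp
    qed
    then show ?thesis by blast
  qed
  then obtain r where r: "strict_mono r" "AE x in lebesgue_on disc. Cauchy (\<lambda>i. s (r i) x)"
    by (rule cauchy_L1_AE_cauchy_subseq[OF L2_integrable[OF disc_lmeasurable s]])
  define u where "u x = lim (\<lambda>i. s (r i) x)" for x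
  have lim: "AE x in lebesgue_on disc. (\<lambda>i. s (r i) x) \<longlonglongrightarrow> u x"
    using r(2) by eventually_elim (simp add: u_def Cauchy_convergent_iff convergent_LIMSEQ_iff)
  have um: "u \<in> borel_measurable (lebesgue_on disc)"
    unfolding u_def using sm by (intro borel_measurable_lim_metric) auto
  have fatou: "(\<lambda>x. s n x - u x) \<in> L2 disc \<and> (LINT x|lebesgue_on disc. (s n x - u x)\<^sup>2) \<le> e\<^sup>2"
    if N: "\<And>i j. i \<ge> N \<Longrightarrow> j \<ge> N \<Longrightarrow> norm (A i - A j) \<le> e" and n: "n \<ge> N" for n N and e :: real
  proof -
    have sq: "(LINT x|lebesgue_on disc. (s n x - s m x)\<^sup>2) \<le> e\<^sup>2" if "m \<ge> N" for m
    proof -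
      have "(LINT x|lebesgue_on disc. (s n x - s m x)\<^sup>2) = (norm (A n - A m))\<^sup>2"
        unfolding As abs_l2_simps(2)[OF s s] by (intro norm_abs_l2[symmetric] L2_diff s)
      then show ?thesis using N[OF n that] by (simp add: power_mono)
    qed
    have nn: "(\<integral>\<^sup>+x. ennreal ((s n x - s m x)\<^sup>2) \<partial>lebesgue_on disc) \<le> ennreal (e\<^sup>2)" if "m \<ge> N" for m
    proof -
      have "integrable (lebesgue_on disc) (\<lambda>x. (s n x - s m x)\<^sup>2)"
        using L2_diff[OF s s] by (simp add: L2_def)
      then show ?thesis using sq[OF that] by (subst nn_integral_eq_integral) (auto simp: ennreal_leI)
    qed
    have "(\<integral>\<^sup>+x. ennreal ((s n x - u x)\<^sup>2) \<partial>lebesgue_on disc)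
        = (\<integral>\<^sup>+x. liminf (\<lambda>i. ennreal ((s n x - s (r i) x)\<^sup>2)) \<partial>lebesgue_on disc)"
    proof (rule nn_integral_cong_AE)
      show "AE x in lebesgue_on disc. ennreal ((s n x - u x)\<^sup>2) = liminf (\<lambda>i. ennreal ((s n x - s (r i) x)\<^sup>2))"
        using lim
      proof eventually_elim
        case (elim x)
        have "(\<lambda>i. ennreal ((s n x - s (r i) x)\<^sup>2)) \<longlonglongrightarrow> ennreal ((s n x - u x)\<^sup>2)"
          by (intro tendsto_intros elim tendsto_ennrealI)
        from lim_imp_Liminf[OF _ this] show ?case by simp
      qed
    qed
    also have "\<dots> \<le> liminf (\<lambda>i. \<integral>\<^sup>+x. ennreal ((s n x - s (r i) x)\<^sup>2) \<partial>lebesgue_on disc)"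
      using sm by (intro nn_integral_liminf) auto
    also have "\<dots> \<le> ennreal (e\<^sup>2)"
    proof (rule Liminf_le)
      show "\<forall>\<^sub>F i in sequentially. (\<integral>\<^sup>+x. ennreal ((s n x - s (r i) x)\<^sup>2) \<partial>lebesgue_on disc) \<le> ennreal (e\<^sup>2)"
        using nn seq_suble[OF r(1)] by (intro eventually_sequentiallyI[of N]) (meson order_trans)
    qed simp
    finally have F: "(\<integral>\<^sup>+x. ennreal ((s n x - u x)\<^sup>2) \<partial>lebesgue_on disc) \<le> ennreal (e\<^sup>2)" .
    have i: "integrable (lebesgue_on disc) (\<lambda>x. (s n x - u x)\<^sup>2)"
      using F sm um by (intro integrableI_nonneg) (auto intro: le_less_trans)
    then have "(\<lambda>x. s n x - u x) \<in> L2 disc" using sm um by (auto simp: L2_def)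
    moreover have "(LINT x|lebesgue_on disc. (s n x - u x)\<^sup>2) \<le> e\<^sup>2"
      using F by (subst (asm) nn_integral_eq_integral[OF i]) (auto simp: ennreal_le_iff)
    ultimately show ?thesis by blast
  qed
  have CA: "\<exists>N. \<forall>i\<ge>N. \<forall>j\<ge>N. norm (A i - A j) \<le> e" if "e > 0" for e :: real
    using CauchyD[OF A that] by (meson less_imp_le)
  obtain N0 where "\<And>i j. i \<ge> N0 \<Longrightarrow> j \<ge> N0 \<Longrightarrow> norm (A i - A j) \<le> 1"
    using CA[of 1] by auto
  then have "(\<lambda>x. s N0 x - u x) \<in> L2 disc" using fatou[of N0 1 N0] by simp
  from L2_diff[OF s[of N0] this] have u: "u \<in> L2 disc" by simp
  have "A \<longlonglongrightarrow> abs_l2 u"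
  proof (rule LIMSEQ_I)
    fix e :: real assume e: "e > 0"
    obtain N where N: "\<And>i j. i \<ge> N \<Longrightarrow> j \<ge> N \<Longrightarrow> norm (A i - A j) \<le> e / 2"
      using CA[of "e / 2"] e by auto
    have "norm (A n - abs_l2 u) < e" if "n \<ge> N" for n
    proof -
      have "(norm (A n - abs_l2 u))\<^sup>2 = (LINT x|lebesgue_on disc. (s n x - u x)\<^sup>2)"
        unfolding As abs_l2_simps(2)[OF s u] by (intro norm_abs_l2 L2_diff s u)
      also have "\<dots> \<le> (e / 2)\<^sup>2" using fatou[OF N that] by blast
      finally have "norm (A n - abs_l2 u) \<le> e / 2" by (rule power2_le_imp_le) (use e in linarith)
      then show ?thesis using e by linarith
    qed
    then show "\<exists>N. \<forall>n\<ge>N. norm (A n - abs_l2 u) < e" by blast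
  qed
  then show "convergent A" by (rule convergentI)
qed

section \<open>The space $H^1$ of the disc\<close>

text \<open>The graph of the weak gradient, on triples (u, g1, g2) of classes. Each test function
  contributes two closed linear equations, from which closedness and the subspace property follow
  directly.\<close>

definition H1 :: "(l2 \<times> l2 \<times> l2) set" where
  "H1 = {U. \<forall>\<phi>. test_function disc \<phi> \<longrightarrow>
     fst U \<bullet> abs_l2 (\<lambda>x. frechet_derivative \<phi> (at x) e1) = - (fst (snd U) \<bullet> abs_l2 \<phi>) \<and>
     fst U \<bullet> abs_l2 (\<lambda>x. frechet_derivative \<phi> (at x) e2) = - (snd (snd U) \<bullet> abs_l2 \<phi>)}"

lemma subspace_H1: "subspace H1"
  by (auto simp: subspace_def H1_def inner_add_left)

lemma closed_H1: "closed H1"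
proof -
  have eq: "H1 = (\<Inter>\<phi>\<in>{\<phi>. test_function disc \<phi>}.
    {U. fst U \<bullet> abs_l2 (\<lambda>x. frechet_derivative \<phi> (at x) e1) = - (fst (snd U) \<bullet> abs_l2 \<phi>)} \<inter>
    {U. fst U \<bullet> abs_l2 (\<lambda>x. frechet_derivative \<phi> (at x) e2) = - (snd (snd U) \<bullet> abs_l2 \<phi>)})"
    by (auto simp: H1_def)
  show ?thesis
    unfolding eq by (intro closed_INT ballI closed_Int closed_Collect_eq continuous_intros)
qed

lemma test_function_L2_disc:
  assumes "test_function disc \<phi>"
  shows "\<phi> \<in> L2 disc" "(\<lambda>x. frechet_derivative \<phi> (at x) (axis i 1)) \<in> L2 disc"
  using test_function_L2[OF open_ball bounded_ball assms] by (auto simp: Basis_vec_def)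

lemma H1_grad_iff:
  "H1_grad disc u g \<longleftrightarrow> u \<in> L2 disc \<and> (\<lambda>x. g x $ 1) \<in> L2 disc \<and> (\<lambda>x. g x $ 2) \<in> L2 disc \<and>
    (abs_l2 u, abs_l2 (\<lambda>x. g x $ 1), abs_l2 (\<lambda>x. g x $ 2)) \<in> H1"
proof (cases "u \<in> L2 disc \<and> (\<lambda>x. g x $ 1) \<in> L2 disc \<and> (\<lambda>x. g x $ 2) \<in> L2 disc")
  case True
  then show ?thesis
    unfolding H1_grad_def H1_def Basis_vec2
    by (auto simp: abs_l2_simps test_function_L2_disc inner_axis)
next
  case False
  then show ?thesis using H1_gradD[of u g] by blast
qed

lemma H1_representation:
  assumes "U \<in> H1"
  obtains u g where "H1_grad disc u g"
    "U = (abs_l2 u, abs_l2 (\<lambda>x. g x $ 1), abs_l2 (\<lambda>x. g x $ 2))"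
proof
  define g where "g x = ((\<chi> i. if i = 1 then rep_l2 (fst (snd U)) x else rep_l2 (snd (snd U)) x) :: real^2)" for x :: "real^2"
  have g: "g x $ 1 = rep_l2 (fst (snd U)) x" "g x $ 2 = rep_l2 (snd (snd U)) x" for x
    by (simp_all add: g_def)
  show *: "U = (abs_l2 (rep_l2 (fst U)), abs_l2 (\<lambda>x. g x $ 1), abs_l2 (\<lambda>x. g x $ 2))"
    by (simp add: g abs_rep_l2)
  show "H1_grad disc (rep_l2 (fst U)) g"
    unfolding H1_grad_iff using assms *[symmetric] by (simp add: g rep_l2_L2 abs_rep_l2)
qed

lemma H1_green:
  assumes U: "U \<in> H1"
    and tangential: "\<And>x. x \<in> disc \<Longrightarrow> x $ 1 * ev F1 x + x $ 2 * ev F2 x = ev defect x * ev W x"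
  shows "fst U \<bullet> abs_l2 (ev (Add (D e1 F1) (D e2 F2))) =
    - (fst (snd U) \<bullet> abs_l2 (ev F1) + snd (snd U) \<bullet> abs_l2 (ev F2))"
proof -
  obtain u g where g: "H1_grad disc u g" and U_eq: "U = (abs_l2 u, abs_l2 (\<lambda>x. g x $ 1), abs_l2 (\<lambda>x. g x $ 2))"
    using H1_representation[OF U] .
  note h = H1_gradD[OF g]
  have "fst U \<bullet> abs_l2 (ev (Add (D e1 F1) (D e2 F2))) = (LINT x|lebesgue_on disc. u x * (ev (D e1 F1) x + ev (D e2 F2) x))"
    unfolding U_eq using abs_l2_simps(3)[OF h(1) ev_L2_disc] by simp
  also have "\<dots> = - (LINT x|lebesgue_on disc. g x $ 1 * ev F1 x + g x $ 2 * ev F2 x)"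
    by (rule H1_grad_tangential[OF g tangential])
  also have "\<dots> = - ((LINT x|lebesgue_on disc. g x $ 1 * ev F1 x) + (LINT x|lebesgue_on disc. g x $ 2 * ev F2 x))"
    by (subst Bochner_Integration.integral_add) (auto intro!: L2_mult_integrable[OF _ ev_L2_disc] h)
  finally show ?thesis unfolding U_eq by (simp add: abs_l2_simps h ev_L2_disc)
qed

definition H1_of :: "(real^2) smooth \<Rightarrow> l2 \<times> l2 \<times> l2" where
  "H1_of p = (abs_l2 (ev p), abs_l2 (ev (D e1 p)), abs_l2 (ev (D e2 p)))"

lemma H1_of_in: "H1_of p \<in> H1"
proof -
  have "H1_grad disc (ev p) (\<lambda>x. \<Sum>b\<in>Basis. ev (D b p) x *\<^sub>R b)"
    by (intro H1_grad_ev) auto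
  moreover have "(\<Sum>b\<in>Basis. ev (D b p) x *\<^sub>R b) $ 1 = ev (D e1 p) x"
    "(\<Sum>b\<in>Basis. ev (D b p) x *\<^sub>R b) $ 2 = ev (D e2 p) x" for x
    using e1_neq_e2 by (simp_all add: Basis_vec2)
  ultimately show ?thesis by (simp add: H1_grad_iff H1_of_def)
qed

section \<open>Multiplication operators and the tangential energy\<close>

lemma L2_mult_ev:
  assumes "u \<in> L2 disc"
  shows "(\<lambda>x. ev p x * u x) \<in> L2 disc"
proof -
  obtain C where C: "\<And>x. x \<in> disc \<Longrightarrow> \<bar>ev p x\<bar> \<le> C" "C \<ge> 0" using ev_bounded_on_disc[of p] by blast
  have m: "(\<lambda>x. ev p x * u x) \<in> borel_measurable (lebesgue_on disc)"
    using assms by (intro borel_measurable_times ev_measurable_lebesgue_on) (simp add: L2_def)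
  have "integrable (lebesgue_on disc) (\<lambda>x. (ev p x * u x)\<^sup>2)"
  proof (rule Bochner_Integration.integrable_bound)
    show "integrable (lebesgue_on disc) (\<lambda>x. C\<^sup>2 * (u x)\<^sup>2)" using assms by (simp add: L2_def)
    show "(\<lambda>x. (ev p x * u x)\<^sup>2) \<in> borel_measurable (lebesgue_on disc)" using m by auto
    show "AE x in lebesgue_on disc. norm ((ev p x * u x)\<^sup>2) \<le> norm (C\<^sup>2 * (u x)\<^sup>2)"
    proof (rule AE_I2)
      fix x assume "x \<in> space (lebesgue_on disc)"
      then have "\<bar>ev p x\<bar>\<^sup>2 \<le> C\<^sup>2" using C by (intro power_mono) auto
      then show "norm ((ev p x * u x)\<^sup>2) \<le> norm (C\<^sup>2 * (u x)\<^sup>2)"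
        by (simp add: power_mult_distrib mult_right_mono)
    qed
  qed
  with m show ?thesis by (simp add: L2_def)
qed

lift_definition mult_ev :: "(real^2) smooth \<Rightarrow> l2 \<Rightarrow> l2" is "\<lambda>p u x. ev p x * u x"
  by (auto simp: l2_rel_def L2_mult_ev elim: eventually_mono)

lemma mult_ev_abs: "u \<in> L2 disc \<Longrightarrow> mult_ev p (abs_l2 u) = abs_l2 (\<lambda>x. ev p x * u x)"
  by (simp add: mult_ev.abs_eq l2_rel_def)

lemma mult_ev_inner: "mult_ev p a \<bullet> b = a \<bullet> mult_ev p b"
  by transfer (simp add: mult.left_commute mult.assoc)

lemma bounded_linear_mult_ev: "bounded_linear (mult_ev p)"
proof -
  obtain C where C: "\<And>x. x \<in> disc \<Longrightarrow> \<bar>ev p x\<bar> \<le> C" "C \<ge> 0" using ev_bounded_on_disc[of p] by blast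
  show ?thesis
  proof (rule bounded_linear_intro)
    show "mult_ev p (a + b) = mult_ev p a + mult_ev p b" for a b
      by transfer (auto simp: l2_rel_def distrib_left L2_add L2_mult_ev)
    show "mult_ev p (r *\<^sub>R a) = r *\<^sub>R mult_ev p a" for r a
      by transfer (auto simp: l2_rel_def mult.left_commute L2_scale L2_mult_ev)
    fix a
    define u where "u = rep_l2 a"
    have u: "u \<in> L2 disc" "a = abs_l2 u" by (simp_all add: u_def rep_l2_L2 abs_rep_l2)
    have "(LINT x|lebesgue_on disc. (ev p x * u x)\<^sup>2) \<le> (LINT x|lebesgue_on disc. C\<^sup>2 * (u x)\<^sup>2)"
    proof (rule integral_mono)
      fix x assume "x \<in> space (lebesgue_on disc)"
      then have "\<bar>ev p x\<bar>\<^sup>2 \<le> C\<^sup>2" using C by (intro power_mono) auto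
      then show "(ev p x * u x)\<^sup>2 \<le> C\<^sup>2 * (u x)\<^sup>2" by (simp add: power_mult_distrib mult_right_mono)
    qed (use u L2_mult_ev[OF u(1)] in \<open>auto simp: L2_def\<close>)
    then have "(norm (mult_ev p a))\<^sup>2 \<le> (norm a * C)\<^sup>2"
      unfolding u(2) mult_ev_abs[OF u(1)] power_mult_distrib norm_abs_l2[OF u(1)] norm_abs_l2[OF L2_mult_ev[OF u(1)]]
      by (simp add: mult.commute)
    then show "norm (mult_ev p a) \<le> norm a * C"
      by (rule power2_le_imp_le) (intro mult_nonneg_nonneg norm_ge_zero C(2))
  qed
qed

text \<open>The energy with matrix $I - x x^T$. Its field of fluxes is tangential to the circle for
  every gradient, and on homogeneous polynomials of degree $n$ its operator is $n(n+2)$ up to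
  terms of lower degree.\<close>

abbreviation XX :: "(real^2) smooth" where "XX \<equiv> Add (Const 1) (Mul (Const (-1)) (Mul X X))"
abbreviation YY :: "(real^2) smooth" where "YY \<equiv> Add (Const 1) (Mul (Const (-1)) (Mul Y Y))"
abbreviation XY :: "(real^2) smooth" where "XY \<equiv> Mul (Const (-1)) (Mul X Y)"

definition Q :: "l2 \<times> l2 \<Rightarrow> l2 \<times> l2 \<Rightarrow> real" where
  "Q g h = g \<bullet> (mult_ev XX (fst h) + mult_ev XY (snd h), mult_ev XY (fst h) + mult_ev YY (snd h))"

lemma bounded_bilinear_Q: "bounded_bilinear Q"
proof -
  have "bounded_linear (\<lambda>h :: l2 \<times> l2. (mult_ev XX (fst h) + mult_ev XY (snd h), mult_ev XY (fst h) + mult_ev YY (snd h)))"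
    by (intro bounded_linear_Pair bounded_linear_add bounded_linear_compose[OF bounded_linear_mult_ev]
        bounded_linear_fst bounded_linear_snd)
  from bounded_bilinear.comp[OF bounded_bilinear_inner bounded_linear_ident this]
  show ?thesis by (simp add: Q_def[abs_def])
qed

lemma Q_sym: "Q g h = Q h g"
proof -
  have sym: "a \<bullet> mult_ev p b = b \<bullet> mult_ev p a" for p a b
    by (subst mult_ev_inner[symmetric]) (rule inner_commute)
  show ?thesis
    unfolding Q_def inner_prod_def fst_conv snd_conv inner_add_right
      sym[of "fst g" _ "fst h"] sym[of "fst g" _ "snd h"] sym[of "snd g" _ "fst h"] sym[of "snd g" _ "snd h"]
    by simp
qed

text \<open>Pointwise the integrand is |g|^2 - (x . g)^2. Lagrange's identity and |x| < 1 put it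
  between 0 and |g|^2.\<close>

lemma Q_bounds: "0 \<le> Q g g" "Q g g \<le> (norm g)\<^sup>2"
proof -
  define a where "a = rep_l2 (fst g)"
  define b where "b = rep_l2 (snd g)"
  have ab: "a \<in> L2 disc" "b \<in> L2 disc" by (simp_all add: a_def b_def rep_l2_L2)
  have g: "g = (abs_l2 a, abs_l2 b)" by (simp add: a_def b_def abs_rep_l2)
  let ?q = "\<lambda>x. a x * (ev XX x * a x) + a x * (ev XY x * b x) + (b x * (ev XY x * a x) + b x * (ev YY x * b x))"
  have i: "integrable (lebesgue_on disc) (\<lambda>x. u x * (ev p x * v x))" if "u \<in> L2 disc" "v \<in> L2 disc" for u v p
    by (intro L2_mult_integrable L2_mult_ev that)
  have iq: "integrable (lebesgue_on disc) ?q"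
    by (intro Bochner_Integration.integrable_add i ab)
  have "Q g g = abs_l2 a \<bullet> mult_ev XX (abs_l2 a) + abs_l2 a \<bullet> mult_ev XY (abs_l2 b)
      + (abs_l2 b \<bullet> mult_ev XY (abs_l2 a) + abs_l2 b \<bullet> mult_ev YY (abs_l2 b))"
    by (simp add: Q_def g inner_prod_def inner_add_right)
  also have "\<dots> = (LINT x|lebesgue_on disc. ?q x)"
    by (simp only: mult_ev_abs abs_l2_simps(3) L2_mult_ev ab i
        Bochner_Integration.integrable_add Bochner_Integration.integral_add)
  finally have q: "Q g g = (LINT x|lebesgue_on disc. ?q x)" .
  have qx: "?q x = (a x)\<^sup>2 + (b x)\<^sup>2 - (x $ 1 * a x + x $ 2 * b x)\<^sup>2" for x
    by (simp add: inner_axis power2_eq_square algebra_simps)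
  have "0 \<le> ?q x" if "x \<in> disc" for x
  proof -
    have "(x $ 1 * a x + x $ 2 * b x)\<^sup>2 + (x $ 2 * a x - x $ 1 * b x)\<^sup>2 = ((x $ 1)\<^sup>2 + (x $ 2)\<^sup>2) * ((a x)\<^sup>2 + (b x)\<^sup>2)"
      by (simp add: power2_eq_square algebra_simps)
    also have "\<dots> \<le> 1 * ((a x)\<^sup>2 + (b x)\<^sup>2)" using that unfolding disc_iff by (intro mult_right_mono) auto
    finally have *: "(x $ 1 * a x + x $ 2 * b x)\<^sup>2 + (x $ 2 * a x - x $ 1 * b x)\<^sup>2 \<le> 1 * ((a x)\<^sup>2 + (b x)\<^sup>2)" .
    have "s \<le> t" if "s + r \<le> 1 * t" "0 \<le> r" for s r t :: real using that by simp
    from this[OF * zero_le_power2] have "(x $ 1 * a x + x $ 2 * b x)\<^sup>2 \<le> (a x)\<^sup>2 + (b x)\<^sup>2" .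
    then show ?thesis unfolding qx by simp
  qed
  then show "0 \<le> Q g g" unfolding q by (intro integral_nonneg_AE AE_I2) simp
  have isq: "integrable (lebesgue_on disc) (\<lambda>x. (a x)\<^sup>2)" "integrable (lebesgue_on disc) (\<lambda>x. (b x)\<^sup>2)"
    using ab by (auto simp: L2_def)
  have "Q g g \<le> (LINT x|lebesgue_on disc. (a x)\<^sup>2 + (b x)\<^sup>2)"
    unfolding q by (intro integral_mono iq Bochner_Integration.integrable_add isq) (simp only: qx, simp)
  also have "\<dots> = (norm g)\<^sup>2"
    unfolding g norm_Pair by (simp add: norm_abs_l2 ab isq)
  finally show "Q g g \<le> (norm g)\<^sup>2" .
qed

text \<open>The flux (I - x x^T) grad p satisfies x . flux = (1 - |x|^2) (x . grad p), so Green's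
  formula applies without a boundary term. \<open>A\<close> and \<open>B\<close> stand for
  simplified forms of the symbolic derivatives of \<open>p\<close>, which are then differentiated
  once more.\<close>

lemma Q_H1_of:
  assumes U: "U \<in> H1" and A: "abs_l2 (ev A) = abs_l2 (ev (D e1 p))" and B: "abs_l2 (ev B) = abs_l2 (ev (D e2 p))"
  shows "Q (snd U) (snd (H1_of p)) = - (fst U \<bullet> abs_l2 (ev
    (Add (D e1 (Add (Mul XX A) (Mul XY B))) (D e2 (Add (Mul XY A) (Mul YY B))))))"
proof -
  have "x $ 1 * ev (Add (Mul XX A) (Mul XY B)) x + x $ 2 * ev (Add (Mul XY A) (Mul YY B)) x =
    ev defect x * ev (Add (Mul X A) (Mul Y B)) x" for x
    by (simp add: ev_defect inner_axis power2_eq_square algebra_simps)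
  from H1_green[OF U this] have "- (fst U \<bullet> abs_l2 (ev
    (Add (D e1 (Add (Mul XX A) (Mul XY B))) (D e2 (Add (Mul XY A) (Mul YY B)))))) =
    fst (snd U) \<bullet> abs_l2 (ev (Add (Mul XX A) (Mul XY B))) + snd (snd U) \<bullet> abs_l2 (ev (Add (Mul XY A) (Mul YY B)))"
    by (simp del: ev.simps D.simps)
  moreover have "abs_l2 (ev (Add (Mul p A) (Mul q B))) = mult_ev p (abs_l2 (ev A)) + mult_ev q (abs_l2 (ev B))" for p q
  proof -
    have "ev (Add (Mul p A) (Mul q B)) = (\<lambda>x. ev p x * ev A x + ev q x * ev B x)" by (simp add: fun_eq_iff)
    then show ?thesis by (simp add: mult_ev_abs ev_L2_disc abs_l2_simps L2_mult_ev)
  qed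
  ultimately show ?thesis
    by (simp add: Q_def inner_prod_def H1_of_def A B del: ev.simps D.simps)
qed

section \<open>Monomials and their totality in L2 of the disc\<close>

primrec pw :: "'a smooth \<Rightarrow> nat \<Rightarrow> 'a smooth" where
  "pw p 0 = Const 1"
| "pw p (Suc n) = Mul p (pw p n)"

definition mon :: "nat \<Rightarrow> nat \<Rightarrow> (real^2) smooth" where
  "mon i j = Mul (pw X i) (pw Y j)"

lemma ev_pw: "ev (pw p n) x = ev p x ^ n"
  by (induction n) auto

lemma ev_D_pw: "ev (D h (pw p n)) x = real n * ev p x ^ (n - 1) * ev (D h p) x"
proof (induction n)
  case (Suc n)
  then show ?case by (cases n) (simp_all add: ev_pw algebra_simps)
qed simp

lemma ev_mon: "ev (mon i j) x = x $ 1 ^ i * x $ 2 ^ j"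
  by (simp add: mon_def ev_pw inner_axis)

lemma ev_D_mon:
  "ev (D e1 (mon i j)) x = real i * x $ 1 ^ (i - 1) * x $ 2 ^ j"
  "ev (D e2 (mon i j)) x = real j * x $ 1 ^ i * x $ 2 ^ (j - 1)"
  by (simp_all add: mon_def ev_D_pw ev_pw inner_axis)

text \<open>Asking for orthogonality of v times every monomial makes the class \<open>V\<close>
  stable under multiplication by a coordinate and then, by induction, by any polynomial function.
  The claim is the case v = 1.\<close>

lemma real_polynomial_function_orthogonal:
  fixes p :: "real^2 \<Rightarrow> real"
  assumes u: "u \<in> L2 disc" and orth: "\<And>i j. (LINT x|lebesgue_on disc. u x * ev (mon i j) x) = 0"
    and p: "real_polynomial_function p"
  shows "(LINT x|lebesgue_on disc. u x * p x) = 0"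
proof -
  define V where "V = {v. continuous_on UNIV v \<and> (\<forall>i j. (LINT x|lebesgue_on disc. u x * (v x * ev (mon i j) x)) = 0)}"
  have L2v: "(\<lambda>x. v x * ev (mon i j) x) \<in> L2 disc" if "v \<in> V" for v i j
    using that by (intro continuous_L2 continuous_intros continuous_on_ev) (auto simp: V_def)
  have V_mon: "(\<lambda>x. v x * x $ k) \<in> V" if v: "v \<in> V" for v and k :: 2
  proof -
    have eq: "v x * x $ k * ev (mon i j) x = v x * ev (if k = 1 then mon (Suc i) j else mon i (Suc j)) x" for i j x
      using exhaust_2[of k] by (auto simp: ev_mon)
    have "(LINT x|lebesgue_on disc. u x * (v x * x $ k * ev (mon i j) x)) = 0" for i j
      unfolding eq using v by (cases "k = 1") (simp_all add: V_def)
    then show ?thesis using v by (auto simp: V_def intro!: continuous_intros)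
  qed
  have V_add: "(\<lambda>x. v x + w x) \<in> V" if "v \<in> V" "w \<in> V" for v w
    using that L2_mult_integrable[OF u L2v[OF that(1)]] L2_mult_integrable[OF u L2v[OF that(2)]]
    by (auto simp: V_def distrib_left distrib_right intro!: continuous_intros)
  have V_scale: "(\<lambda>x. v x * c) \<in> V" if "v \<in> V" for v c
  proof -
    have eq: "u x * (v x * c * m) = c * (u x * (v x * m))" for x m by simp
    have "(LINT x|lebesgue_on disc. u x * (v x * c * ev (mon i j) x)) = 0" for i j
      unfolding eq using that by (simp add: V_def)
    then show ?thesis using that by (auto simp: V_def intro!: continuous_intros)
  qed
  have V_mult: "\<forall>v\<in>V. (\<lambda>x. v x * p x) \<in> V"
    using p
  proof (induction rule: real_polynomial_function.induct)
    case (linear h)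
    have h: "h x = x $ 1 * h e1 + x $ 2 * h e2" for x
    proof -
      have "x = x $ 1 *\<^sub>R e1 + x $ 2 *\<^sub>R e2" by (simp add: vec_eq_iff forall_2)
      then show ?thesis using linear_add[OF bounded_linear.linear[OF linear]] linear_scale[OF bounded_linear.linear[OF linear]]
        by (metis real_scaleR_def)
    qed
    have "(\<lambda>x. v x * h x) \<in> V" if "v \<in> V" for v
    proof -
      have "(\<lambda>x. v x * x $ 1 * h e1 + v x * x $ 2 * h e2) \<in> V"
        by (intro V_add V_scale V_mon that)
      moreover have "v x * h x = v x * x $ 1 * h e1 + v x * x $ 2 * h e2" for x
        by (subst h) (simp add: distrib_left mult.assoc)
      ultimately show ?thesis by presburger
    qed
    then show ?case by blast
  next
    case (const c)
    then show ?case using V_scale by blast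
  next
    case (add f g)
    then show ?case using V_add by (auto simp: distrib_left)
  next
    case (mult f g)
    then show ?case by (auto simp flip: mult.assoc)
  qed
  have "(\<lambda>x. 1) \<in> V" using orth by (simp add: V_def)
  from bspec[OF V_mult this] have "(LINT x|lebesgue_on disc. u x * (p x * ev (mon 0 0) x)) = 0" by (simp add: V_def)
  then show ?thesis by (simp add: ev_mon)
qed

text \<open>Weierstrass approximation on the closed disc: the error is at most d times the L1 norm
  \<open>I\<close> of u, and \<open>I + 1\<close> in the denominator of d avoids a division by
  0.\<close>

lemma continuous_orthogonal:
  fixes f :: "real^2 \<Rightarrow> real"
  assumes u: "u \<in> L2 disc" and orth: "\<And>i j. (LINT x|lebesgue_on disc. u x * ev (mon i j) x) = 0"
    and f: "continuous_on UNIV f"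
  shows "(LINT x|lebesgue_on disc. u x * f x) = 0"
proof -
  define I where "I = (LINT x|lebesgue_on disc. \<bar>u x\<bar>)"
  have iu: "integrable (lebesgue_on disc) (\<lambda>x. \<bar>u x\<bar>)" using L2_integrable[OF disc_lmeasurable u] by auto
  have I0: "I \<ge> 0" unfolding I_def by simp
  have "\<bar>LINT x|lebesgue_on disc. u x * f x\<bar> \<le> e" if e: "e > 0" for e
  proof -
    define d where "d = e / (I + 1)"
    have d: "d > 0" using e I0 by (simp add: d_def)
    have fc: "continuous_on (cball 0 1) f" by (rule continuous_on_subset[OF f]) simp
    obtain g where g: "real_polynomial_function g" "\<And>x. x \<in> cball 0 1 \<Longrightarrow> \<bar>f x - g x\<bar> < d"
      using Stone_Weierstrass_real_polynomial_function[OF compact_cball fc d] by blast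
    have gc: "continuous_on UNIV g" using g(1) by (simp add: continuous_on_polymonial_function real_polynomial_function_eq)
    have L: "f \<in> L2 disc" "g \<in> L2 disc" by (auto intro!: continuous_L2 f gc)
    have "(LINT x|lebesgue_on disc. u x * f x) = (LINT x|lebesgue_on disc. u x * f x) - (LINT x|lebesgue_on disc. u x * g x)"
      using real_polynomial_function_orthogonal[OF u orth g(1)] by simp
    also have "\<dots> = (LINT x|lebesgue_on disc. u x * f x - u x * g x)"
      by (intro Bochner_Integration.integral_diff[symmetric] L2_mult_integrable u L)
    finally have "\<bar>LINT x|lebesgue_on disc. u x * f x\<bar> = \<bar>LINT x|lebesgue_on disc. u x * f x - u x * g x\<bar>" by simp
    also have "\<dots> \<le> (LINT x|lebesgue_on disc. \<bar>u x * f x - u x * g x\<bar>)" by (rule integral_abs_bound)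
    also have "\<dots> \<le> (LINT x|lebesgue_on disc. d * \<bar>u x\<bar>)"
    proof (rule integral_mono)
      show "integrable (lebesgue_on disc) (\<lambda>x. \<bar>u x * f x - u x * g x\<bar>)"
        by (intro Bochner_Integration.integrable_abs Bochner_Integration.integrable_diff L2_mult_integrable u L)
      show "integrable (lebesgue_on disc) (\<lambda>x. d * \<bar>u x\<bar>)" using iu by simp
      fix x assume "x \<in> space (lebesgue_on disc)"
      then have "\<bar>f x - g x\<bar> \<le> d" using g(2)[of x] by simp
      then have "\<bar>u x\<bar> * \<bar>f x - g x\<bar> \<le> \<bar>u x\<bar> * d" by (intro mult_left_mono) auto
      then show "\<bar>u x * f x - u x * g x\<bar> \<le> d * \<bar>u x\<bar>"
        unfolding right_diff_distrib[symmetric] abs_mult by (simp add: mult.commute)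
    qed
    also have "\<dots> = d * I" by (simp add: I_def)
    also have "\<dots> \<le> e" using e I0 by (simp add: d_def field_simps)
    finally show ?thesis .
  qed
  then have "\<bar>LINT x|lebesgue_on disc. u x * f x\<bar> \<le> 0" by (rule field_le_epsilon[of _ 0, simplified])
  then show ?thesis by simp
qed

text \<open>Continuous functions decreasing to the indicator carry orthogonality from continuous
  functions over to closed sets.\<close>

lemma closed_indicator_limit:
  fixes T :: "'a::metric_space set"
  assumes T: "closed T" "T \<noteq> {}"
  shows "(\<lambda>n. max 0 (1 - real n * infdist x T)) \<longlonglongrightarrow> indicator T x"
proof (cases "x \<in> T")
  case False
  then have p: "infdist x T > 0" using T infdist_pos_not_in_closed by blast
  obtain N where N: "real N > 1 / infdist x T" using reals_Archimedean2 by blast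
  have "max 0 (1 - real n * infdist x T) = 0" if "n \<ge> N" for n
  proof -
    have "1 / infdist x T < real n" using N that by simp
    then have "1 < real n * infdist x T" using p by (simp add: field_simps)
    then show ?thesis by simp
  qed
  then show ?thesis using False by (intro tendsto_eventually eventually_sequentiallyI[of N]) auto
qed simp

lemma closed_set_orthogonal:
  assumes u: "u \<in> L2 disc" and orth: "\<And>i j. (LINT x|lebesgue_on disc. u x * ev (mon i j) x) = 0"
    and T: "closed T"
  shows "(LINT x|lebesgue_on disc. u x * indicator T x) = 0"
proof (cases "T = {}")
  case False
  define f where "f n x = max 0 (1 - real n * infdist x T)" for n and x :: "real^2"
  have fc: "continuous_on UNIV (f n)" for n unfolding f_def by (intro continuous_intros)
  have iu: "integrable (lebesgue_on disc) u" by (rule L2_integrable[OF disc_lmeasurable u])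
  have Tm: "T \<in> sets borel" using T by (rule borel_closed)
  have "(\<lambda>n. LINT x|lebesgue_on disc. u x * f n x) \<longlonglongrightarrow> (LINT x|lebesgue_on disc. u x * indicator T x)"
  proof (rule integral_dominated_convergence)
    have "(indicator T :: real^2 \<Rightarrow> real) \<in> borel_measurable lebesgue"
      using Tm by (intro measurable_completion) auto
    then show "(\<lambda>x. u x * indicator T x) \<in> borel_measurable (lebesgue_on disc)"
      by (intro borel_measurable_times borel_measurable_integrable[OF iu] measurable_restrict_space1)
    show "(\<lambda>x. u x * f n x) \<in> borel_measurable (lebesgue_on disc)" for n
    proof -
      have "f n \<in> L2 disc" by (intro continuous_L2 fc) auto
      then show ?thesis using u by (intro borel_measurable_times) (auto simp: L2_def)
    qed
    show "integrable (lebesgue_on disc) (\<lambda>x. \<bar>u x\<bar>)" using iu by auto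
    show "AE x in lebesgue_on disc. (\<lambda>n. u x * f n x) \<longlonglongrightarrow> u x * indicator T x"
      unfolding f_def by (intro AE_I2 tendsto_intros closed_indicator_limit T False)
    show "AE x in lebesgue_on disc. norm (u x * f n x) \<le> \<bar>u x\<bar>" for n
    proof (rule AE_I2)
      fix x
      have "0 \<le> f n x" "f n x \<le> 1" by (auto simp: f_def infdist_nonneg)
      then show "norm (u x * f n x) \<le> \<bar>u x\<bar>" by (simp add: abs_mult mult_left_le)
    qed
  qed
  then show ?thesis by (simp add: continuous_orthogonal[OF u orth fc] LIMSEQ_const_iff)
qed simp

text \<open>Inner regularity: a closed subset of {u > 0} is null because u integrates to 0 over it,
  and closed subsets exhaust that set up to arbitrarily small measure.\<close>

lemma nonpos_of_orthogonal:
  assumes u: "u \<in> L2 disc" and orth: "\<And>i j. (LINT x|lebesgue_on disc. u x * ev (mon i j) x) = 0"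
  shows "AE x in lebesgue_on disc. u x \<le> 0"
proof -
  define A where "A = {x\<in>disc. 0 < u x}"
  have um: "u \<in> borel_measurable (lebesgue_on disc)" using u by (simp add: L2_def)
  have dl: "disc \<in> sets lebesgue" by simp
  have "A \<in> sets (lebesgue_on disc)"
    using borel_measurable_less[OF borel_measurable_const um, of 0] by (simp add: A_def)
  then have A: "A \<in> sets lebesgue" using dl by (simp add: sets_restrict_space_iff)
  have T0: "emeasure lebesgue T = 0" if T: "closed T" "T \<subseteq> A" for T
  proof -
    have Tl: "T \<in> sets lebesgue" using T(1) by (intro sets_completionI_sets) (simp add: borel_closed)
    have nn: "0 \<le> u x * indicator T x" for x using T(2) by (auto simp: A_def indicator_def intro: less_imp_le)
    have "integrable (lebesgue_on disc) (\<lambda>x. u x * indicator T x)"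
    proof (rule Bochner_Integration.integrable_bound)
      show "integrable (lebesgue_on disc) u" by (rule L2_integrable[OF disc_lmeasurable u])
      show "(\<lambda>x. u x * indicator T x) \<in> borel_measurable (lebesgue_on disc)"
        using Tl by (intro borel_measurable_times um measurable_restrict_space1 borel_measurable_indicator)
    qed (auto simp: indicator_def)
    then have "AE x in lebesgue_on disc. u x * indicator T x = 0"
      using closed_set_orthogonal[OF u orth T(1)] integral_nonneg_eq_0_iff_AE[of "lebesgue_on disc" "\<lambda>x. u x * indicator T x"] nn
      by auto
    then have "AE x in lebesgue. x \<in> disc \<longrightarrow> u x * indicator T x = 0"
      using dl by (simp add: AE_restrict_space_iff)
    then have "AE x in lebesgue. x \<notin> T"
      by eventually_elim (use T(2) in \<open>auto simp: A_def indicator_def\<close>)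
    then show ?thesis using Tl by (subst (asm) AE_iff_measurable[of T]) auto
  qed
  have "emeasure lebesgue A \<le> ennreal e" if e: "e > 0" for e
  proof -
    obtain T where T: "closed T" "T \<subseteq> A" "A - T \<in> lmeasurable" "emeasure lebesgue (A - T) < ennreal e"
      using sets_lebesgue_inner_closed[OF A e] .
    have Tl: "T \<in> sets lebesgue" using T(1) by (intro sets_completionI_sets) (simp add: borel_closed)
    have "emeasure lebesgue A \<le> emeasure lebesgue (A - T) + emeasure lebesgue T"
    proof -
      have "A = (A - T) \<union> T" using T(2) by auto
      then show ?thesis using emeasure_subadditive[of "A - T" lebesgue T] A Tl by (metis sets.Diff)
    qed
    then show ?thesis using T T0[OF T(1,2)] by simp
  qed
  then have "emeasure lebesgue A = 0" by (metis ennreal_le_epsilon add_0 le_zero_eq ennreal_zero_neq_top)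
  then have "AE x in lebesgue. x \<notin> A" using A by (intro AE_not_in) auto
  then have "AE x in lebesgue. x \<in> disc \<longrightarrow> u x \<le> 0"
    by eventually_elim (auto simp: A_def)
  then show ?thesis using dl by (simp add: AE_restrict_space_iff)
qed

theorem monomials_total:
  assumes "\<And>i j. a \<bullet> abs_l2 (ev (mon i j)) = 0"
  shows "a = 0"
proof -
  define u where "u = rep_l2 a"
  have u: "u \<in> L2 disc" "a = abs_l2 u" by (simp_all add: u_def rep_l2_L2 abs_rep_l2)
  have orth: "(LINT x|lebesgue_on disc. u x * ev (mon i j) x) = 0" for i j
    using assms[of i j] unfolding u(2) by (simp add: abs_l2_simps(3) u(1) ev_L2_disc)
  have m: "(\<lambda>x. - u x) \<in> L2 disc" using L2_scale[OF u(1), of "-1"] by simp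
  have "AE x in lebesgue_on disc. u x \<le> 0" by (rule nonpos_of_orthogonal[OF u(1) orth])
  moreover have "AE x in lebesgue_on disc. - u x \<le> 0"
    by (rule nonpos_of_orthogonal[OF m]) (simp add: orth)
  ultimately have "AE x in lebesgue_on disc. u x = 0" by eventually_elim simp
  then show ?thesis using u by (simp add: abs_l2_eq_0_iff)
qed

section \<open>Triangularity of the tangential energy on monomials\<close>

abbreviation cls :: "(real^2) smooth \<Rightarrow> l2" where "cls p \<equiv> abs_l2 (ev p)"

lemma cls_eqI: "(\<And>x. ev p x = ev q x) \<Longrightarrow> cls p = cls q"
  by (metis ext)

lemma cls_Add: "cls (Add p q) = cls p + cls q"
proof -
  have "ev (Add p q) = (\<lambda>x. ev p x + ev q x)" by (simp add: fun_eq_iff)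
  then show ?thesis by (simp add: abs_l2_simps ev_L2_disc)
qed

lemma cls_scale: "cls (Mul (Const c) p) = c *\<^sub>R cls p"
proof -
  have "ev (Mul (Const c) p) = (\<lambda>x. c * ev p x)" by (simp add: fun_eq_iff)
  then show ?thesis by (simp add: abs_l2_scaleR ev_L2_disc)
qed

text \<open>Minus the Laplacian of the monomial. Truncated subtraction is harmless: where an
  exponent would be negative, the coefficient is 0.\<close>

definition lower :: "nat \<Rightarrow> nat \<Rightarrow> l2" where
  "lower i j = (- real (i * (i - 1))) *\<^sub>R cls (mon (i - 2) j) + (- real (j * (j - 1))) *\<^sub>R cls (mon i (j - 2))"

text \<open>The Euler operator E = x . grad multiplies the monomial p by n = i + j, so div (x E p) =
  2 E p + E (E p) = n(n+2) p; the identity matrix contributes the Laplacian. The case split on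
  exponents resolves the truncated subtractions.\<close>

lemma flux_divergence_mon:
  fixes i j :: nat
  defines "A \<equiv> Mul (Const (real i)) (mon (i - 1) j)" and "B \<equiv> Mul (Const (real j)) (mon i (j - 1))"
  shows "ev (Add (D e1 (Add (Mul XX A) (Mul XY B))) (D e2 (Add (Mul XY A) (Mul YY B)))) x =
    - (real ((i + j) * (i + j + 2)) * ev (mon i j) x + (- real (i * (i - 1)) * ev (mon (i - 2) j) x
      + - real (j * (j - 1)) * ev (mon i (j - 2)) x))"
proof -
  have c: "k = 0 \<or> k = 1 \<or> (\<exists>l. k = Suc (Suc l))" for k :: nat
    by (metis One_nat_def not0_implies_Suc)
  show ?thesis
    using c[of i] c[of j] unfolding A_def B_def
    by (elim disjE exE) (simp_all add: ev_mon ev_D_mon inner_axis algebra_simps power2_eq_square)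
qed

lemma Q_mon:
  assumes "U \<in> H1"
  shows "Q (snd U) (snd (H1_of (mon i j))) =
    fst U \<bullet> (real ((i + j) * (i + j + 2)) *\<^sub>R cls (mon i j) + lower i j)"
proof -
  let ?A = "Mul (Const (real i)) (mon (i - 1) j)" and ?B = "Mul (Const (real j)) (mon i (j - 1))"
  let ?E = "Add (Mul (Const (real ((i + j) * (i + j + 2)))) (mon i j))
    (Add (Mul (Const (- real (i * (i - 1)))) (mon (i - 2) j)) (Mul (Const (- real (j * (j - 1)))) (mon i (j - 2))))"
  have A: "cls ?A = cls (D e1 (mon i j))" and B: "cls ?B = cls (D e2 (mon i j))"
    by (rule cls_eqI, simp add: ev_mon ev_D_mon)+
  have "Q (snd U) (snd (H1_of (mon i j))) = - (fst U \<bullet> cls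
    (Add (D e1 (Add (Mul XX ?A) (Mul XY ?B))) (D e2 (Add (Mul XY ?A) (Mul YY ?B)))))"
    by (rule Q_H1_of[OF assms A B])
  also have "cls (Add (D e1 (Add (Mul XX ?A) (Mul XY ?B))) (D e2 (Add (Mul XY ?A) (Mul YY ?B)))) = cls (Mul (Const (-1)) ?E)"
    by (rule cls_eqI, subst flux_divergence_mon) simp
  also have "\<dots> = - (real ((i + j) * (i + j + 2)) *\<^sub>R cls (mon i j) + lower i j)"
    unfolding cls_scale[of "-1"] by (simp only: cls_Add cls_scale lower_def) simp
  finally show ?thesis by (simp only: inner_minus_right minus_minus)
qed

text \<open>Cantor's pairing runs through the exponents along antidiagonals, hence by increasing
  degree, so the terms of \<open>lower\<close> with nonzero coefficient belong to smaller
  indices.\<close>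

definition deg :: "nat \<Rightarrow> nat" where "deg k = (case prod_decode k of (i, j) \<Rightarrow> i + j)"
definition monomial :: "nat \<Rightarrow> (real^2) smooth" where "monomial k = (case prod_decode k of (i, j) \<Rightarrow> mon i j)"

lemma monomial_encode: "monomial (prod_encode (i, j)) = mon i j"
  by (simp add: monomial_def)

lemma triangle_mono: "m \<le> n \<Longrightarrow> triangle m \<le> triangle n"
  by (induction n rule: nat_induct) (auto simp: le_Suc_eq)

lemma prod_encode_less: "m + n < i + j \<Longrightarrow> m \<le> i \<Longrightarrow> prod_encode (m, n) < prod_encode (i, j)"
proof -
  assume a: "m + n < i + j" "m \<le> i"
  have "triangle (m + n) + Suc (m + n) \<le> triangle (i + j)"
    using triangle_mono[of "Suc (m + n)" "i + j"] a(1) by simp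
  then show ?thesis using a(2) by (simp add: prod_encode_def)
qed

text \<open>Serves twice: the diagonal entries tend to infinity, and only index 0 has entry
  0.\<close>

lemma k_le_eigenvalue: "real k \<le> real (deg k * (deg k + 2))"
proof -
  obtain i j where ij: "prod_decode k = (i, j)" by fastforce
  have "k = triangle (i + j) + i"
    using prod_decode_inverse[of k] by (simp add: ij prod_encode_def)
  moreover have "triangle n \<le> n * (n + 1)" for n by (induction n) auto
  ultimately have "k \<le> (i + j) * (i + j + 1) + (i + j)" by (simp add: add_mono trans_le_add1)
  also have "\<dots> = deg k * (deg k + 2)" by (simp add: deg_def ij)
  finally show ?thesis by linarith
qed

global_interpretation disc_energy: triangular_energy H1 Q "\<lambda>k. H1_of (monomial k)"
  "\<lambda>k. real (deg k * (deg k + 2))" "\<lambda>k. case prod_decode k of (i, j) \<Rightarrow> lower i j"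
proof (rule triangular_energy.intro)
  show "subspace H1" by (rule subspace_H1)
  show "Q g h = Q h g" "0 \<le> Q g g" "Q g g \<le> (norm g)\<^sup>2" for g h by (rule Q_sym Q_bounds)+
  show "H1_of (monomial k) \<in> H1" for k by (rule H1_of_in)
  show "Q (snd U) (snd (H1_of (monomial k))) = fst U \<bullet> (real (deg k * (deg k + 2)) *\<^sub>R fst (H1_of (monomial k))
      + (case prod_decode k of (i, j) \<Rightarrow> lower i j))" if "U \<in> H1" for U k
  proof -
    obtain i j where ij: "prod_decode k = (i, j)" by fastforce
    have "fst (H1_of (mon i j)) = cls (mon i j)" by (simp add: H1_of_def)
    then show ?thesis using Q_mon[OF that, of i j] by (simp only: monomial_def deg_def ij case_prod_conv)
  qed
  show "(case prod_decode k of (i, j) \<Rightarrow> lower i j) \<in> span ((\<lambda>m. fst (H1_of (monomial m))) ` {..<k})" for k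
  proof -
    obtain i j where ij: "prod_decode k = (i, j)" by fastforce
    then have k: "k = prod_encode (i, j)" by (metis prod_decode_inverse)
    have cls_in: "cls (mon m n) \<in> (\<lambda>m. fst (H1_of (monomial m))) ` {..<k}" if "m + n < i + j" "m \<le> i" for m n
      using prod_encode_less[OF that] monomial_encode[of m n]
      by (intro image_eqI[of _ _ "prod_encode (m, n)"]) (auto simp: H1_of_def k)
    have "(- real (i * (i - 1))) *\<^sub>R cls (mon (i - 2) j) \<in> span ((\<lambda>m. fst (H1_of (monomial m))) ` {..<k})"
    proof (cases "i \<le> 1")
      case True
      then have "i * (i - 1) = 0" by auto
      then show ?thesis by (simp only: span_zero of_nat_0 scaleR_zero_left minus_zero)
    next
      case False
      then show ?thesis by (intro span_scale span_base cls_in) auto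
    qed
    moreover have "(- real (j * (j - 1))) *\<^sub>R cls (mon i (j - 2)) \<in> span ((\<lambda>m. fst (H1_of (monomial m))) ` {..<k})"
    proof (cases "j \<le> 1")
      case True
      then have "j * (j - 1) = 0" by auto
      then show ?thesis by (simp only: span_zero of_nat_0 scaleR_zero_left minus_zero)
    next
      case False
      then show ?thesis by (intro span_scale span_base cls_in) auto
    qed
    ultimately show ?thesis unfolding ij case_prod_conv lower_def by (rule span_add)
  qed
  show "filterlim (\<lambda>k. real (deg k * (deg k + 2))) at_top sequentially"
    by (rule filterlim_at_top_mono[OF filterlim_real_sequentially]) (intro always_eventually allI k_le_eigenvalue)
  show "x = 0" if "\<And>k. x \<bullet> fst (H1_of (monomial k)) = 0" for x
  proof (rule monomials_total)
    show "x \<bullet> cls (mon i j) = 0" for i j using that[of "prod_encode (i, j)"] by (simp add: monomial_encode H1_of_def)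
  qed
qed (rule bounded_bilinear_Q)

text \<open>Every diagonal entry except that of the constant monomial is nonzero; this takes the
  place of a connectedness argument.\<close>

lemma H1_zero_gradient:
  assumes "U \<in> H1" "snd U = 0"
  shows "fst U \<in> span {cls (mon 0 0)}"
proof -
  have "real (deg k * (deg k + 2)) \<noteq> 0" if "k > 0" for k
    using k_le_eigenvalue[of k] that by linarith
  from disc_energy.zero_energy[OF assms this] show ?thesis
    using monomial_encode[of 0 0] by (simp add: H1_of_def prod_encode_def)
qed

text \<open>On the unit disc, pulled back from an ellipse, the Dirichlet form has a factor \<open>\<kappa>\<close>
  (the squared ratio of the axes) in front of the second partial derivatives.\<close>

definition form :: "real \<Rightarrow> l2 \<times> l2 \<Rightarrow> l2 \<times> l2 \<Rightarrow> real" where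
  "form \<kappa> g h = fst g \<bullet> fst h + \<kappa> * (snd g \<bullet> snd h)"

text \<open>A vanishing combination would make x1 a root of a nonzero polynomial for almost every x
  in the disc, so the disc would lie in finitely many lines up to a null set. Independence of these
  powers yields \<open>infinite_dim\<close>.\<close>

lemma powers_independent:
  assumes "finite I" "\<exists>i\<in>I. c i \<noteq> 0"
  shows "(\<Sum>i\<in>I. c i *\<^sub>R cls (mon i 0)) \<noteq> 0"
proof
  assume z: "(\<Sum>i\<in>I. c i *\<^sub>R cls (mon i 0)) = 0"
  define p where "p = (\<Sum>i\<in>I. monom (c i) i)"
  have "p \<noteq> 0"
  proof -
    obtain i where i: "i \<in> I" "c i \<noteq> 0" using assms(2) by blast
    have "coeff p i = c i" using assms(1) i by (simp add: p_def coeff_sum)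
    then show ?thesis using i by auto
  qed
  have px: "poly p (x $ 1) = (\<Sum>i\<in>I. c i * ev (mon i 0) x)" for x :: "real^2"
    by (simp add: p_def poly_sum poly_monom ev_mon)
  have "abs_l2 (\<lambda>x. \<Sum>i\<in>I. c i * ev (mon i 0) x) = 0"
    using z by (subst abs_l2_sum[symmetric]) (simp_all add: ev_L2_disc)
  then have "AE x in lebesgue_on disc. (\<Sum>i\<in>I. c i * ev (mon i 0) x) = 0"
    by (subst (asm) abs_l2_eq_0_iff) (auto intro!: L2_sum L2_scale ev_L2_disc)
  then have "AE x in lebesgue. x \<in> disc \<longrightarrow> poly p (x $ 1) = 0"
    by (simp add: AE_restrict_space_iff px)
  moreover have "negligible (\<Union>r\<in>{r. poly p r = 0}. {x :: real^2. x $ 1 = r})"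
    using poly_roots_finite[OF \<open>p \<noteq> 0\<close>] negligible_standard_hyperplane[of e1]
    by (intro negligible_Union) (auto simp: Basis_vec2 inner_axis)
  then have "AE x in lebesgue. x \<notin> (\<Union>r\<in>{r. poly p r = 0}. {x :: real^2. x $ 1 = r})"
    unfolding negligible_iff_null_sets by (rule AE_not_in)
  ultimately have "AE x in lebesgue. x \<notin> disc" by eventually_elim auto
  then have "negligible disc" by (subst (asm) AE_iff_null_sets[symmetric]) (auto simp: negligible_iff_null_sets)
  then show False using open_not_negligible[of disc] by simp
qed

lemma energy_form_disc:
  assumes \<kappa>: "\<kappa> > 0"
  shows "energy_form H1 (form \<kappa>)"
proof (rule energy_form.intro)
  show "subspace H1" by (rule subspace_H1)
  show "closed H1" by (rule closed_H1)
  have "bounded_linear (\<lambda>h :: l2 \<times> l2. (fst h, \<kappa> *\<^sub>R snd h))"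
    by (intro bounded_linear_Pair bounded_linear_fst bounded_linear_const_scaleR bounded_linear_snd
        bounded_linear_compose[OF bounded_linear_scaleR_right])
  from bounded_bilinear.comp[OF bounded_bilinear_inner bounded_linear_ident this]
  show "bounded_bilinear (form \<kappa>)" by (simp add: form_def[abs_def] inner_prod_def)
  show "form \<kappa> g h = form \<kappa> h g" for g h by (simp add: form_def inner_commute)
  show "\<exists>c>0. \<forall>g. c * (norm g)\<^sup>2 \<le> form \<kappa> g g"
  proof (intro exI[of _ "min 1 \<kappa>"] conjI allI)
    fix g :: "l2 \<times> l2"
    have "(norm g)\<^sup>2 = fst g \<bullet> fst g + snd g \<bullet> snd g"
      by (simp add: power2_norm_eq_inner inner_prod_def)
    then show "min 1 \<kappa> * (norm g)\<^sup>2 \<le> form \<kappa> g g"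
      using mult_right_mono[of "min 1 \<kappa>" 1 "fst g \<bullet> fst g"] mult_right_mono[of "min 1 \<kappa>" \<kappa> "snd g \<bullet> snd g"]
      by (simp add: form_def distrib_left)
  qed (use \<kappa> in simp)
  show "\<exists>r. strict_mono (r :: nat \<Rightarrow> nat) \<and> convergent (\<lambda>n. fst (x (r n)))"
    if "range x \<subseteq> H1" "bounded (range x)" for x
    using disc_energy.compact_embedding[OF that] .
  show "\<exists>v\<in>H1. fst v \<noteq> 0 \<and> (\<forall>i<n. fst v \<bullet> b i = 0)" for n :: nat and b
  proof -
    \<comment> \<open>n + 1 powers of x1 against n orthogonality conditions.\<close>
    obtain c where c: "\<exists>i\<in>{..n}. c i \<noteq> 0" "\<forall>k\<in>{..<n}. (\<Sum>i\<in>{..n}. c i * (cls (mon i 0) \<bullet> b k)) = 0"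
      using homogeneous_system_solvable[of "{..<n}" "{..n}" "\<lambda>i k. cls (mon i 0) \<bullet> b k"] by auto
    define v where "v = (\<Sum>i\<in>{..n}. c i *\<^sub>R H1_of (mon i 0))"
    have fv: "fst v = (\<Sum>i\<in>{..n}. c i *\<^sub>R cls (mon i 0))" by (simp add: v_def fst_sum H1_of_def)
    have "v \<in> H1" unfolding v_def by (intro subspace_sum subspace_scale subspace_H1 H1_of_in)
    moreover have "fst v \<noteq> 0" unfolding fv by (intro powers_independent c) simp
    moreover have "fst v \<bullet> b k = 0" if "k < n" for k using c(2) that by (simp add: fv inner_sum_left)
    ultimately show ?thesis by blast
  qed
qed

section \<open>Strict monotonicity in the ratio of the axes\<close>

lemma eigenpair_disc:
  assumes "\<kappa> > 0"
  shows "energy_form.eigenpair H1 (form \<kappa>) \<mu> x \<longleftrightarrow>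
    x \<in> H1 \<and> (\<forall>v\<in>H1. form \<kappa> (snd x) (snd v) = \<mu> * (fst x \<bullet> fst v))"
  by (rule energy_form.eigenpair_def[OF energy_form_disc[OF assms]])

text \<open>Formally d2 g1 = d2 d1 u = d1 d2 u = 0. Commuting derivatives of test functions gives
  this for compact supports; since the field (0, defect * W) vanishes on the circle, the cutoff
  argument extends it up to the boundary.\<close>

lemma first_derivative_independent:
  assumes x: "x \<in> H1" "snd (snd x) = 0"
  shows "fst (snd x) \<bullet> cls (D e2 (Mul defect W)) = 0"
proof -
  define g where "g = rep_l2 (fst (snd x))"
  have g: "g \<in> L2 disc" "fst (snd x) = abs_l2 g" by (simp_all add: g_def rep_l2_L2 abs_rep_l2)
  have H1D: "fst x \<bullet> cls (D e1 q) = - (fst (snd x) \<bullet> cls q)" "fst x \<bullet> cls (D e2 q) = 0"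
    if "test_function disc (ev q)" for q
    using x that unfolding H1_def by (auto simp: frechet_derivative_ev)
  have indep: "fst (snd x) \<bullet> cls (D e2 q) = 0" if q: "test_function disc (ev q)" for q
  proof -
    have "fst (snd x) \<bullet> cls (D e2 q) = - (fst x \<bullet> cls (D e1 (D e2 q)))"
      using H1D(1)[OF test_function_D[OF q]] by simp
    also have "cls (D e1 (D e2 q)) = cls (D e2 (D e1 q))" by (rule cls_eqI) (rule D_commute)
    also have "fst x \<bullet> cls (D e2 (D e1 q)) = 0" by (rule H1D(2)[OF test_function_D[OF q]])
    finally show ?thesis by simp
  qed
  let ?F = "Mul defect W"
  have "(LINT y|lebesgue_on disc. g y * (ev (D e1 (Const 0)) y + ev (D e2 ?F) y)) = (LINT y|lebesgue_on disc. 0)"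
  proof (rule tangential_divergence)
    show "integrable (lebesgue_on disc) g" by (rule L2_integrable[OF disc_lmeasurable g(1)])
    show "y $ 1 * ev (Const 0) y + y $ 2 * ev ?F y = ev defect y * ev (Mul Y W) y" for y
      by (simp add: inner_axis)
    fix n
    have "(LINT y|lebesgue_on disc. g y * (ev (D e1 (Mul (cutoff n) (Const 0))) y + ev (D e2 (Mul (cutoff n) ?F)) y))
      = fst (snd x) \<bullet> cls (D e2 (Mul (cutoff n) ?F))"
      unfolding g(2) abs_l2_simps(3)[OF g(1) ev_L2_disc] by simp
    also have "\<dots> = 0" by (intro indep cutoff_test_function)
    finally show "(LINT y|lebesgue_on disc. g y * (ev (D e1 (Mul (cutoff n) (Const 0))) y + ev (D e2 (Mul (cutoff n) ?F)) y))
      = (LINT y|lebesgue_on disc. 0 * ev (cutoff n) y)" by simp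
  qed simp
  then show ?thesis unfolding g(2) abs_l2_simps(3)[OF g(1) ev_L2_disc] by simp
qed

text \<open>Testing the eigenvalue equation with \<open>v = \<partial>\<^sub>2 (defect * W)\<close> kills its right-hand side, and the
  left-hand side becomes \<open>- 2 \<integral> g1 x1 \<partial>\<^sub>2 W\<close>; the \<open>\<partial>\<^sub>2 W\<close> exhaust the polynomials.\<close>

lemma eigenpair_one_variable:
  assumes \<kappa>: "\<kappa> > 0" and eig: "energy_form.eigenpair H1 (form \<kappa>) \<mu> x" and g2: "snd (snd x) = 0"
  shows "snd x = 0"
proof -
  define g1 where "g1 = fst (snd x)"
  have x: "x \<in> H1" and eq: "\<And>v. v \<in> H1 \<Longrightarrow> g1 \<bullet> fst (snd v) = \<mu> * (fst x \<bullet> fst v)"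
    using eig g2 by (auto simp: eigenpair_disc[OF \<kappa>] form_def g1_def)
  have key: "g1 \<bullet> cls (Mul X (D e2 W)) = 0" for W
  proof -
    let ?p = "Mul defect W"
    have "cls (Const 0) = 0"
      using abs_l2_zero by (metis ev.simps(1) ext)
    \<comment> \<open>Green's formula for the field (0, defect * W): as d2 u = 0, the test function
      d2 (defect * W) is orthogonal to \<open>fst x\<close>.\<close>
    then have "fst x \<bullet> cls (Add (D e1 (Const 0)) (D e2 ?p)) = 0"
      using H1_green[OF x, of "Const 0" ?p "Mul Y W"] g2 by (simp add: inner_axis)
    moreover have "cls (Add (D e1 (Const 0)) (D e2 ?p)) = cls (D e2 ?p)" by (rule cls_eqI) simp
    ultimately have "g1 \<bullet> cls (D e1 (D e2 ?p)) = 0"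
      using eq[OF H1_of_in[of "D e2 ?p"]] by (simp only: H1_of_def fst_conv snd_conv mult_zero_right)
    \<comment> \<open>Derivatives commute and d2 d1 of the defect is 0, which leaves -2 x1 d2 W plus
      a term annihilated by \<open>first_derivative_independent\<close>.\<close>
    moreover have "cls (D e1 (D e2 ?p)) = cls (Add (Mul (Const (-2)) (Mul X (D e2 W))) (D e2 (Mul defect (D e1 W))))"
    proof (rule cls_eqI)
      fix y
      have "ev (D e1 (D e2 ?p)) y = ev (D e2 (Mul (D e1 defect) W)) y + ev (D e2 (Mul defect (D e1 W))) y"
        unfolding D_commute[of e1 e2] by simp
      moreover have "ev (D e2 (D e1 defect)) y = 0" by (simp add: defect_def inner_axis)
      then have "ev (D e2 (Mul (D e1 defect) W)) y = - 2 * y $ 1 * ev (D e2 W) y"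
        by (simp add: ev_D_defect)
      ultimately show "ev (D e1 (D e2 ?p)) y =
        ev (Add (Mul (Const (-2)) (Mul X (D e2 W))) (D e2 (Mul defect (D e1 W)))) y"
        by (simp add: inner_axis)
    qed
    ultimately show ?thesis
      using first_derivative_independent[OF x g2, of "D e1 W"]
      by (simp only: cls_Add cls_scale g1_def inner_add_right inner_scaleR_right)
  qed
  have "mult_ev X g1 \<bullet> cls (mon i j) = 0" for i j
  proof -
    \<comment> \<open>Every monomial is d2 of another one up to the factor 1/(j+1).\<close>
    have "real (Suc j) *\<^sub>R cls (Mul X (mon i j)) = cls (Mul X (D e2 (mon i (Suc j))))"
      unfolding cls_scale[symmetric] by (rule cls_eqI) (simp add: ev_D_mon ev_mon)
    then have "g1 \<bullet> (real (Suc j) *\<^sub>R cls (Mul X (mon i j))) = 0" using key by simp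
    then have "g1 \<bullet> cls (Mul X (mon i j)) = 0" by simp
    moreover have "cls (Mul X (mon i j)) = mult_ev X (cls (mon i j))"
    proof -
      have "ev (Mul X (mon i j)) = (\<lambda>y. ev X y * ev (mon i j) y)" by (simp add: fun_eq_iff)
      then show ?thesis by (simp only: mult_ev_abs[OF ev_L2_disc])
    qed
    ultimately show ?thesis by (simp add: mult_ev_inner)
  qed
  then have z: "mult_ev X g1 = 0" by (rule monomials_total)
  define g where "g = rep_l2 g1"
  have g: "g \<in> L2 disc" "g1 = abs_l2 g" by (simp_all add: g_def rep_l2_L2 abs_rep_l2)
  have "AE y in lebesgue_on disc. ev X y * g y = 0"
    using z unfolding g(2) mult_ev_abs[OF g(1)] by (simp only: abs_l2_eq_0_iff[OF L2_mult_ev[OF g(1)]])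
  then have "AE y in lebesgue. y \<in> disc \<longrightarrow> y $ 1 * g y = 0"
    by (simp add: AE_restrict_space_iff inner_axis)
  \<comment> \<open>The weight x1 vanishes only on a null line, so it can be divided out.\<close>
  moreover have "AE y in lebesgue. y \<notin> {y :: real^2. y \<bullet> e1 = 0}"
    using negligible_standard_hyperplane[of e1 0]
    unfolding negligible_iff_null_sets Basis_vec2 by (intro AE_not_in) simp
  ultimately have "AE y in lebesgue. y \<in> disc \<longrightarrow> g y = 0"
    by eventually_elim (auto simp: inner_axis)
  then have "g1 = 0" using g by (simp add: abs_l2_eq_0_iff AE_restrict_space_iff)
  then show ?thesis using g2 by (simp add: g1_def prod_eq_iff)
qed

text \<open>Equality yields a unit eigenvector with zero gradient, so the common eigenvalue is 0. By
  monotonicity \<open>m 0 \<le> 0\<close> too, and since j is at least 1, \<open>e 0\<close> and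
  \<open>e j\<close> would be two orthonormal vectors in the line of constants.\<close>

theorem disc_eigenvalue_strict_mono:
  assumes \<kappa>: "\<kappa> > 1" and j: "j \<ge> 1"
    and e: "energy_form.spectral_basis H1 (form 1) e m"
    and f: "energy_form.spectral_basis H1 (form \<kappa>) f n"
  shows "m j < n j"
proof (rule ccontr)
  assume "\<not> m j < n j"
  have \<kappa>0: "\<kappa> > 0" using \<kappa> by simp
  interpret a: energy_form H1 "form 1" by (rule energy_form_disc) simp
  interpret b: energy_form H1 "form \<kappa>" by (rule energy_form_disc[OF \<kappa>0])
  have le: "form 1 g g \<le> form \<kappa> g g" for g
    using \<kappa> mult_right_mono[of 1 \<kappa> "snd g \<bullet> snd g"] by (simp add: form_def)
  note cmp = eigenvalue_comparison[OF a.energy_form_axioms b.energy_form_axioms le e f, of j]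
  have mn: "m j = n j" using cmp(1) \<open>\<not> m j < n j\<close> by simp
  then obtain x where x: "b.eigenpair (n j) x" "norm (fst x) = 1" "form 1 (snd x) (snd x) = form \<kappa> (snd x) (snd x)"
    using cmp(2) by blast
  have "(\<kappa> - 1) * (snd (snd x) \<bullet> snd (snd x)) = 0" using x(3) by (simp add: form_def left_diff_distrib)
  then have "snd (snd x) = 0" using \<kappa> by simp
  then have sx: "snd x = 0" by (rule eigenpair_one_variable[OF \<kappa>0 x(1)])
  have "n j * (fst x \<bullet> fst x) = form \<kappa> (snd x) (snd x)"
    using x(1) by (simp add: eigenpair_disc[OF \<kappa>0])
  then have mj: "m j = 0" using sx x(2) mn by (auto simp: form_def)
  note E = a.spectral_basisD[OF e]
  have diag: "form 1 (snd (e i)) (snd (e i)) = m i" for i using E(7)[OF E(3), of i i] E(2)[of i i] by simp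
  have const: "fst (e i) \<in> span {cls (mon 0 0)}" if "m i \<le> 0" for i
  proof (rule H1_zero_gradient[OF E(3)])
    have "snd (e i) \<bullet> snd (e i) \<le> 0" using diag[of i] that by (simp add: form_def inner_prod_def)
    then show "snd (e i) = 0" by (metis inner_eq_zero_iff inner_ge_zero order_antisym)
  qed
  have "m 0 \<le> 0" using monoD[OF E(4), of 0 j] mj by simp
  then obtain s t where st: "fst (e 0) = s *\<^sub>R cls (mon 0 0)" "fst (e j) = t *\<^sub>R cls (mon 0 0)"
    using const[of 0] const[of j] mj by (auto simp: span_singleton)
  have "s * t * (cls (mon 0 0) \<bullet> cls (mon 0 0)) = 0" using E(2)[of 0 j] j unfolding st by auto
  moreover have "s * s * (cls (mon 0 0) \<bullet> cls (mon 0 0)) = 1" using E(2)[of 0 0] unfolding st by simp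
  moreover have "t * t * (cls (mon 0 0) \<bullet> cls (mon 0 0)) = 1" using E(2)[of j j] unfolding st by simp
  ultimately show False by auto
qed

section \<open>Affine changes of variables\<close>

lemma integrable_lebesgue_on_iff:
  fixes f :: "'a::euclidean_space \<Rightarrow> real"
  shows "S \<in> sets lebesgue \<Longrightarrow> integrable (lebesgue_on S) f \<longleftrightarrow> f absolutely_integrable_on S"
  by (simp add: integrable_restrict_space set_integrable_def)

text \<open>The inverse is carried along explicitly, so that every result also applies to it through
  \<open>inverse_affine\<close>. The sort of the index type is that of the change-of-variables
  theorem.\<close>

locale affine_bijection =
  fixes c :: "real^'n::{finite,wellorder}" and L :: "real^'n::_ \<Rightarrow> real^'n::_"
    and T T' :: "real^'n::_ \<Rightarrow> real^'n::_" and c' and L'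
  assumes linear: "linear L" and T_def: "T x = c + L x"
    and linear': "linear L'" and T'_def: "T' x = c' + L' x"
    and inverse: "T' (T x) = x" "T (T' x) = x"
begin

lemma inverse_affine: "affine_bijection c' L' T' T c L"
  by (rule affine_bijection.intro) (rule linear linear' T_def T'_def inverse)+

lemma inj_T: "inj T"
  by (metis injI inverse(1))

lemma T_has_derivative: "(T has_derivative L) (at x within S)"
proof -
  have "((\<lambda>x. c + L x) has_derivative (\<lambda>h. 0 + L h)) (at x within S)"
    by (intro has_derivative_add has_derivative_const linear_imp_has_derivative linear)
  then show ?thesis by (simp add: T_def[abs_def])
qed

definition jacobian :: real where "jacobian = \<bar>det (matrix L)\<bar>"

lemma jacobian_pos: "jacobian > 0"
proof -
  have "inj L"
  proof (rule injI)
    fix x y assume "L x = L y"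
    then have "T x = T y" by (simp add: T_def)
    then show "x = y" using inj_T by (simp add: inj_eq)
  qed
  then have "det (matrix L) \<noteq> 0" using det_nz_iff_inj[OF linear] by simp
  then show ?thesis by (simp add: jacobian_def)
qed

lemma change_of_variables:
  fixes \<psi> :: "real^'n::_ \<Rightarrow> real"
  assumes \<Omega>: "\<Omega> \<in> sets lebesgue" "T ` \<Omega> \<in> sets lebesgue"
  shows "integrable (lebesgue_on (T ` \<Omega>)) \<psi> \<longleftrightarrow> integrable (lebesgue_on \<Omega>) (\<lambda>x. \<psi> (T x))"
    and "(LINT z|lebesgue_on (T ` \<Omega>). \<psi> z) = jacobian * (LINT x|lebesgue_on \<Omega>. \<psi> (T x))"
proof -
  \<comment> \<open>The change-of-variables theorem is about vector-valued functions, so \<psi> is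
    lifted to \<open>real^1\<close>.\<close>
  define f :: "real^'n::_ \<Rightarrow> real^1" where "f z = vec (\<psi> z)" for z
  have cov: "(\<lambda>x. jacobian * \<psi> (T x)) absolutely_integrable_on \<Omega> \<and> integral \<Omega> (\<lambda>x. jacobian * \<psi> (T x)) = b
    \<longleftrightarrow> \<psi> absolutely_integrable_on (T ` \<Omega>) \<and> integral (T ` \<Omega>) \<psi> = b" for b
  proof -
    have "(\<lambda>x. \<bar>det (matrix L)\<bar> *\<^sub>R f (T x)) absolutely_integrable_on \<Omega> \<and>
        integral \<Omega> (\<lambda>x. \<bar>det (matrix L)\<bar> *\<^sub>R f (T x)) = vec b
      \<longleftrightarrow> f absolutely_integrable_on (T ` \<Omega>) \<and> integral (T ` \<Omega>) f = vec b"
      by (rule has_absolute_integral_change_of_variables[OF \<Omega>(1)])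
        (use T_has_derivative inj_T in \<open>auto intro: inj_on_subset\<close>)
    then show ?thesis
      by (simp add: f_def absolutely_integrable_on_1_iff integral_on_1_eq jacobian_def vec_eq_iff)
  qed
  have int: "\<psi> absolutely_integrable_on (T ` \<Omega>) \<longleftrightarrow> (\<lambda>x. jacobian * \<psi> (T x)) absolutely_integrable_on \<Omega>"
    using cov by blast
  then show i: "integrable (lebesgue_on (T ` \<Omega>)) \<psi> \<longleftrightarrow> integrable (lebesgue_on \<Omega>) (\<lambda>x. \<psi> (T x))"
    using jacobian_pos by (simp add: \<Omega> flip: integrable_lebesgue_on_iff)
  show "(LINT z|lebesgue_on (T ` \<Omega>). \<psi> z) = jacobian * (LINT x|lebesgue_on \<Omega>. \<psi> (T x))"
  proof (cases "integrable (lebesgue_on (T ` \<Omega>)) \<psi>")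
    case True
    then have "integrable (lebesgue_on \<Omega>) (\<lambda>x. jacobian * \<psi> (T x))" using i by simp
    moreover have "integral (T ` \<Omega>) \<psi> = integral \<Omega> (\<lambda>x. jacobian * \<psi> (T x))"
      using cov int True \<Omega> integrable_lebesgue_on_iff by blast
    ultimately show ?thesis
      using lebesgue_integral_eq_integral[OF True \<Omega>(2)]
        lebesgue_integral_eq_integral[of \<Omega> "\<lambda>x. jacobian * \<psi> (T x)"] \<Omega>(1) by auto
  next
    \<comment> \<open>Neither integrand is integrable, and both integrals are 0 by
      convention.\<close>
    case False
    then show ?thesis using i by (simp add: not_integrable_integral_eq)
  qed
qed

lemma image_eq_vimage: "T ` \<Omega> = T' -` \<Omega>"
  using inverse by (auto simp: image_iff) metis

lemma continuous_T: "continuous_on S T"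
  by (meson T_has_derivative has_derivative_continuous continuous_on_eq_continuous_within)

lemma open_image: "open \<Omega> \<Longrightarrow> open (T ` \<Omega>)"
  unfolding image_eq_vimage
  by (intro open_vimage affine_bijection.continuous_T[OF inverse_affine])

lemma bounded_image: "bounded \<Omega> \<Longrightarrow> bounded (T ` \<Omega>)"
  unfolding T_def[abs_def]
  using bounded_translation[OF bounded_linear_image[of \<Omega> L], of c] linear
  by (simp add: linear_conv_bounded_linear image_image)

lemma L2_compose:
  assumes \<Omega>: "open \<Omega>" "bounded \<Omega>" and u: "u \<in> L2 (T ` \<Omega>)"
  shows "(\<lambda>x. u (T x)) \<in> L2 \<Omega>"
proof -
  have s: "\<Omega> \<in> sets lebesgue" "T ` \<Omega> \<in> sets lebesgue" using \<Omega>(1) open_image by auto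
  have "T ` \<Omega> \<in> lmeasurable" using open_image bounded_image \<Omega> by (simp add: lmeasurable_open)
  then have "integrable (lebesgue_on (T ` \<Omega>)) u" using u by (rule L2_integrable)
  then have "integrable (lebesgue_on \<Omega>) (\<lambda>x. u (T x))" using change_of_variables(1)[OF s] by blast
  moreover have "integrable (lebesgue_on \<Omega>) (\<lambda>x. (u (T x))\<^sup>2)"
    using u change_of_variables(1)[OF s, of "\<lambda>z. (u z)\<^sup>2"] by (simp add: L2_def)
  ultimately show ?thesis by (simp add: L2_def borel_measurable_integrable)
qed

end

section \<open>Test functions and weak gradients under affine maps\<close>

lemma C_k_add: "C_k k f \<Longrightarrow> C_k k g \<Longrightarrow> C_k k (\<lambda>x. f x + g x)"
proof (induction k arbitrary: f g)
  case 0
  then show ?case by (simp add: continuous_intros)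
next
  case (Suc k)
  have d: "(f has_derivative frechet_derivative f (at x)) (at x)" "(g has_derivative frechet_derivative g (at x)) (at x)" for x
    using Suc.prems by (auto simp: frechet_derivative_works)
  have "frechet_derivative (\<lambda>x. f x + g x) (at x) = (\<lambda>h. frechet_derivative f (at x) h + frechet_derivative g (at x) h)" for x
    by (rule frechet_derivative_at[symmetric]) (intro has_derivative_add d)
  moreover have "(\<lambda>x. f x + g x) differentiable at x" for x
    using Suc.prems by (intro differentiable_add) auto
  ultimately show ?case using Suc by simp
qed

lemma C_k_scale: "C_k k f \<Longrightarrow> C_k k (\<lambda>x. a * f x)"
proof (induction k arbitrary: f)
  case 0
  then show ?case by (simp add: continuous_intros)
next
  case (Suc k)
  have d: "(f has_derivative frechet_derivative f (at x)) (at x)" for x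
    using Suc.prems by (auto simp: frechet_derivative_works)
  have "frechet_derivative (\<lambda>x. a * f x) (at x) = (\<lambda>h. a * frechet_derivative f (at x) h)" for x
    by (rule frechet_derivative_at[symmetric]) (intro has_derivative_mult_right d)
  moreover have "(\<lambda>x. a * f x) differentiable at x" for x
    using Suc.prems by (intro differentiable_mult) auto
  ultimately show ?case using Suc by simp
qed

lemma C_k_zero: "C_k k (\<lambda>x :: 'a::euclidean_space. 0)"
proof -
  have "ev (Const 0) = (\<lambda>x :: 'a. 0)" by (simp add: fun_eq_iff)
  then show ?thesis using C_k_ev[of k "Const 0 :: 'a smooth"] by (simp only:)
qed

lemma C_k_sum: "(\<And>i. i \<in> I \<Longrightarrow> C_k k (f i)) \<Longrightarrow> C_k k (\<lambda>x. \<Sum>i\<in>I. f i x)"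
  by (induction I rule: infinite_finite_induct) (auto simp: C_k_zero C_k_add)

context affine_bijection
begin

lemma frechet_derivative_compose:
  assumes "\<phi> differentiable at (T x)"
  shows "((\<lambda>x. \<phi> (T x)) has_derivative (\<lambda>h. frechet_derivative \<phi> (at (T x)) (L h))) (at x)"
proof -
  have "(\<phi> has_derivative frechet_derivative \<phi> (at (T x))) (at (T x))" using assms by (simp add: frechet_derivative_works)
  from diff_chain_at[OF T_has_derivative this] show ?thesis by (simp add: o_def)
qed

lemma frechet_derivative_expand:
  fixes \<phi> :: "real^'n::_ \<Rightarrow> real"
  assumes "\<phi> differentiable at z"
  shows "frechet_derivative \<phi> (at z) h = (\<Sum>i\<in>Basis. (h \<bullet> i) * frechet_derivative \<phi> (at z) i)"
proof -
  have l: "linear (frechet_derivative \<phi> (at z))" using assms by (rule linear_frechet_derivative)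
  have "frechet_derivative \<phi> (at z) h = frechet_derivative \<phi> (at z) (\<Sum>i\<in>Basis. (h \<bullet> i) *\<^sub>R i)"
    by (simp add: euclidean_representation)
  also have "\<dots> = (\<Sum>i\<in>Basis. (h \<bullet> i) * frechet_derivative \<phi> (at z) i)"
    using l by (simp add: linear_sum linear_scale)
  finally show ?thesis .
qed

text \<open>By the chain rule the partial derivatives of the composite are fixed linear combinations
  of partial derivatives of \<phi> composed with \<open>T\<close>, so the induction runs over all
  \<phi>.\<close>

lemma C_k_compose:
  fixes \<phi> :: "real^'n::_ \<Rightarrow> real"
  shows "C_k k \<phi> \<Longrightarrow> C_k k (\<lambda>x. \<phi> (T x))"
proof (induction k arbitrary: \<phi>)
  case 0
  then show ?case using continuous_on_compose2[OF _ continuous_T, of UNIV \<phi> UNIV] by simp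
next
  case (Suc k)
  then have d: "\<phi> differentiable at z" for z by simp
  have "frechet_derivative (\<lambda>x. \<phi> (T x)) (at x) = (\<lambda>h. frechet_derivative \<phi> (at (T x)) (L h))" for x
    by (rule frechet_derivative_at[symmetric]) (rule frechet_derivative_compose[OF d])
  then have eq: "frechet_derivative (\<lambda>x. \<phi> (T x)) (at x) b = (\<Sum>i\<in>Basis. (L b \<bullet> i) * frechet_derivative \<phi> (at (T x)) i)" for x b
    by (simp flip: frechet_derivative_expand[OF d])
  have "(\<lambda>x. \<phi> (T x)) differentiable at x" for x
    using frechet_derivative_compose[OF d] differentiableI by blast
  moreover have "C_k k (\<lambda>x. \<Sum>i\<in>Basis. (L b \<bullet> i) * frechet_derivative \<phi> (at (T x)) i)" for b
    using Suc by (intro C_k_sum C_k_scale) auto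
  ultimately show ?case by (simp add: eq)
qed

lemma test_function_compose:
  fixes \<phi> :: "real^'n::_ \<Rightarrow> real"
  assumes "test_function (T ` \<Omega>) \<phi>"
  shows "test_function \<Omega> (\<lambda>x. \<phi> (T x))"
proof -
  define K where "K = closure {z. \<phi> z \<noteq> 0}"
  have K: "compact K" "K \<subseteq> T ` \<Omega>" using assms by (auto simp: K_def test_function_def)
  have cK: "compact (T' ` K)"
    by (intro compact_continuous_image affine_bijection.continuous_T[OF inverse_affine] K)
  have "{x. \<phi> (T x) \<noteq> 0} \<subseteq> T' ` K"
  proof
    fix x assume "x \<in> {x. \<phi> (T x) \<noteq> 0}"
    then have "T x \<in> K" using closure_subset[of "{z. \<phi> z \<noteq> 0}"] by (auto simp: K_def)
    then show "x \<in> T' ` K" using inverse(1) by (metis imageI)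
  qed
  then have sub: "closure {x. \<phi> (T x) \<noteq> 0} \<subseteq> T' ` K"
    using cK by (intro closure_minimal compact_imp_closed)
  then have "compact (closure {x. \<phi> (T x) \<noteq> 0})"
    using cK by (metis Int_absorb1 closed_closure compact_Int_closed)
  moreover have "T' ` K \<subseteq> \<Omega>" using K(2) inverse(1) by auto
  ultimately show ?thesis using sub assms C_k_compose unfolding test_function_def by blast
qed

text \<open>\<open>G\<close> is the transpose of \<open>L\<close> applied to the gradient at
  \<open>T x\<close>, described by inner products. Test functions are moved by the inverse map, and
  the Jacobian cancels from both sides.\<close>

lemma H1_grad_compose:
  assumes \<Omega>: "open \<Omega>" "bounded \<Omega>" and u: "H1_grad (T ` \<Omega>) u g"
    and G: "\<And>x b. b \<in> Basis \<Longrightarrow> G x \<bullet> b = g (T x) \<bullet> L b"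
  shows "H1_grad \<Omega> (\<lambda>x. u (T x)) G"
  unfolding H1_grad_def
proof (intro conjI ballI allI impI)
  have s: "\<Omega> \<in> sets lebesgue" "T ` \<Omega> \<in> sets lebesgue" using \<Omega>(1) open_image by auto
  have T\<Omega>: "open (T ` \<Omega>)" "bounded (T ` \<Omega>)" using open_image bounded_image \<Omega> by auto
  have u2: "u \<in> L2 (T ` \<Omega>)" and g2: "i \<in> Basis \<Longrightarrow> (\<lambda>z. g z \<bullet> i) \<in> L2 (T ` \<Omega>)" for i
    using u by (auto simp: H1_grad_def)
  show "(\<lambda>x. u (T x)) \<in> L2 \<Omega>" by (rule L2_compose[OF \<Omega> u2])
  fix b :: "real^'n::_" assume b: "b \<in> Basis"
  have gb: "g z \<bullet> L b = (\<Sum>i\<in>Basis. (L b \<bullet> i) * (g z \<bullet> i))" for z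
    by (subst euclidean_inner) (simp add: mult.commute)
  have "(\<lambda>z. g z \<bullet> L b) \<in> L2 (T ` \<Omega>)" unfolding gb by (intro L2_sum L2_scale g2)
  from L2_compose[OF \<Omega> this] show "(\<lambda>x. G x \<bullet> b) \<in> L2 \<Omega>" by (simp add: G b)
  fix \<phi> :: "real^'n::_ \<Rightarrow> real" assume \<phi>: "test_function \<Omega> \<phi>"
  define \<psi> where "\<psi> z = \<phi> (T' z)" for z
  have "\<Omega> = T' ` T ` \<Omega>" using inverse by (simp add: image_image)
  then have \<psi>: "test_function (T ` \<Omega>) \<psi>"
    using \<phi> affine_bijection.test_function_compose[OF inverse_affine, of "T ` \<Omega>" \<phi>] by (simp add: \<psi>_def[abs_def])
  note \<psi>2 = test_function_L2[OF T\<Omega> \<psi>]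
  have d: "\<psi> differentiable at z" for z
    using test_function_derivative(1)[OF \<psi>] differentiableI by blast
  have \<phi>\<psi>: "\<phi> x = \<psi> (T x)" for x by (simp add: \<psi>_def inverse)
  have "frechet_derivative \<phi> (at x) = (\<lambda>h. frechet_derivative \<psi> (at (T x)) (L h))" for x
    unfolding \<phi>\<psi>[abs_def] by (rule frechet_derivative_at[symmetric]) (rule frechet_derivative_compose[OF d])
  then have D\<phi>: "frechet_derivative \<phi> (at x) b = (\<Sum>i\<in>Basis. (L b \<bullet> i) * frechet_derivative \<psi> (at (T x)) i)" for x
    by (simp flip: frechet_derivative_expand[OF d])
  have "jacobian * (LINT x|lebesgue_on \<Omega>. u (T x) * frechet_derivative \<phi> (at x) b) =
      (LINT z|lebesgue_on (T ` \<Omega>). u z * (\<Sum>i\<in>Basis. (L b \<bullet> i) * frechet_derivative \<psi> (at z) i))"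
    unfolding D\<phi> by (rule change_of_variables(2)[OF s, symmetric])
  also have "\<dots> = (LINT z|lebesgue_on (T ` \<Omega>). (\<Sum>i\<in>Basis. (L b \<bullet> i) * (u z * frechet_derivative \<psi> (at z) i)))"
    by (simp add: sum_distrib_left mult_ac)
  also have "\<dots> = (\<Sum>i\<in>Basis. (L b \<bullet> i) * (LINT z|lebesgue_on (T ` \<Omega>). u z * frechet_derivative \<psi> (at z) i))"
    by (subst Bochner_Integration.integral_sum) (auto intro!: L2_mult_integrable u2 \<psi>2)
  also have "\<dots> = (\<Sum>i\<in>Basis. (L b \<bullet> i) * - (LINT z|lebesgue_on (T ` \<Omega>). (g z \<bullet> i) * \<psi> z))"
    using u \<psi> by (intro sum.cong) (auto simp: H1_grad_def)
  also have "\<dots> = - (LINT z|lebesgue_on (T ` \<Omega>). (\<Sum>i\<in>Basis. (L b \<bullet> i) * ((g z \<bullet> i) * \<psi> z)))"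
    by (subst Bochner_Integration.integral_sum) (auto intro!: L2_mult_integrable g2 \<psi>2 simp: sum_negf)
  also have "\<dots> = - (LINT z|lebesgue_on (T ` \<Omega>). (g z \<bullet> L b) * \<psi> z)"
    unfolding gb by (simp add: sum_distrib_right mult.assoc)
  also have "\<dots> = - (jacobian * (LINT x|lebesgue_on \<Omega>. (g (T x) \<bullet> L b) * \<psi> (T x)))"
    using change_of_variables(2)[OF s, of "\<lambda>z. (g z \<bullet> L b) * \<psi> z"] by simp
  finally have "jacobian * (LINT x|lebesgue_on \<Omega>. u (T x) * frechet_derivative \<phi> (at x) b) =
      jacobian * - (LINT x|lebesgue_on \<Omega>. (G x \<bullet> b) * \<phi> x)"
    by (simp add: G b \<phi>\<psi>)
  then show "(LINT x|lebesgue_on \<Omega>. u (T x) * frechet_derivative \<phi> (at x) b) =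
      - (LINT x|lebesgue_on \<Omega>. (G x \<bullet> b) * \<phi> x)"
    using jacobian_pos by (simp only: mult_cancel_left) simp
qed

end

section \<open>Neumann spectrum of an ellipse\<close>

text \<open>In coordinates f is d times e turned by a right angle, where d is the determinant of the
  frame and d^2 = 1. Orthonormality of the columns therefore passes to the rows.\<close>

lemma orthonormal_expansion_2:
  fixes e f z :: "real^2"
  assumes "norm e = 1" "norm f = 1" "e \<bullet> f = 0"
  shows "z = (z \<bullet> e) *\<^sub>R e + (z \<bullet> f) *\<^sub>R f"
proof -
  define p q r s where "p = e $ 1" and "q = e $ 2" and "r = f $ 1" and "s = f $ 2"
  have 1: "p * p + q * q = 1" "r * r + s * s = 1" "p * r + q * s = 0"
    using assms by (auto simp: p_def q_def r_def s_def norm_eq_1 inner_vec_def sum_2)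
  define d where "d = p * s - q * r"
  have "s = (p * p + q * q) * s - q * (p * r + q * s)" using 1 by simp
  then have s: "s = d * p" by (simp add: d_def algebra_simps)
  have "r = (p * p + q * q) * r - p * (p * r + q * s)" using 1 by simp
  then have r: "r = - d * q" by (simp add: d_def algebra_simps)
  have "d * d * (p * p + q * q) = 1" using 1(2) unfolding s r by (simp add: algebra_simps)
  then have dd: "d * d = 1" using 1 by simp
  have "p * p + r * r = p * p + d * d * (q * q)" by (simp add: r)
  then have 2: "p * p + r * r = 1" using dd 1 by simp
  have "q * q + s * s = q * q + d * d * (p * p)" by (simp add: s)
  then have 3: "q * q + s * s = 1" using dd 1 by simp
  have "p * q + r * s = p * q - d * d * (p * q)" by (simp add: r s)
  then have 4: "p * q + r * s = 0" using dd by simp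
  have "((z \<bullet> e) *\<^sub>R e + (z \<bullet> f) *\<^sub>R f) $ 1 = z $ 1 * (p * p + r * r) + z $ 2 * (p * q + r * s)"
    "((z \<bullet> e) *\<^sub>R e + (z \<bullet> f) *\<^sub>R f) $ 2 = z $ 1 * (p * q + r * s) + z $ 2 * (q * q + s * s)"
    by (simp_all add: inner_vec_def sum_2 p_def q_def r_def s_def algebra_simps)
  then show ?thesis using 2 3 4 by (simp add: vec_eq_iff forall_2)
qed

locale ellipse_frame =
  fixes c e f :: "real^2" and a b :: real
  assumes unit: "norm e = 1" "norm f = 1" and orth: "e \<bullet> f = 0" and pos: "a > 0" "b > 0"
begin

definition L :: "real^2 \<Rightarrow> real^2" where "L x = (a * x $ 1) *\<^sub>R e + (b * x $ 2) *\<^sub>R f"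
definition L' :: "real^2 \<Rightarrow> real^2" where "L' z = (\<chi> i. if i = 1 then (z \<bullet> e) / a else (z \<bullet> f) / b)"
definition T :: "real^2 \<Rightarrow> real^2" where "T x = c + L x"
definition T' :: "real^2 \<Rightarrow> real^2" where "T' z = - L' c + L' z"
definition \<kappa> :: real where "\<kappa> = (a / b)\<^sup>2"

lemma \<kappa>_pos: "\<kappa> > 0"
  using pos by (simp add: \<kappa>_def)

lemma L'_components: "L' z $ 1 = (z \<bullet> e) / a" "L' z $ 2 = (z \<bullet> f) / b"
  by (simp_all add: L'_def)

lemma L_inner: "L x \<bullet> e = a * x $ 1" "L x \<bullet> f = b * x $ 2"
  using unit orth by (simp_all add: L_def inner_add_left norm_eq_1 inner_commute[of f e])

lemma linear_L': "linear L'"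
  by (rule linearI) (simp_all add: vec_eq_iff forall_2 L'_components inner_add_left add_divide_distrib)

lemma inverse_L: "L' (L x) = x" "L (L' z) = z"
proof -
  show "L' (L x) = x" using pos by (simp add: vec_eq_iff forall_2 L'_components L_inner)
  show "L (L' z) = z"
    using pos orthonormal_expansion_2[OF unit orth, of z] by (simp add: L_def L'_components)
qed

sublocale affine: affine_bijection c L T T' "- L' c" L'
proof
  show "L (x + y) = L x + L y" "L (r *\<^sub>R x) = r *\<^sub>R L x" for x y r
    by (simp_all add: L_def algebra_simps)
  show "L' (x + y) = L' x + L' y" "L' (r *\<^sub>R x) = r *\<^sub>R L' x" for x y r
    using linear_L' by (simp_all add: linear_add linear_scale)
  show "T' (T x) = x" "T (T' x) = x" for x
    by (simp_all add: T_def T'_def linear_add[OF linear_L'] inverse_L)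
      (metis add_uminus_conv_diff diff_add_cancel inverse_L(2) linear_diff[OF linear_L'] add.commute uminus_add_conv_diff)
qed (simp_all add: T_def T'_def)

lemma image_disc: "T ` disc = {z. (((z - c) \<bullet> e) / a)\<^sup>2 + (((z - c) \<bullet> f) / b)\<^sup>2 < 1}"
proof -
  have "T' z $ 1 = ((z - c) \<bullet> e) / a" "T' z $ 2 = ((z - c) \<bullet> f) / b" for z
    by (simp_all add: T'_def L'_components inner_diff_left diff_divide_distrib)
  then show ?thesis unfolding affine.image_eq_vimage vimage_def disc_iff by simp
qed

text \<open>The chain rule: this is the gradient of u composed with \<open>T\<close> when g is the
  gradient of u. \<open>push\<close> undoes it.\<close>

definition pull :: "(real^2 \<Rightarrow> real^2) \<Rightarrow> real^2 \<Rightarrow> real^2" where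
  "pull g x = (\<chi> i. if i = 1 then a * (g (T x) \<bullet> e) else b * (g (T x) \<bullet> f))"

definition push :: "(real^2 \<Rightarrow> real^2) \<Rightarrow> real^2 \<Rightarrow> real^2" where
  "push G z = (G (T' z) $ 1 / a) *\<^sub>R e + (G (T' z) $ 2 / b) *\<^sub>R f"

lemma pull_components: "pull g x $ 1 = a * (g (T x) \<bullet> e)" "pull g x $ 2 = b * (g (T x) \<bullet> f)"
  by (simp_all add: pull_def)

lemma pull_push: "pull (push G) = G"
  using pos unit orth
  by (auto simp: fun_eq_iff vec_eq_iff forall_2 pull_components push_def affine.inverse inner_add_left
      norm_eq_1 inner_commute[of f e])

lemma H1_grad_pull:
  assumes "H1_grad (T ` disc) u g"
  shows "H1_grad disc (\<lambda>x. u (T x)) (pull g)"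
proof (rule affine.H1_grad_compose[OF _ _ assms])
  show "pull g x \<bullet> i = g (T x) \<bullet> L i" if "i \<in> Basis" for x i
    using that unfolding Basis_vec2
    by (auto simp: inner_axis pull_components L_def inner_add_right)
qed auto

lemma H1_grad_push:
  assumes "H1_grad disc U G"
  shows "H1_grad (T ` disc) (\<lambda>z. U (T' z)) (push G)"
proof (rule affine_bijection.H1_grad_compose[OF affine.inverse_affine])
  have "T' ` T ` disc = disc" by (simp add: image_image affine.inverse)
  then show "H1_grad (T' ` T ` disc) U G" using assms by simp
  show "push G z \<bullet> i = G (T' z) \<bullet> L' i" for z i
    by (simp add: push_def inner_add_left inner_vec_def[of "G (T' z)" "L' i"] sum_2 L'_components
        inner_commute[of i])
qed (auto intro: affine.open_image affine.bounded_image)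

lemma disc_sets: "disc \<in> sets lebesgue" "T ` disc \<in> sets lebesgue"
  using affine.open_image[of disc] by auto

definition H1_class :: "(real^2 \<Rightarrow> real) \<Rightarrow> (real^2 \<Rightarrow> real^2) \<Rightarrow> l2 \<times> l2 \<times> l2" where
  "H1_class u g = (abs_l2 (\<lambda>x. u (T x)), abs_l2 (\<lambda>x. pull g x $ 1), abs_l2 (\<lambda>x. pull g x $ 2))"

lemma H1_class_in: "H1_grad (T ` disc) u g \<Longrightarrow> H1_class u g \<in> H1"
  using H1_grad_pull[of u g] by (simp add: H1_grad_iff H1_class_def)

lemma H1_class_surj:
  assumes "y \<in> H1"
  obtains v h where "H1_grad (T ` disc) v h" "y = H1_class v h"
proof -
  obtain V H where V: "H1_grad disc V H" "y = (abs_l2 V, abs_l2 (\<lambda>x. H x $ 1), abs_l2 (\<lambda>x. H x $ 2))"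
    using H1_representation[OF assms] .
  then have "y = H1_class (\<lambda>z. V (T' z)) (push H)" by (simp add: H1_class_def pull_push affine.inverse)
  then show thesis using that[OF H1_grad_push[OF V(1)]] by blast
qed

text \<open>In the frame e, f the gradient at \<open>T x\<close> has components
  \<open>pull g x $ 1 / a\<close> and \<open>pull g x $ 2 / b\<close>. Taking out a^-2 leaves the
  weight (a/b)^2 = \<kappa> on the second product.\<close>

lemma energy_transport:
  assumes g: "H1_grad (T ` disc) u g" and h: "H1_grad (T ` disc) v h"
  shows "(LINT z|lebesgue_on (T ` disc). g z \<bullet> h z) =
      affine.jacobian / a\<^sup>2 * form \<kappa> (snd (H1_class u g)) (snd (H1_class v h))"
    and "(LINT z|lebesgue_on (T ` disc). u z * v z) =
      affine.jacobian * (fst (H1_class u g) \<bullet> fst (H1_class v h))"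
proof -
  note G = H1_gradD(1-3)[OF H1_grad_pull[OF g]] and H = H1_gradD(1-3)[OF H1_grad_pull[OF h]]
  have gh: "g (T x) \<bullet> h (T x) = (pull g x $ 1 * pull h x $ 1 + \<kappa> * (pull g x $ 2 * pull h x $ 2)) / a\<^sup>2" for x
  proof -
    have "g (T x) \<bullet> h (T x) = (g (T x) \<bullet> e) * (h (T x) \<bullet> e) + (g (T x) \<bullet> f) * (h (T x) \<bullet> f)"
      by (subst orthonormal_expansion_2[OF unit orth, of "h (T x)"])
        (simp add: inner_add_right mult.commute)
    then show ?thesis using pos by (simp add: pull_components \<kappa>_def field_simps power2_eq_square)
  qed
  have "(LINT z|lebesgue_on (T ` disc). g z \<bullet> h z) = affine.jacobian *
      ((LINT x|lebesgue_on disc. pull g x $ 1 * pull h x $ 1 + \<kappa> * (pull g x $ 2 * pull h x $ 2)) / a\<^sup>2)"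
    by (simp add: affine.change_of_variables(2)[OF disc_sets] gh)
  also have "(LINT x|lebesgue_on disc. pull g x $ 1 * pull h x $ 1 + \<kappa> * (pull g x $ 2 * pull h x $ 2))
      = form \<kappa> (snd (H1_class u g)) (snd (H1_class v h))"
    using G H by (simp add: form_def H1_class_def abs_l2_simps(3) L2_mult_integrable)
  finally show "(LINT z|lebesgue_on (T ` disc). g z \<bullet> h z) =
      affine.jacobian / a\<^sup>2 * form \<kappa> (snd (H1_class u g)) (snd (H1_class v h))" by simp
  show "(LINT z|lebesgue_on (T ` disc). u z * v z) =
      affine.jacobian * (fst (H1_class u g) \<bullet> fst (H1_class v h))"
    using G H by (simp add: affine.change_of_variables(2)[OF disc_sets] H1_class_def abs_l2_simps(3))
qed

text \<open>The Jacobian cancels, and the factor a^-2 of the energy moves to the eigenvalue. Square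
  integrability is stated separately because the eigenspace consists of functions, and
  \<open>abs_l2\<close> is meaningful only on \<open>L2\<close>.\<close>

lemma neumann_eigenspace_iff:
  "u \<in> neumann_eigenspace (T ` disc) \<mu> \<longleftrightarrow> (\<lambda>x. u (T x)) \<in> L2 disc \<and>
    (\<exists>x. energy_form.eigenpair H1 (form \<kappa>) (a\<^sup>2 * \<mu>) x \<and> fst x = abs_l2 (\<lambda>x. u (T x)))"
proof -
  have J: "affine.jacobian > 0" by (rule affine.jacobian_pos)
  have scale: "J / A * s = \<mu> * (J * t) \<longleftrightarrow> s = A * \<mu> * t" if "J > 0" "A > 0" for J A s t :: real
    using that by (auto simp: field_simps)
  have equiv: "(LINT z|lebesgue_on (T ` disc). g z \<bullet> h z) = \<mu> * (LINT z|lebesgue_on (T ` disc). u z * v z) \<longleftrightarrow>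
    form \<kappa> (snd (H1_class u g)) (snd (H1_class v h)) = a\<^sup>2 * \<mu> * (fst (H1_class u g) \<bullet> fst (H1_class v h))"
    if "H1_grad (T ` disc) u g" "H1_grad (T ` disc) v h" for g v h
    unfolding energy_transport[OF that] using J pos by (intro scale) auto
  show ?thesis
  proof
    assume "u \<in> neumann_eigenspace (T ` disc) \<mu>"
    then obtain g where g: "H1_grad (T ` disc) u g" and eig: "\<And>v h. H1_grad (T ` disc) v h \<Longrightarrow>
      (LINT z|lebesgue_on (T ` disc). g z \<bullet> h z) = \<mu> * (LINT z|lebesgue_on (T ` disc). u z * v z)"
      by (auto simp: neumann_eigenspace_def)
    have "energy_form.eigenpair H1 (form \<kappa>) (a\<^sup>2 * \<mu>) (H1_class u g)"
      unfolding eigenpair_disc[OF \<kappa>_pos]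
    proof (intro conjI ballI H1_class_in[OF g])
      fix y assume "y \<in> H1"
      then obtain v h where y: "H1_grad (T ` disc) v h" "y = H1_class v h" by (rule H1_class_surj)
      show "form \<kappa> (snd (H1_class u g)) (snd y) = a\<^sup>2 * \<mu> * (fst (H1_class u g) \<bullet> fst y)"
        using eig[OF y(1)] equiv[OF g y(1)] unfolding y(2) by blast
    qed
    then show "(\<lambda>x. u (T x)) \<in> L2 disc \<and>
      (\<exists>x. energy_form.eigenpair H1 (form \<kappa>) (a\<^sup>2 * \<mu>) x \<and> fst x = abs_l2 (\<lambda>x. u (T x)))"
      using H1_gradD(1)[OF H1_grad_pull[OF g]] by (intro conjI exI[of _ "H1_class u g"]) (auto simp: H1_class_def)
  next
    assume "(\<lambda>x. u (T x)) \<in> L2 disc \<and>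
      (\<exists>x. energy_form.eigenpair H1 (form \<kappa>) (a\<^sup>2 * \<mu>) x \<and> fst x = abs_l2 (\<lambda>x. u (T x)))"
    then obtain x where u2: "(\<lambda>x. u (T x)) \<in> L2 disc" and x: "x \<in> H1" "fst x = abs_l2 (\<lambda>x. u (T x))"
      and eig: "\<And>y. y \<in> H1 \<Longrightarrow> form \<kappa> (snd x) (snd y) = a\<^sup>2 * \<mu> * (fst x \<bullet> fst y)"
      unfolding eigenpair_disc[OF \<kappa>_pos] by blast
    obtain v h where vh: "H1_grad disc v h" "x = (abs_l2 v, abs_l2 (\<lambda>x. h x $ 1), abs_l2 (\<lambda>x. h x $ 2))"
      using H1_representation[OF x(1)] .
    \<comment> \<open>The function u composed with \<open>T\<close> has the same class as
      \<open>v\<close>, so \<open>h\<close> is its weak gradient as well.\<close>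
    have "H1_grad disc (\<lambda>x. u (T x)) h"
      using vh x u2 H1_gradD(2,3)[OF vh(1)] by (simp add: H1_grad_iff)
    from H1_grad_push[OF this] have g: "H1_grad (T ` disc) u (push h)" by (simp add: affine.inverse)
    have xc: "x = H1_class u (push h)" using vh(2) x(2) by (simp add: H1_class_def pull_push)
    show "u \<in> neumann_eigenspace (T ` disc) \<mu>"
      unfolding neumann_eigenspace_def
    proof (intro CollectI exI[of _ "push h"] conjI allI impI g)
      fix w k assume w: "H1_grad (T ` disc) w k"
      show "(LINT z|lebesgue_on (T ` disc). push h z \<bullet> k z) = \<mu> * (LINT z|lebesgue_on (T ` disc). u z * w z)"
        using eig[OF H1_class_in[OF w]] equiv[OF g w] unfolding xc by blast
    qed
  qed
qed

text \<open>Vanishing almost everywhere is expressed through the integral of F^2, which the change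
  of variables transports.\<close>

lemma AE_zero_iff:
  assumes F: "(\<lambda>x. F (T x)) \<in> L2 disc"
  shows "(AE z in lebesgue_on (T ` disc). F z = 0) \<longleftrightarrow> abs_l2 (\<lambda>x. F (T x)) = 0"
proof -
  have "(\<lambda>z. (\<lambda>x. F (T x)) (T' z)) \<in> L2 (T ` disc)"
  proof (rule affine_bijection.L2_compose[OF affine.inverse_affine])
    have "T' ` T ` disc = disc" by (simp add: image_image affine.inverse)
    then show "(\<lambda>x. F (T x)) \<in> L2 (T' ` T ` disc)" using F by simp
  qed (auto intro: affine.open_image affine.bounded_image)
  then have F2: "integrable (lebesgue_on (T ` disc)) (\<lambda>z. (F z)\<^sup>2)" by (simp add: affine.inverse L2_def)
  have "(AE z in lebesgue_on (T ` disc). F z = 0) \<longleftrightarrow> (LINT z|lebesgue_on (T ` disc). (F z)\<^sup>2) = 0"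
    by (subst integral_nonneg_eq_0_iff_AE[OF F2]) auto
  also have "\<dots> \<longleftrightarrow> (norm (abs_l2 (\<lambda>x. F (T x))))\<^sup>2 = 0"
    using affine.jacobian_pos by (simp only: affine.change_of_variables(2)[OF disc_sets] norm_abs_l2[OF F]) auto
  finally show ?thesis by simp
qed

lemma neumann_multiplicity_ellipse:
  assumes sb: "energy_form.spectral_basis H1 (form \<kappa>) w m"
  shows "neumann_multiplicity (T ` disc) \<mu> (card {i. m i = a\<^sup>2 * \<mu>})"
proof -
  interpret E: energy_form H1 "form \<kappa>" by (rule energy_form_disc[OF \<kappa>_pos])
  note S = E.spectral_basisD[OF sb]
  define A where "A = {i. m i = a\<^sup>2 * \<mu>}"
  define n where "n = card A"
  have finA: "finite A" unfolding A_def by (rule E.finite_level_set[OF S(5)])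
  then obtain h where h: "bij_betw h {..<n} A"
    unfolding n_def using ex_bij_betw_nat_finite[OF finA] by (auto simp: lessThan_atLeast0)
  have hA: "h i \<in> A" if "i < n" for i using h that by (auto simp: bij_betw_def)
  define u where "u i z = rep_l2 (fst (w (h i))) (T' z)" for i z
  have uT: "(\<lambda>x. u i (T x)) = rep_l2 (fst (w (h i)))" for i by (simp add: u_def affine.inverse fun_eq_iff)
  have uL2: "(\<lambda>x. u i (T x)) \<in> L2 disc" for i by (simp add: uT rep_l2_L2)
  have uc: "abs_l2 (\<lambda>x. u i (T x)) = fst (w (h i))" for i by (simp add: uT abs_rep_l2)
  have comb: "(\<lambda>x. \<Sum>i<n. d i * u i (T x)) \<in> L2 disc"
    "abs_l2 (\<lambda>x. \<Sum>i<n. d i * u i (T x)) = (\<Sum>i<n. d i *\<^sub>R fst (w (h i)))" for d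
    using abs_l2_sum[of "{..<n}" "\<lambda>i x. u i (T x)" d] by (auto intro!: L2_sum L2_scale uL2 simp: uL2 uc)
  have "u i \<in> neumann_eigenspace (T ` disc) \<mu>" if "i < n" for i
    unfolding neumann_eigenspace_iff
    using uL2 uc hA[OF that] S(1)[of "h i"] by (intro conjI exI[of _ "w (h i)"]) (simp_all add: A_def)
  moreover have "\<forall>i<n. d i = 0" if "AE x in lebesgue_on (T ` disc). (\<Sum>i<n. d i * u i x) = 0" for d
  proof (intro allI impI)
    fix k assume k: "k < n"
    have "(\<Sum>i<n. d i *\<^sub>R fst (w (h i))) = 0"
      using that AE_zero_iff[OF comb(1)] comb(2) by simp
    then have "0 = (\<Sum>i<n. d i *\<^sub>R fst (w (h i))) \<bullet> fst (w (h k))" by simp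
    also have "\<dots> = (\<Sum>i<n. d i * (if h i = h k then 1 else 0))" by (simp add: inner_sum_left S(2))
    also have "\<dots> = (\<Sum>i<n. if i = k then d k else 0)"
      using h k by (intro sum.cong) (auto simp: bij_betw_def inj_on_def)
    also have "\<dots> = d k" using k by simp
    finally show "d k = 0" by simp
  qed
  moreover have "\<exists>d. AE x in lebesgue_on (T ` disc). v x = (\<Sum>i<n. d i * u i x)"
    if v: "v \<in> neumann_eigenspace (T ` disc) \<mu>" for v
  proof -
    obtain x where vL: "(\<lambda>x. v (T x)) \<in> L2 disc" and x: "E.eigenpair (a\<^sup>2 * \<mu>) x" "fst x = abs_l2 (\<lambda>x. v (T x))"
      using v unfolding neumann_eigenspace_iff by auto
    define d where "d i = fst x \<bullet> fst (w (h i))" for i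
    have "fst x = (\<Sum>i\<in>A. (fst x \<bullet> fst (w i)) *\<^sub>R fst (w i))"
      unfolding A_def by (rule E.eigenpair_expansion[OF sb x(1)])
    also have "\<dots> = (\<Sum>i<n. d i *\<^sub>R fst (w (h i)))"
      unfolding d_def by (rule sum.reindex_bij_betw[OF h, symmetric])
    finally have "abs_l2 (\<lambda>x. v (T x) - (\<Sum>i<n. d i * u i (T x))) = 0"
      using abs_l2_simps(2)[OF vL comb(1)[of d]] comb(2)[of d] x(2) by simp
    then have "AE z in lebesgue_on (T ` disc). v z - (\<Sum>i<n. d i * u i z) = 0"
      using AE_zero_iff[of "\<lambda>z. v z - (\<Sum>i<n. d i * u i z)"] L2_diff[OF vL comb(1)[of d]] by blast
    then show ?thesis by auto
  qed
  ultimately show ?thesis unfolding neumann_multiplicity_def A_def[symmetric] n_def[symmetric] by blast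
qed

text \<open>The spectrum is indexed from 1 and the spectral basis from 0; index 0 repeats
  \<open>m 0\<close> and lies outside the counted range.\<close>

lemma neumann_spectrum_ellipse:
  assumes sb: "energy_form.spectral_basis H1 (form \<kappa>) w m"
  shows "neumann_spectrum (T ` disc) (\<lambda>j. m (j - 1) / a\<^sup>2)"
proof -
  interpret E: energy_form H1 "form \<kappa>" by (rule energy_form_disc[OF \<kappa>_pos])
  note S = E.spectral_basisD[OF sb]
  have a2: "a\<^sup>2 > 0" using pos by simp
  have "mono_on {1..} (\<lambda>j. m (j - 1) / a\<^sup>2)"
    using monoD[OF S(4)] a2 by (intro mono_onI divide_right_mono) auto
  moreover have "filterlim (\<lambda>j. m (j - 1) / a\<^sup>2) at_top sequentially"
  proof -
    have "filterlim (\<lambda>j. m (j - 1)) at_top sequentially"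
      by (rule filterlim_compose[OF S(5)]) (rule filterlim_minus_const_nat_at_top)
    then show ?thesis using a2
      by (intro filterlim_at_top_mult_tendsto_pos[OF tendsto_const[of "inverse (a\<^sup>2)"], unfolded divide_inverse[symmetric]])
        (auto simp: divide_inverse)
  qed
  moreover have "card {j\<in>{1..}. m (j - 1) / a\<^sup>2 = \<mu>} = card {i. m i = a\<^sup>2 * \<mu>}" for \<mu>
  proof (rule bij_betw_same_card[of "\<lambda>j. j - 1"], rule bij_betw_byWitness[of _ Suc])
    show "(\<lambda>j. j - 1) ` {j\<in>{1..}. m (j - 1) / a\<^sup>2 = \<mu>} \<subseteq> {i. m i = a\<^sup>2 * \<mu>}"
      "Suc ` {i. m i = a\<^sup>2 * \<mu>} \<subseteq> {j\<in>{1..}. m (j - 1) / a\<^sup>2 = \<mu>}"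
      using a2 by (auto simp: field_simps)
  qed auto
  ultimately show ?thesis
    unfolding neumann_spectrum_def using neumann_multiplicity_ellipse[OF sb] by simp
qed

end

section \<open>Comparison with the disc\<close>

text \<open>More than n functions that are almost everywhere combinations of n fixed ones satisfy a
  nontrivial relation; the finitely many exceptional null sets are merged into one.\<close>

lemma neumann_multiplicity_le:
  assumes m: "neumann_multiplicity \<Omega> \<mu> n" and m': "neumann_multiplicity \<Omega> \<mu> n'"
  shows "n' \<le> n"
proof (rule ccontr)
  assume "\<not> n' \<le> n"
  obtain u where span: "\<And>v. v \<in> neumann_eigenspace \<Omega> \<mu> \<Longrightarrow> \<exists>c. AE x in lebesgue_on \<Omega>. v x = (\<Sum>i<n. c i * u i x)"
    using m unfolding neumann_multiplicity_def by metis
  obtain u' where u': "\<And>i. i < n' \<Longrightarrow> u' i \<in> neumann_eigenspace \<Omega> \<mu>"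
    and indep: "\<And>c. AE x in lebesgue_on \<Omega>. (\<Sum>i<n'. c i * u' i x) = 0 \<Longrightarrow> \<forall>i<n'. c i = 0"
    using m' unfolding neumann_multiplicity_def by metis
  obtain M where M: "\<And>i. i < n' \<Longrightarrow> AE x in lebesgue_on \<Omega>. u' i x = (\<Sum>k<n. M i k * u k x)"
    using span[OF u'] by metis
  obtain c where c: "\<exists>i\<in>{..<n'}. c i \<noteq> 0" "\<forall>k\<in>{..<n}. (\<Sum>i<n'. c i * M i k) = 0"
    using homogeneous_system_solvable[of "{..<n}" "{..<n'}" M] \<open>\<not> n' \<le> n\<close> by auto
  have "AE x in lebesgue_on \<Omega>. \<forall>i\<in>{..<n'}. u' i x = (\<Sum>k<n. M i k * u k x)"
    using M by (intro AE_finite_allI) auto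
  then have "AE x in lebesgue_on \<Omega>. (\<Sum>i<n'. c i * u' i x) = 0"
  proof eventually_elim
    case (elim x)
    then have "(\<Sum>i<n'. c i * u' i x) = (\<Sum>i<n'. \<Sum>k<n. c i * M i k * u k x)"
      by (simp add: sum_distrib_left mult.assoc)
    also have "\<dots> = (\<Sum>k<n. (\<Sum>i<n'. c i * M i k) * u k x)"
      by (subst sum.swap) (simp add: sum_distrib_right)
    finally show ?case using c(2) by simp
  qed
  then show False using indep c(1) by auto
qed

text \<open>If m j < m' j, then by monotonicity \<open>m'\<close> takes the value \<open>m j\<close>
  only below j, where it agrees with \<open>m\<close>. But \<open>m\<close> takes it at j as well,
  so the two counts, both equal to the multiplicity, would differ.\<close>

lemma neumann_spectrum_le:
  assumes m: "neumann_spectrum \<Omega> m" and m': "neumann_spectrum \<Omega> m'"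
    and j: "j \<ge> 1" and eq: "\<And>i. 1 \<le> i \<Longrightarrow> i < j \<Longrightarrow> m i = m' i"
  shows "m' j \<le> m j"
proof (rule ccontr)
  assume less: "\<not> m' j \<le> m j"
  define A A' where "A = {i\<in>{1..}. m i = m j}" and "A' = {i\<in>{1..}. m' i = m j}"
  have "neumann_multiplicity \<Omega> (m j) (card A)" "neumann_multiplicity \<Omega> (m j) (card A')"
    using m m' unfolding neumann_spectrum_def A_def A'_def by blast+
  then have card: "card A = card A'" using neumann_multiplicity_le by (metis order_antisym)
  have "A' \<subseteq> {1..<j}"
  proof
    fix i assume i: "i \<in> A'"
    have "i < j"
    proof (rule ccontr)
      assume "\<not> i < j"
      then have "m' j \<le> m' i"
        using m' j by (auto simp: neumann_spectrum_def intro: mono_onD[of "{1..}"])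
      then show False using i less by (simp add: A'_def)
    qed
    then show "i \<in> {1..<j}" using i by (simp add: A'_def)
  qed
  then have "A' \<subseteq> A" using eq by (force simp: A_def A'_def)
  moreover have "j \<in> A" "j \<notin> A'" using j less by (auto simp: A_def A'_def)
  ultimately have "A' \<subset> A" by blast
  moreover have "finite A"
  proof -
    obtain N where "\<And>n. n \<ge> N \<Longrightarrow> m n \<ge> m j + 1"
      using m unfolding neumann_spectrum_def filterlim_at_top eventually_sequentially by blast
    then have "A \<subseteq> {..<N}" unfolding A_def by (force simp: not_less[symmetric])
    then show ?thesis using finite_subset by blast
  qed
  ultimately show False using card psubset_card_mono[of A A'] by simp
qed

text \<open>Makes the definite description in \<open>neumann_eigenvalue\<close> denote.\<close>

lemma neumann_spectrum_unique:
  assumes "neumann_spectrum \<Omega> m" "neumann_spectrum \<Omega> m'" "j \<ge> 1"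
  shows "m j = m' j"
  using assms(3)
proof (induction j rule: less_induct)
  case (less j)
  then show ?case
    using neumann_spectrum_le[OF assms(1,2), of j] neumann_spectrum_le[OF assms(2,1), of j] by force
qed

lemma neumann_eigenvalue_eq:
  assumes "neumann_spectrum \<Omega> m" "j \<ge> 1"
  shows "neumann_eigenvalue \<Omega> j = m j"
  unfolding neumann_eigenvalue_def
  using assms neumann_spectrum_unique by (intro the_equality) blast+

section \<open>Diameters and the comparison of an ellipse with a disk\<close>

text \<open>The ellipse is open and misses its vertices c + a e and c - a e, so points at a fraction
  t < 1 of the way are used. A lower bound is the right direction because this diameter multiplies
  the larger side.\<close>

lemma diameter_ellipse_ge:
  fixes c e f :: "real^2"
  assumes "norm e = 1" "e \<bullet> f = 0" "a > 0" "b > 0" and bounded: "bounded E"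
    and E: "E = {x. (((x - c) \<bullet> e) / a)\<^sup>2 + (((x - c) \<bullet> f) / b)\<^sup>2 < 1}"
  shows "2 * a \<le> diameter E"
proof (rule field_le_mult_one_interval)
  fix t :: real assume t: "0 < t" "t < 1"
  have in_E: "c + (s * a) *\<^sub>R e \<in> E" if "\<bar>s\<bar> = t" for s
  proof -
    have "s\<^sup>2 = t\<^sup>2" using that by (metis power2_abs)
    also have "\<dots> < 1" using t by (simp add: abs_square_less_1)
    finally show ?thesis using assms(1-4) by (simp add: E norm_eq_1)
  qed
  have "dist (c + (t * a) *\<^sub>R e) (c + (- t * a) *\<^sub>R e) \<le> diameter E"
    using t by (intro diameter_bounded_bound bounded in_E) auto
  moreover have "(c + (t * a) *\<^sub>R e) - (c + (- t * a) *\<^sub>R e) = (2 * t * a) *\<^sub>R e"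
    unfolding add_diff_cancel_left scaleR_left_diff_distrib[symmetric] by simp
  ultimately have "norm ((2 * t * a) *\<^sub>R e) \<le> diameter E" unfolding dist_norm by (simp only:)
  then show "t * (2 * a) \<le> diameter E"
    using t assms(1,3) by (simp add: mult_ac)
qed

lemma ball_eq_norm: "ball c r = {x. norm (x - c) < r}"
  unfolding ball_def dist_norm by (simp add: norm_minus_commute)

lemma ellipse_disk_comparison:
  assumes j: "j \<ge> 2" and E: "ellipse_frame e f a b" and ab: "a > b"
    and E_def: "E = {x. (((x - c) \<bullet> e) / a)\<^sup>2 + (((x - c) \<bullet> f) / b)\<^sup>2 < 1}"
    and r: "r > 0"
  shows "neumann_eigenvalue (ball c' r) j * (diameter (ball c' r :: (real^2) set))\<^sup>2
    < neumann_eigenvalue E j * (diameter E)\<^sup>2"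
proof -
  interpret E: ellipse_frame c e f a b by (rule E)
  \<comment> \<open>The disk is the ellipse with both semi-axes r in the standard frame, which gives
    \<kappa> = 1.\<close>
  interpret B: ellipse_frame c' e1 e2 r r by unfold_locales (use r in \<open>auto simp: inner_axis_axis\<close>)
  have E_eq: "E.T ` disc = E" using E.image_disc E_def by simp
  have B_eq: "B.T ` disc = ball c' r"
  proof -
    have "((y $ 1) / r)\<^sup>2 + ((y $ 2) / r)\<^sup>2 < 1 \<longleftrightarrow> norm y < r" for y :: "real^2"
    proof -
      have "((y $ 1) / r)\<^sup>2 + ((y $ 2) / r)\<^sup>2 < 1 \<longleftrightarrow> (norm y)\<^sup>2 < r\<^sup>2"
        using r by (simp add: norm_vec2 power_divide field_simps)
      also have "\<dots> \<longleftrightarrow> norm y < r" using r by (simp only: not_le[symmetric] abs_le_square_iff[symmetric]) simp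
      finally show ?thesis .
    qed
    from this[of "_ - c'"] show ?thesis
      unfolding B.image_disc ball_eq_norm[of c' r] cart_eq_inner_axis by simp
  qed
  have kB: "B.\<kappa> = 1" using r by (simp add: B.\<kappa>_def)
  have kE: "E.\<kappa> > 1" using ab E.pos by (simp add: E.\<kappa>_def power_divide power_strict_mono)
  obtain w n where w: "energy_form.spectral_basis H1 (form E.\<kappa>) w n"
    using energy_form.spectral_basis_exists[OF energy_form_disc[OF E.\<kappa>_pos]] by blast
  obtain v m where v: "energy_form.spectral_basis H1 (form 1) v m"
    using energy_form.spectral_basis_exists[OF energy_form_disc[of 1]] by auto
  have less: "m (j - 1) < n (j - 1)"
    using j by (intro disc_eigenvalue_strict_mono[OF kE _ v w]) simp
  have muE: "neumann_eigenvalue E j = n (j - 1) / a\<^sup>2"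
    using neumann_eigenvalue_eq[OF E.neumann_spectrum_ellipse[OF w], of j] j E_eq by simp
  have muB: "neumann_eigenvalue (ball c' r) j = m (j - 1) / r\<^sup>2"
    using neumann_eigenvalue_eq[OF B.neumann_spectrum_ellipse[unfolded kB, OF v], of j] j B_eq by simp
  \<comment> \<open>Nonnegativity allows the lower bound on the squared diameter to be multiplied by
    the eigenvalue.\<close>
  have n0: "0 \<le> n (j - 1)"
  proof -
    interpret F: energy_form H1 "form E.\<kappa>" by (rule energy_form_disc[OF E.\<kappa>_pos])
    note S = F.spectral_basisD[OF w]
    show ?thesis
      using F.form_nonneg[of "snd (w (j - 1))"] S(7)[OF S(3), of "j - 1" "j - 1"] S(2)[of "j - 1" "j - 1"] by simp
  qed
  have "neumann_eigenvalue (ball c' r) j * (diameter (ball c' r :: (real^2) set))\<^sup>2 = 4 * m (j - 1)"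
    using r by (simp add: muB diameter_ball power_mult_distrib)
  also have "\<dots> < 4 * n (j - 1)" using less by simp
  also have "\<dots> = n (j - 1) / a\<^sup>2 * (2 * a)\<^sup>2" using E.pos by (simp add: power_mult_distrib)
  also have "\<dots> \<le> neumann_eigenvalue E j * (diameter E)\<^sup>2"
  proof -
    have "bounded E" using E.affine.bounded_image[of disc] E_eq by simp
    then have "2 * a \<le> diameter E"
      using E.unit E.orth E.pos by (intro diameter_ellipse_ge[OF _ _ _ _ _ E_def])
    then have "(2 * a)\<^sup>2 \<le> (diameter E)\<^sup>2" using E.pos by (intro power_mono) auto
    then show ?thesis unfolding muE using n0 E.pos by (intro mult_left_mono) auto
  qed
  finally show ?thesis .
qed

theorem proposition1p3:
  fixes E B :: "(real^2) set" and j :: nat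
  assumes "j \<ge> 2"
    and "is_ellipse E" and "\<not> is_disk E"
    and "is_disk B"
  shows "neumann_eigenvalue E j * (diameter E)\<^sup>2 > neumann_eigenvalue B j * (diameter B)\<^sup>2"
proof -
  obtain c' r where B: "r > 0" "B = ball c' r" using assms(4) unfolding is_disk_def by blast
  obtain c e f a b where E: "norm e = 1" "norm f = 1" "e \<bullet> f = 0" "a > 0" "b > 0"
    and E_def: "E = {x. (((x - c) \<bullet> e) / a)\<^sup>2 + (((x - c) \<bullet> f) / b)\<^sup>2 < 1}"
    using assms(2) unfolding is_ellipse_def by blast
  \<comment> \<open>Equal semi-axes would make the ellipse a disk, by Pythagoras in the frame e,
    f.\<close>
  have "a \<noteq> b"
  proof
    assume ab: "a = b"
    have "((y \<bullet> e) / a)\<^sup>2 + ((y \<bullet> f) / b)\<^sup>2 < 1 \<longleftrightarrow> norm y < a" for y :: "real^2"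
    proof -
      have "(norm y)\<^sup>2 = y \<bullet> ((y \<bullet> e) *\<^sub>R e + (y \<bullet> f) *\<^sub>R f)"
        by (simp add: power2_norm_eq_inner flip: orthonormal_expansion_2[OF E(1-3)])
      then have n: "(norm y)\<^sup>2 = (y \<bullet> e)\<^sup>2 + (y \<bullet> f)\<^sup>2" by (simp add: inner_add_right power2_eq_square)
      have "((y \<bullet> e) / a)\<^sup>2 + ((y \<bullet> f) / b)\<^sup>2 < 1 \<longleftrightarrow> (norm y)\<^sup>2 < a\<^sup>2"
        using E(4) unfolding ab[symmetric] n by (simp add: power_divide field_simps)
      also have "\<dots> \<longleftrightarrow> norm y < a" using E(4) by (simp only: not_le[symmetric] abs_le_square_iff[symmetric]) simp
      finally show ?thesis .
    qed
    from this[of "_ - c"] have "E = ball c a" unfolding E_def ball_eq_norm by simp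
    then show False using assms(3) E(4) unfolding is_disk_def by blast
  qed
  then consider "a > b" | "b > a" by linarith
  then show ?thesis
  proof cases
    case 1
    have "ellipse_frame e f a b" using E by unfold_locales
    from ellipse_disk_comparison[OF assms(1) this 1 E_def B(1)] show ?thesis unfolding B(2) .
  next
    case 2
    \<comment> \<open>Swapping the axes puts the longer one first.\<close>
    have "ellipse_frame f e b a" using E by unfold_locales (simp_all add: inner_commute)
    from ellipse_disk_comparison[OF assms(1) this 2 _ B(1)] show ?thesis
      unfolding B(2) E_def by (simp add: add.commute)
  qed
qed

end
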